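(* Let $P_f^{(n)}$ be the distribution of $(X_1,\dots,X_n)$ for a stationary Gaussian time series $\{X_t:t=0,\pm1,\dots\}$ with mean zero and spectral density $f\in\mathcal{F}$. Assume that there exist constants $\Gamma$ and $M$ such that $\|\log f\|_\infty\le\Gamma$ and $\sum_h|h|\gamma_h^2(f)\le M$ for every $f\in\mathcal{F}$. Let $\varepsilon_n\ge1/\sqrt n$ satisfy, for every $j\in\mathbb{N}$, $$\sup_{\varepsilon>\varepsilon_n}\log N\bigl(\xi\varepsilon/2,\{f\in\mathcal{F}:\|f-f_0\|_2\le\varepsilon\},\|\cdot\|_\infty\bigr)\le n\varepsilon_n^2,$$ $$\frac{\Pi(f:\|f-f_0\|_2\le j\varepsilon_n)}{\Pi(f:\|f-f_0\|_2\le\varepsilon_n)}\lesssim e^{Kn\varepsilon_n^2j^2/8},$$ where $\xi$ and $K$ are the testing constants (depending only on $\Gamma$ and $M$) specified in the context. Then $P_{f_0}^{(n)}\Pi(f:\|f-f_0\|_2\ge M_n\varepsilon_n\mid X_1,\dots,X_n)\to0$ for every $M_n\to\infty$.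
   Context: $\mathcal{F}$ is a class of spectral densities $f:(-\pi,\pi]\to\mathbb{R}$, with autocovariances $\gamma_h(f)=\int_{-\pi}^\pi e^{ih\lambda}f(\lambda)\,d\lambda$, $h\in\mathbb{Z}$. $\|\cdot\|_2$ is the $L_2$-norm relative to Lebesgue measure on $(-\pi,\pi]$ and $\|\cdot\|_\infty$ the uniform norm. $\Pi$ is a prior probability measure on $\mathcal{F}$ and $\Pi(\cdot\mid X_1,\dots,X_n)$ the posterior given by Bayes' formula; $f_0\in\mathcal{F}$ is the fixed true spectral density; $Pg=\int g\,dP$. $\lesssim$ denotes inequality up to a fixed multiplicative constant. $N(\varepsilon,A,\|\cdot\|_\infty)$ is the minimal number of $\|\cdot\|_\infty$-balls of radius $\varepsilon$ needed to cover $A$. Testing constants: under the assumed bounds $\|\log f\|_\infty\le\Gamma$, $\sum_h|h|\gamma_h^2(f)\le M$ for all $f\in\mathcal{F}$, there exist constants $\xi>0$, $K>0$ and $c_0>0$ depending only on $\Gamma$ and $M$ such that for every $n$, every $\varepsilon\ge c_0/\sqrt n$ and every $f_0,f_1\in\mathcal{F}$ with $\|f_1-f_0\|_2\ge\varepsilon$ there is a test $\phi_n$ with $P_{f_0}^{(n)}\phi_n\vee\sup_{f\in\mathcal{F}:\|f-f_1\|_\infty\le\xi\varepsilon}P_f^{(n)}(1-\phi_n)\le e^{-Kn\varepsilon^2}$ (a consequence of results of Birgé). $\xi$ and $K$ denote these constants. *)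

theory Defs
  imports "HOL-Probability.Probability"
begin

text \<open>
  Functions on the circle \<open>(-\<pi>, \<pi>]\<close> are represented by functions on the reals;
  nothing below looks at values outside \<open>{-pi<..pi}\<close>.
\<close>

definition autocov :: "(real \<Rightarrow> real) \<Rightarrow> int \<Rightarrow> complex" where
  "autocov f h =
     (LINT l:{-pi<..pi}|lborel. exp (\<i> * of_int h * of_real l) * complex_of_real (f l))"

text \<open>The real integral is meaningful for the differences of bounded measurable functions
  to which it is applied.\<close>

definition l2_norm :: "(real \<Rightarrow> real) \<Rightarrow> real" where
  "l2_norm g = sqrt (LINT l:{-pi<..pi}|lborel. (g l)\<^sup>2)"

definition sup_norm :: "(real \<Rightarrow> real) \<Rightarrow> ereal" where
  "sup_norm g = (SUP l\<in>{-pi<..pi}. ereal \<bar>g l\<bar>)"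

text \<open>The series is real valued, so its autocovariances are real: this is the symmetry
  condition, which is required only almost everywhere.\<close>

definition spectral_density :: "(real \<Rightarrow> real) \<Rightarrow> bool" where
  "spectral_density f \<longleftrightarrow>
     (\<forall>l\<in>{-pi<..pi}. 0 \<le> f l) \<and>
     set_integrable lborel {-pi<..pi} f \<and>
     (AE l in lborel. l \<in> {-pi<..<pi} \<longrightarrow> f (- l) = f l)"

text \<open>Positivity is explicit because \<open>ln 0 = 0\<close>. For a spectral density,
  \<open>(cmod (autocov f h))\<^sup>2\<close> is the square of a real number.\<close>

definition regular_density :: "real \<Rightarrow> real \<Rightarrow> (real \<Rightarrow> real) \<Rightarrow> bool" where
  "regular_density \<Gamma> M f \<longleftrightarrow>
     spectral_density f \<and>
     (\<forall>l\<in>{-pi<..pi}. 0 < f l) \<and>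
     sup_norm (\<lambda>l. ln (f l)) \<le> ereal \<Gamma> \<and>
     (\<lambda>h::int. real_of_int \<bar>h\<bar> * (cmod (autocov f h))\<^sup>2) summable_on UNIV \<and>
     (\<Sum>\<^sub>\<infinity>h::int. real_of_int \<bar>h\<bar> * (cmod (autocov f h))\<^sup>2) \<le> M"

text \<open>Univariate normal random variables; \<open>\<sigma> = 0\<close> is the degenerate case.\<close>

definition normal_rv :: "'w measure \<Rightarrow> ('w \<Rightarrow> real) \<Rightarrow> bool" where
  "normal_rv W Y \<longleftrightarrow>
     (\<exists>m \<sigma>. (\<sigma> = 0 \<and> Y \<in> borel_measurable W \<and> (AE w in W. Y w = m)) \<or>
            (\<sigma> > 0 \<and> distributed W lborel Y (\<lambda>x. ennreal (normal_density m \<sigma> x))))"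

definition gaussian_process :: "'w measure \<Rightarrow> ('t \<Rightarrow> 'w \<Rightarrow> real) \<Rightarrow> bool" where
  "gaussian_process W X \<longleftrightarrow>
     prob_space W \<and>
     (\<forall>t. X t \<in> borel_measurable W) \<and>
     (\<forall>S a. finite S \<longrightarrow> normal_rv W (\<lambda>w. \<Sum>t\<in>S. a t * X t w))"

text \<open>Stationarity is contained in the last clause: the mean is constant and the covariance
  depends on the lag only.\<close>

definition stationary_gaussian_series ::
  "'w measure \<Rightarrow> (int \<Rightarrow> 'w \<Rightarrow> real) \<Rightarrow> (real \<Rightarrow> real) \<Rightarrow> bool" where
  "stationary_gaussian_series W X f \<longleftrightarrow>
     gaussian_process W X \<and>
     (\<forall>t. (LINT w|W. X t w) = 0) \<and>
     (\<forall>t h. complex_of_real (LINT w|W. X (t + h) w * X t w) = autocov f h)"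

abbreviation sample_space :: "nat \<Rightarrow> (nat \<Rightarrow> real) measure" where
  "sample_space n \<equiv> PiM {1..n} (\<lambda>_. borel)"

definition sample_law ::
  "'w measure \<Rightarrow> (int \<Rightarrow> 'w \<Rightarrow> real) \<Rightarrow> nat \<Rightarrow> (nat \<Rightarrow> real) measure" where
  "sample_law W X n = distr W (sample_space n) (\<lambda>w. \<lambda>t\<in>{1..n}. X (int t) w)"

definition is_test :: "nat \<Rightarrow> ((nat \<Rightarrow> real) \<Rightarrow> real) \<Rightarrow> bool" where
  "is_test n \<phi> \<longleftrightarrow>
     \<phi> \<in> borel_measurable (sample_space n) \<and>
     (\<forall>x\<in>space (sample_space n). 0 \<le> \<phi> x \<and> \<phi> x \<le> 1)"

text \<open>Here \<open>P n f\<close> stands for the law of the first \<open>n\<close> observations under \<open>f\<close>. That the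
  constants depend on \<open>\<Gamma>\<close> and \<open>M\<close> only is expressed by the quantifier over all classes \<open>G\<close>
  obeying these bounds. The supremum is over a nonempty set (it contains \<open>f1\<close>) of numbers
  in \<open>[0, 1]\<close>.\<close>

definition testing_constants ::
  "(nat \<Rightarrow> (real \<Rightarrow> real) \<Rightarrow> (nat \<Rightarrow> real) measure) \<Rightarrow> real \<Rightarrow> real \<Rightarrow> real \<Rightarrow> real \<Rightarrow> bool" where
  "testing_constants P \<Gamma> M \<xi> K \<longleftrightarrow>
     \<xi> > 0 \<and> K > 0 \<and>
     (\<exists>c0>0. \<forall>G. (\<forall>f\<in>G. regular_density \<Gamma> M f) \<longrightarrow>
        (\<forall>n\<ge>1. \<forall>e\<ge>c0 / sqrt (real n). \<forall>f0\<in>G. \<forall>f1\<in>G.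
           l2_norm (\<lambda>l. f1 l - f0 l) \<ge> e \<longrightarrow>
           (\<exists>\<phi>. is_test n \<phi> \<and>
              max (LINT x|P n f0. \<phi> x)
                  (SUP f\<in>{f\<in>G. sup_norm (\<lambda>l. f l - f1 l) \<le> ereal (\<xi> * e)}.
                     LINT x|P n f. 1 - \<phi> x)
              \<le> exp (- K * real n * e\<^sup>2))))"

text \<open>The centres of the balls are arbitrary functions, not necessarily elements of \<open>A\<close>.
  The value is \<open>\<infinity>\<close> if there is no finite cover.\<close>

definition covering_number :: "real \<Rightarrow> (real \<Rightarrow> real) set \<Rightarrow> enat" where
  "covering_number e A =
     (INF S\<in>{S. finite S \<and> A \<subseteq> (\<Union>c\<in>S. {g. sup_norm (\<lambda>l. g l - c l) \<le> ereal e})}.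
        enat (card S))"

definition log_covering_number :: "real \<Rightarrow> (real \<Rightarrow> real) set \<Rightarrow> ereal" where
  "log_covering_number e A =
     (case covering_number e A of enat k \<Rightarrow> ereal (ln (real k)) | \<infinity> \<Rightarrow> \<infinity>)"

text \<open>Jointly measurable densities \<open>p f\<close> of the laws \<open>Q f\<close> with respect to a
  sigma-finite measure \<open>\<mu>\<close>, as needed for Bayes' formula.\<close>

definition dominated_model ::
  "'f measure \<Rightarrow> ('f \<Rightarrow> 'x measure) \<Rightarrow> 'x measure \<Rightarrow> ('f \<Rightarrow> 'x \<Rightarrow> ennreal) \<Rightarrow> bool" where
  "dominated_model Pr Q \<mu> p \<longleftrightarrow>
     sigma_finite_measure \<mu> \<and>
     (\<lambda>(f, x). p f x) \<in> borel_measurable (Pr \<Otimes>\<^sub>M \<mu>) \<and>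
     (\<forall>f\<in>space Pr. Q f = density \<mu> (p f))"

text \<open>Bayes' formula. The convention \<open>0 / 0 = 0\<close> concerns only observations at which the
  marginal density vanishes.\<close>

definition posterior ::
  "'f measure \<Rightarrow> ('f \<Rightarrow> 'x \<Rightarrow> ennreal) \<Rightarrow> 'f set \<Rightarrow> 'x \<Rightarrow> ennreal" where
  "posterior Pr p A x = (\<integral>\<^sup>+f\<in>A. p f x \<partial>Pr) / (\<integral>\<^sup>+f. p f x \<partial>Pr)"

end

theory Submission
  imports Defs "HOL-Real_Asymp.Real_Asymp"
begin

text \<open>The posterior mass of the shells \<open>j \<epsilon> < d(f, f0) \<le> (j + 1) \<epsilon>\<close> is controlled by tests (numerator
  of Bayes' formula) and by a lower bound on the evidence (denominator).

  Both need the likelihood ratio of two of the Gaussian laws.  Diagonalizing their Toeplitz covariance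
  forms simultaneously turns it into a product of ratios of univariate normal densities with
  variances \<open>e i\<close> and \<open>1\<close>, whose moments of order \<open>1 + \<alpha>\<close> are of size \<open>exp (c (\<Sum>i. (e i - 1)\<^sup>2))\<close>, and
  \<open>\<Sum>i. (e i - 1)\<^sup>2 \<lesssim> n d(f, g)\<^sup>2\<close> because the reproducing kernel of the covariance form is bounded by a
  multiple of \<open>n\<close> on its diagonal.  Markov's inequality then yields the evidence bound.

  A ball of the cover, once centred in the class, has radius \<open>\<xi> (j + 1) \<epsilon>\<close>, which exceeds the
  testing radius \<open>\<xi> j \<epsilon>\<close>.  The densities satisfying the bounds form a convex set, so a density in the larger ball
  can be moved into the smaller one at uniform distance at most \<open>\<xi> \<epsilon>\<close>; the change of measure costs
  half of the exponent of the test and a factor \<open>exp (c n \<epsilon>\<^sup>2)\<close>, negligible for large \<open>j\<close>.\<close>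

section \<open>Laws determined by characteristic functions\<close>

text \<open>Three obstacles shape the argument. The model describes linear combinations of the
  series, that is, joint characteristic functions. Product laws of coordinates are recovered from
  them by one-dimensional uniqueness, one coordinate at a time. Two regular densities are comparable
  only up to the factor \<open>exp (2 * \<Gamma>)\<close>, so the second moment of their likelihood
  ratio may be infinite. The evidence bound therefore works with the small order \<alpha> =
  \<open>exp (- 2 * \<Gamma>) / 2\<close>, whereas the tests compare densities of which one is at
  most 3/2 times the other and can afford \<alpha> = 1. As \<open>F\<close> need not be convex, the
  tests are taken for the class of all regular densities, which contains the segments used. The rate
  only guarantees that \<open>n * \<epsilon>^2\<close> is at least 1, so for fixed constants the
  error bound need not vanish. The evidence threshold \<open>exp (- D * n * \<epsilon>^2)\<close>
  has a free constant \<open>D\<close>: a large \<open>D\<close> makes failure of the evidence bound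
  unlikely, a large \<open>J\<close> depending on \<open>D\<close> makes the shells from
  \<open>J\<close> on negligible, and only then \<open>n\<close> grows until \<open>Mn n\<close>
  exceeds \<open>J\<close>.\<close>

lemma weighted_law_eqI:
  assumes "prob_space W"
    and Y [measurable]: "Y \<in> borel_measurable W" and w [measurable]: "w \<in> borel_measurable W"
    and w_bounds: "\<And>x. 0 \<le> w x" "\<And>x. w x \<le> c"
    and \<nu>: "real_distribution \<nu>"
    and char_eq: "\<And>s. (CLINT x|W. complex_of_real (w x) * iexp (s * Y x))
      = complex_of_real (LINT x|W. w x) * char \<nu> s"
    and A [measurable]: "A \<in> sets borel"
  shows "(LINT x|W. w x * indicator A (Y x)) = (LINT x|W. w x) * measure \<nu> A"
proof -
  interpret W: prob_space W by fact
  interpret N: real_distribution \<nu> by fact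
  have int_w: "integrable W w"
    by (rule W.integrable_const_bound[of _ c]) (use w_bounds in auto)
  define E where "E = (LINT x|W. w x)"
  have E0: "E \<ge> 0" unfolding E_def using w_bounds by simp
  show ?thesis
  proof (cases "E = 0")
    case True
    then have "AE x in W. w x = 0"
      using integral_nonneg_eq_0_iff_AE[OF int_w] w_bounds by (auto simp: E_def)
    then have "(LINT x|W. w x * indicator A (Y x)) = (LINT x|W. 0)"
      by (intro integral_cong_AE) auto
    then show ?thesis using True by (simp add: E_def)
  next
    case False
    then have Epos: "E > 0" using E0 by simp
    \<comment> \<open>The hypothesis says that under the probability with density
      \<open>w / E\<close> the characteristic function of \<open>Y\<close> is that of
      \<open>\<nu>\<close>; Levy's uniqueness theorem then identifies the two laws.\<close>
    define M where "M = density W (\<lambda>x. ennreal (w x / E))"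
    have [measurable_cong]: "sets M = sets W" by (simp add: M_def)
    have "emeasure M (space M) = (\<integral>\<^sup>+x. ennreal (w x / E) \<partial>W)"
      by (simp add: M_def emeasure_density space_density cong: nn_integral_cong_simp)
    also have "\<dots> = ennreal (LINT x|W. w x / E)"
      using int_w w_bounds E0 by (intro nn_integral_eq_integral) auto
    also have "\<dots> = 1" using Epos by (simp add: E_def)
    finally interpret M: prob_space M by (rule prob_spaceI)
    define N where "N = distr M borel Y"
    interpret NN: real_distribution N unfolding N_def
      by (rule M.real_distribution_distr) (simp)
    have "char N s = char \<nu> s" for s
    proof -
      have "char N s = (CLINT x|M. iexp (s * Y x))"
        unfolding char_def N_def by (subst integral_distr) auto
      also have "\<dots> = (CLINT x|W. (w x / E) *\<^sub>R iexp (s * Y x))"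
        unfolding M_def by (subst integral_density) (use w_bounds E0 in auto)
      also have "\<dots> = (CLINT x|W. (1/E) *\<^sub>R (complex_of_real (w x) * iexp (s * Y x)))"
        by (intro Bochner_Integration.integral_cong) (auto simp: scaleR_conv_of_real)
      also have "\<dots> = (1/E) *\<^sub>R (complex_of_real E * char \<nu> s)"
        unfolding integral_scaleR_right char_eq E_def ..
      also have "\<dots> = char \<nu> s" using Epos by (simp add: scaleR_conv_of_real)
      finally show ?thesis .
    qed
    then have "N = \<nu>"
      by (intro Levy_uniqueness) (auto simp: NN.real_distribution_axioms \<nu>)
    then have "measure \<nu> A = (LINT x|M. indicator A (Y x))"
      using integral_distr[of Y M borel "indicator A :: real \<Rightarrow> real"]
      by (simp add: N_def)
    also have "\<dots> = (LINT x|W. (w x / E) *\<^sub>R indicator A (Y x))"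
      unfolding M_def by (subst integral_density) (use w_bounds E0 in auto)
    also have "\<dots> = (LINT x|W. (w x * indicator A (Y x)) / E)" by (simp add: field_simps)
    also have "\<dots> = (LINT x|W. w x * indicator A (Y x)) / E" by simp
    finally show ?thesis using Epos by (simp add: E_def field_simps)
  qed
qed

text \<open>Here the weights \<open>w (1 + cos U)\<close> and \<open>w (1 + sin U)\<close> reduce the complex measure
  to positive ones.\<close>

lemma weighted_law_complex_eqI:
  assumes "prob_space W"
    and Y [measurable]: "Y \<in> borel_measurable W" and w [measurable]: "w \<in> borel_measurable W"
    and U [measurable]: "U \<in> borel_measurable W"
    and w_bounds: "\<And>x. 0 \<le> w x" "\<And>x. w x \<le> 1"
    and \<nu>: "real_distribution \<nu>"
    and c0: "\<And>s. (CLINT x|W. complex_of_real (w x) * iexp (s * Y x)) = c0 * char \<nu> s"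
    and c1: "\<And>s. (CLINT x|W. complex_of_real (w x) * iexp (U x + s * Y x)) = c1 * char \<nu> s"
    and c2: "\<And>s. (CLINT x|W. complex_of_real (w x) * iexp (- U x + s * Y x)) = c2 * char \<nu> s"
    and A [measurable]: "A \<in> sets borel"
  shows "(CLINT x|W. complex_of_real (w x * indicator A (Y x)) * iexp (U x)) = c1 * measure \<nu> A"
proof -
  interpret W: prob_space W by fact
  interpret N: real_distribution \<nu> by fact
  have int: "integrable W (\<lambda>x. complex_of_real (w x * h x) * iexp (V x))"
    if [measurable]: "h \<in> borel_measurable W" "V \<in> borel_measurable W" and "\<And>x. \<bar>h x\<bar> \<le> 2" for h V
    by (rule W.integrable_const_bound[of _ 2])
      (use w_bounds that mult_mono[of "w _" 1 "\<bar>h _\<bar>" 2] in \<open>auto simp: norm_mult abs_mult\<close>)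
  have rint: "integrable W (\<lambda>x. w x * h x)"
    if [measurable]: "h \<in> borel_measurable W" and "\<And>x. \<bar>h x\<bar> \<le> 2" for h
    by (rule W.integrable_const_bound[of _ 2])
      (use w_bounds that mult_mono[of "w _" 1 "\<bar>h _\<bar>" 2] in \<open>auto simp: norm_mult abs_mult\<close>)
  have int': "integrable W (\<lambda>x. complex_of_real (w x) * iexp (V x))"
    if [measurable]: "V \<in> borel_measurable W" for V
    using int[of "\<lambda>_. 1" V] by simp
  have char0: "char \<nu> 0 = 1" by (rule N.char_zero)
  have c0': "c0 = complex_of_real (LINT x|W. w x)"
    using c0[of 0] by (simp add: char0)
  have c1': "c1 = (CLINT x|W. complex_of_real (w x) * iexp (U x))" using c1[of 0] by (simp add: char0)
  have c2': "c2 = (CLINT x|W. complex_of_real (w x) * iexp (- U x))" using c2[of 0] by (simp add: char0)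
  have cosE: "complex_of_real (cos u) = (iexp u + iexp (- u)) / 2" for u :: real
    by (simp add: cos_exp_eq flip: cos_of_real)
  have sinE: "complex_of_real (sin u) = (iexp u - iexp (- u)) / (2 * \<i>)" for u :: real
    by (simp add: sin_exp_eq flip: sin_of_real)
  \<comment> \<open>Cosine and sine combine the phases \<open>U\<close> and \<open>- U\<close>, and
    the constant in \<open>1 + cos U\<close> is the phase 0; this is why all of \<open>c0\<close>,
    \<open>c1\<close>, \<open>c2\<close> are required.\<close>
  have cos_s: "(CLINT x|W. complex_of_real (w x * cos (U x)) * iexp (s * Y x)) = (c1 + c2) / 2 * char \<nu> s" for s
  proof -
    have "complex_of_real (w x * cos (U x)) * iexp (s * Y x)
        = (complex_of_real (w x) * iexp (U x + s * Y x) + complex_of_real (w x) * iexp (- U x + s * Y x)) / 2" for x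
      unfolding of_real_mult cosE by (simp add: field_simps exp_add exp_diff exp_minus)
    then have "(CLINT x|W. complex_of_real (w x * cos (U x)) * iexp (s * Y x)) =
       (CLINT x|W. (complex_of_real (w x) * iexp (U x + s * Y x) + complex_of_real (w x) * iexp (- U x + s * Y x)) / 2)"
      by presburger
    also have "\<dots> = (c1 * char \<nu> s + c2 * char \<nu> s) / 2"
      unfolding integral_divide_zero
      by (subst Bochner_Integration.integral_add; (rule int')?; (simp only: c1 c2)?; measurable)
    finally show ?thesis by (simp add: field_simps)
  qed
  have sin_s: "(CLINT x|W. complex_of_real (w x * sin (U x)) * iexp (s * Y x)) = (c1 - c2) / (2 * \<i>) * char \<nu> s" for s
  proof -
    have "complex_of_real (w x * sin (U x)) * iexp (s * Y x)
        = (complex_of_real (w x) * iexp (U x + s * Y x) - complex_of_real (w x) * iexp (- U x + s * Y x)) / (2*\<i>)" for x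
      unfolding of_real_mult sinE by (simp add: field_simps exp_add exp_diff exp_minus)
    then have "(CLINT x|W. complex_of_real (w x * sin (U x)) * iexp (s * Y x)) =
       (CLINT x|W. (complex_of_real (w x) * iexp (U x + s * Y x) - complex_of_real (w x) * iexp (- U x + s * Y x)) / (2*\<i>))"
      by presburger
    also have "\<dots> = (c1 * char \<nu> s - c2 * char \<nu> s) / (2*\<i>)"
      unfolding integral_divide_zero
      by (subst Bochner_Integration.integral_diff; (rule int')?; (simp only: c1 c2)?; measurable)
    finally show ?thesis by (simp add: field_simps)
  qed
  have main: "(LINT x|W. w x * h x * indicator A (Y x)) = (LINT x|W. w x * h x) * measure \<nu> A"
    if h[measurable]: "h \<in> borel_measurable W" and hb: "\<And>x. \<bar>h x\<bar> \<le> 1"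
      and d: "\<And>s. (CLINT x|W. complex_of_real (w x * h x) * iexp (s * Y x)) = d * char \<nu> s" for h d
  proof -
    have d': "d = complex_of_real (LINT x|W. w x * h x)"
      using d[of 0] by (simp add: char0 flip: of_real_mult)
    have h0: "0 \<le> 1 + h x" "1 + h x \<le> 2" "\<bar>h x\<bar> \<le> 2" for x using hb[of x] by auto
    have split: "w x * (1 + h x) = w x + w x * h x" for x by (simp add: algebra_simps)
    have i1: "integrable W w" using rint[of "\<lambda>_. 1"] by simp
    have i2: "integrable W (\<lambda>x. w x * h x)" by (rule rint) (use h0 in auto)
    have "(LINT x|W. (w x * (1 + h x)) * indicator A (Y x)) = (LINT x|W. w x * (1 + h x)) * measure \<nu> A"
    proof (rule weighted_law_eqI[where c=2])
      show "0 \<le> w x * (1 + h x)" for x using w_bounds h0 by simp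
      show "w x * (1 + h x) \<le> 2" for x using mult_mono[of "w x" 1 "1 + h x" 2] w_bounds h0 by auto
      fix s
      have "(CLINT x|W. complex_of_real (w x * (1 + h x)) * iexp (s * Y x))
        = (CLINT x|W. complex_of_real (w x) * iexp (s * Y x) + complex_of_real (w x * h x) * iexp (s * Y x))"
        unfolding split by (simp add: algebra_simps)
      also have "\<dots> = c0 * char \<nu> s + d * char \<nu> s"
        by (subst Bochner_Integration.integral_add; (rule int' int)?; (simp only: c0 d)?; (rule h0)?; measurable)
      also have "\<dots> = complex_of_real (LINT x|W. w x * (1 + h x)) * char \<nu> s"
        unfolding split Bochner_Integration.integral_add[OF i1 i2] c0' d' by (simp add: algebra_simps)
      finally show "(CLINT x|W. complex_of_real (w x * (1 + h x)) * iexp (s * Y x))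
         = complex_of_real (LINT x|W. w x * (1 + h x)) * char \<nu> s" .
    qed (use assms in auto)
    moreover have "(LINT x|W. w x * indicator A (Y x)) = (LINT x|W. w x) * measure \<nu> A"
      by (rule weighted_law_eqI[where c=1]) (use assms c0' in auto)
    moreover have "(LINT x|W. (w x * (1 + h x)) * indicator A (Y x))
       = (LINT x|W. w x * indicator A (Y x)) + (LINT x|W. w x * h x * indicator A (Y x))"
    proof -
      have "(LINT x|W. (w x * (1 + h x)) * indicator A (Y x))
        = (LINT x|W. w x * indicator A (Y x) + w x * (h x * indicator A (Y x)))"
        by (simp add: algebra_simps)
      also have "\<dots> = (LINT x|W. w x * indicator A (Y x)) + (LINT x|W. w x * (h x * indicator A (Y x)))"
        by (rule Bochner_Integration.integral_add; rule rint) (use h0 in \<open>auto split: split_indicator\<close>)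
      finally show ?thesis by (simp add: mult.assoc)
    qed
    moreover have "(LINT x|W. w x * (1 + h x)) = (LINT x|W. w x) + (LINT x|W. w x * h x)"
      unfolding split using i1 i2 by simp
    ultimately show ?thesis by (simp add: algebra_simps)
  qed
  have iexp_split: "iexp u = complex_of_real (cos u) + \<i> * complex_of_real (sin u)" for u :: real
    by (simp add: cis_conv_exp[symmetric] complex_eq_iff)
  have gen: "(CLINT x|W. complex_of_real (w x * h x) * iexp (U x))
     = complex_of_real (LINT x|W. w x * cos (U x) * h x) + \<i> * complex_of_real (LINT x|W. w x * sin (U x) * h x)"
    if [measurable]: "h \<in> borel_measurable W" and hb: "\<And>x. \<bar>h x\<bar> \<le> 1" for h
  proof -
    have "(CLINT x|W. complex_of_real (w x * h x) * iexp (U x)) =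
      (CLINT x|W. complex_of_real (w x * (cos (U x) * h x)) + \<i> * complex_of_real (w x * (sin (U x) * h x)))"
      unfolding iexp_split by (simp add: algebra_simps)
    also have "\<dots> = complex_of_real (LINT x|W. w x * (cos (U x) * h x)) + \<i> * complex_of_real (LINT x|W. w x * (sin (U x) * h x))"
    proof -
      have b: "\<bar>cos (U x) * h x\<bar> \<le> 2" "\<bar>sin (U x) * h x\<bar> \<le> 2" for x
        using mult_mono[of "\<bar>cos (U x)\<bar>" 1 "\<bar>h x\<bar>" 1] mult_mono[of "\<bar>sin (U x)\<bar>" 1 "\<bar>h x\<bar>" 1] hb[of x]
        by (auto simp: abs_mult)
      have "integrable W (\<lambda>x. complex_of_real (w x * (cos (U x) * h x)))"
           "integrable W (\<lambda>x. complex_of_real (w x * (sin (U x) * h x)))"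
        by (intro integrable_of_real rint; use b in simp)+
      then show ?thesis
        by (subst Bochner_Integration.integral_add) (auto simp del: of_real_mult)
    qed
    finally show ?thesis by (simp add: mult.assoc)
  qed
  have "(CLINT x|W. complex_of_real (w x * indicator A (Y x)) * iexp (U x))
     = (complex_of_real (LINT x|W. w x * cos (U x)) + \<i> * complex_of_real (LINT x|W. w x * sin (U x))) * measure \<nu> A"
  proof -
    have "(LINT x|W. w x * cos (U x) * indicator A (Y x)) = (LINT x|W. w x * cos (U x)) * measure \<nu> A"
      by (rule main[OF _ _ cos_s]) auto
    moreover have "(LINT x|W. w x * sin (U x) * indicator A (Y x)) = (LINT x|W. w x * sin (U x)) * measure \<nu> A"
      by (rule main[OF _ _ sin_s]) auto
    ultimately show ?thesis
      by (subst gen) (auto simp: algebra_simps split: split_indicator)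
  qed
  also have "(complex_of_real (LINT x|W. w x * cos (U x)) + \<i> * complex_of_real (LINT x|W. w x * sin (U x))) = c1"
    unfolding c1' using gen[of "\<lambda>_. 1"] by simp
  finally show ?thesis .
qed

text \<open>In the factorized characteristic function the exponentials are exchanged for indicators
  one coordinate at a time: \<open>J\<close> in \<open>claim\<close> collects the coordinates
  already turned into events. With \<open>J = I\<close> the formula gives the measure of every
  rectangle, which determines the product measure.\<close>

lemma joint_law_eq_PiM:
  fixes Y :: "'i \<Rightarrow> 'w \<Rightarrow> real"
  assumes "prob_space W" and fin: "finite I"
    and Y [measurable]: "\<And>i. Y i \<in> borel_measurable W"
    and \<nu>: "\<And>i. real_distribution (\<nu> i)"
    and char_eq: "\<And>t. (CLINT x|W. iexp (\<Sum>i\<in>I. t i * Y i x)) = (\<Prod>i\<in>I. char (\<nu> i) (t i))"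
  shows "distr W (PiM I (\<lambda>_. borel)) (\<lambda>x. \<lambda>i\<in>I. Y i x) = PiM I \<nu>"
proof -
  interpret W: prob_space W by fact
  interpret R: real_distribution "\<nu> i" for i by (rule \<nu>)
  interpret P: product_prob_space \<nu> I ..
  have claim: "(CLINT x|W. complex_of_real (\<Prod>i\<in>J. indicator (A i) (Y i x)) * iexp (\<Sum>i\<in>I-J. t i * Y i x))
     = complex_of_real (\<Prod>i\<in>J. measure (\<nu> i) (A i)) * (\<Prod>i\<in>I-J. char (\<nu> i) (t i))"
    if "J \<subseteq> I" "\<And>i. i \<in> J \<Longrightarrow> A i \<in> sets borel" for J A t
    using finite_subset[OF that(1) fin] that
  proof (induction J arbitrary: t rule: finite_induct)
    case empty
    show ?case using char_eq[of t] by simp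
  next
    case (insert k J)
    have kI: "k \<in> I - J" and fIJ: "finite (I - J)" using insert fin by auto
    have IJ: "I - J - {k} = I - insert k J" by auto
    have A[measurable]: "\<And>i. i \<in> J \<Longrightarrow> A i \<in> sets borel" "A k \<in> sets borel" using insert by auto
    have IH: "(CLINT x|W. complex_of_real (\<Prod>i\<in>J. indicator (A i) (Y i x)) * iexp (\<Sum>i\<in>I-J. t i * Y i x))
     = complex_of_real (\<Prod>i\<in>J. measure (\<nu> i) (A i)) * (\<Prod>i\<in>I-J. char (\<nu> i) (t i))" for t
      using insert by auto
    define w :: "'w \<Rightarrow> real" where "w x = (\<Prod>i\<in>J. indicator (A i) (Y i x))" for x
    define U where "U x = (\<Sum>i\<in>I - insert k J. t i * Y i x)" for x
    have [measurable]: "w \<in> borel_measurable W" unfolding w_def by measurable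
    have [measurable]: "U \<in> borel_measurable W" unfolding U_def by measurable
    have w01: "0 \<le> w x" "w x \<le> 1" for x
      unfolding w_def by (auto intro!: prod_nonneg prod_le_1)
    let ?m = "complex_of_real (\<Prod>i\<in>J. measure (\<nu> i) (A i))"
    \<comment> \<open>The induction hypothesis at coefficients \<open>a * t i\<close>, and
      \<open>s\<close> at \<open>k\<close>. The values 0, 1 and -1 of \<open>a\<close> provide the
      three phases demanded by \<open>weighted_law_complex_eqI\<close>.\<close>
    have aux: "(CLINT x|W. complex_of_real (w x) * iexp (a * U x + s * Y k x))
       = ?m * (\<Prod>i\<in>I - insert k J. char (\<nu> i) (a * t i)) * char (\<nu> k) s" for a s
    proof -
      have eq: "(\<Sum>i\<in>I-J. (if i = k then s else a * t i) * Y i x) = a * U x + s * Y k x" for x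
        unfolding U_def sum.remove[OF fIJ kI] IJ sum_distrib_left
        by (auto intro!: sum.cong simp: mult.assoc)
      show ?thesis
        using IH[of "\<lambda>i. if i = k then s else a * t i"]
        unfolding eq w_def[symmetric] prod.remove[OF fIJ kI] IJ
        by (simp add: mult_ac cong: prod.cong_simp)
    qed
    have "(CLINT x|W. complex_of_real (w x * indicator (A k) (Y k x)) * iexp (U x))
      = ?m * (\<Prod>i\<in>I - insert k J. char (\<nu> i) (t i)) * measure (\<nu> k) (A k)"
      by (rule weighted_law_complex_eqI[where ?c0.0="?m * (\<Prod>i\<in>I - insert k J. char (\<nu> i) (0 * t i))"
            and ?c2.0="?m * (\<Prod>i\<in>I - insert k J. char (\<nu> i) (-1 * t i))"])
        (use assms w01 aux[of 0] aux[of 1] aux[of "-1"] in auto)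
    then show ?case using insert by (simp add: w_def U_def mult_ac)
  qed
  show ?thesis
  proof (rule P.PiM_eqI[OF fin])
    show "sets (distr W (PiM I (\<lambda>_. borel)) (\<lambda>x. \<lambda>i\<in>I. Y i x)) = sets (PiM I \<nu>)"
      by (simp cong: sets_PiM_cong)
    fix A assume "\<And>i. i \<in> I \<Longrightarrow> A i \<in> sets (\<nu> i)"
    then have A[measurable]: "\<And>i. i \<in> I \<Longrightarrow> A i \<in> sets borel" by simp
    let ?D = "distr W (PiM I (\<lambda>_. borel)) (\<lambda>x. \<lambda>i\<in>I. Y i x)"
    have [measurable]: "(\<lambda>x. \<lambda>i\<in>I. Y i x) \<in> measurable W (PiM I (\<lambda>_. borel))" by measurable
    have PE: "Pi\<^sub>E I A \<in> sets (PiM I (\<lambda>_. borel))" using A fin by (intro sets_PiM_I_finite) auto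
    interpret D: prob_space ?D by (rule W.prob_space_distr) measurable
    have "complex_of_real (measure ?D (Pi\<^sub>E I A)) = complex_of_real (LINT x|W. indicator (Pi\<^sub>E I A) (\<lambda>i\<in>I. Y i x))"
      using integral_distr[of "\<lambda>x. \<lambda>i\<in>I. Y i x" W "PiM I (\<lambda>_. borel)" "indicator (Pi\<^sub>E I A) :: _ \<Rightarrow> real"] PE
      by (simp add: Int_absorb2 sets.sets_into_space)
    also have "\<dots> = (CLINT x|W. complex_of_real (\<Prod>i\<in>I. indicator (A i) (Y i x)))"
      by (subst integral_complex_of_real[symmetric], intro Bochner_Integration.integral_cong)
        (auto simp: indicator_def fin PiE_def Pi_def)
    also have "\<dots> = complex_of_real (\<Prod>i\<in>I. measure (\<nu> i) (A i))"
      using claim[of I A] A by simp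
    finally have "measure ?D (Pi\<^sub>E I A) = (\<Prod>i\<in>I. measure (\<nu> i) (A i))" by (simp only: of_real_eq_iff)
    then show "emeasure ?D (Pi\<^sub>E I A) = (\<Prod>i\<in>I. emeasure (\<nu> i) (A i))"
      unfolding D.emeasure_eq_measure R.emeasure_eq_measure by (simp add: prod_ennreal)
  qed
qed

section \<open>Gaussian series and trigonometric forms\<close>

text \<open>The characteristic function at the single point 1 suffices, because \<open>Y\<close>
  will be an arbitrary linear combination of the series and so may absorb any scalar. The degenerate
  normal law obeys the same formula with variance 0.\<close>

lemma normal_rv_centred:
  assumes "prob_space W" and nY: "normal_rv W Y" and mean: "(LINT w|W. Y w) = 0"
  shows "integrable W (\<lambda>w. (Y w)\<^sup>2)"
    and "(CLINT w|W. iexp (Y w)) = complex_of_real (exp (- (LINT w|W. (Y w)\<^sup>2) / 2))"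
proof -
  interpret W: prob_space W by fact
  from nY have "integrable W (\<lambda>w. (Y w)\<^sup>2) \<and>
    (CLINT w|W. iexp (Y w)) = complex_of_real (exp (- (LINT w|W. (Y w)\<^sup>2) / 2))"
    unfolding normal_rv_def
  proof safe
    fix m assume Y[measurable]: "Y \<in> borel_measurable W" and ae: "AE w in W. Y w = m"
    have "(LINT w|W. Y w) = (LINT w|W. m)" using ae by (intro integral_cong_AE) auto
    then have m0: "m = 0" using mean W.prob_space by simp
    have i: "integrable W (\<lambda>w. (Y w)\<^sup>2)"
      by (rule W.integrable_const_bound[of _ 0]) (use ae m0 in auto)
    have 1: "(LINT w|W. (Y w)\<^sup>2) = (LINT w|W. 0)" by (rule integral_cong_AE) (use ae m0 in auto)
    have "(CLINT w|W. iexp (Y w)) = (CLINT w|W. 1)" by (rule integral_cong_AE) (use ae m0 in auto)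
    then have 2: "(CLINT w|W. iexp (Y w)) = 1" using W.prob_space by simp
    show "integrable W (\<lambda>w. (Y w)\<^sup>2)" by (rule i)
    show "(CLINT w|W. iexp (Y w)) = complex_of_real (exp (- (LINT w|W. (Y w)\<^sup>2) / 2))"
      using 1 2 by simp
  next
    fix m \<sigma> :: real assume \<sigma>: "\<sigma> > 0" and d: "distributed W lborel Y (\<lambda>x. ennreal (normal_density m \<sigma> x))"
    have m0: "m = 0" using W.normal_distributed_expectation[OF \<sigma> d] mean by simp
    have var: "(LINT w|W. (Y w)\<^sup>2) = \<sigma>\<^sup>2"
      using W.normal_distributed_variance[OF \<sigma> d] mean by simp
    show "integrable W (\<lambda>w. (Y w)\<^sup>2)"
      using distributed_integrable[OF d, of "\<lambda>x. x\<^sup>2"] integrable_normal_moment[OF \<sigma>, of m 2] m0 by simp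
    have "distributed W lborel (\<lambda>w. (Y w - m) / \<sigma>) std_normal_density"
      using W.normal_standard_normal_convert[OF \<sigma>, of Y m] d by simp
    then have e: "distr W lborel (\<lambda>w. Y w / \<sigma>) = std_normal_distribution"
      and [measurable]: "(\<lambda>w. Y w / \<sigma>) \<in> borel_measurable W"
      by (auto simp: distributed_def m0)
    have "complex_of_real (exp (- (\<sigma>\<^sup>2) / 2)) = char (distr W lborel (\<lambda>w. Y w / \<sigma>)) \<sigma>"
      unfolding e char_std_normal_distribution by simp
    also have "\<dots> = (CLINT w|W. iexp (Y w))"
      unfolding char_def using \<sigma> by (subst integral_distr) auto
    finally show "(CLINT w|W. iexp (Y w)) = complex_of_real (exp (- (LINT w|W. (Y w)\<^sup>2) / 2))"
      by (simp add: var)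
  qed
  then show "integrable W (\<lambda>w. (Y w)\<^sup>2)"
    and "(CLINT w|W. iexp (Y w)) = complex_of_real (exp (- (LINT w|W. (Y w)\<^sup>2) / 2))" by auto
qed

section \<open>Covariance forms as integrals of trigonometric polynomials\<close>

definition trig_cos :: "nat \<Rightarrow> (nat \<Rightarrow> real) \<Rightarrow> real \<Rightarrow> real" where
  "trig_cos n a l = (\<Sum>t\<in>{1..n}. a t * cos (real t * l))"

definition trig_sin :: "nat \<Rightarrow> (nat \<Rightarrow> real) \<Rightarrow> real \<Rightarrow> real" where
  "trig_sin n a l = (\<Sum>t\<in>{1..n}. a t * sin (real t * l))"

text \<open>The second factor is the real part of \<open>A * cnj B\<close> for the trigonometric
  polynomials \<open>A\<close>, \<open>B\<close> with coefficients \<open>a\<close>,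
  \<open>b\<close>. In this spectral form of the covariance, pointwise comparison of densities
  becomes comparison of quadratic forms.\<close>

definition trig_form :: "nat \<Rightarrow> (real \<Rightarrow> real) \<Rightarrow> (nat \<Rightarrow> real) \<Rightarrow> (nat \<Rightarrow> real) \<Rightarrow> real" where
  "trig_form n f a b = (LINT l:{-pi<..pi}|lborel.
     f l * (trig_cos n a l * trig_cos n b l + trig_sin n a l * trig_sin n b l))"

lemma trig_cos_measurable [measurable]: "trig_cos n a \<in> borel_measurable borel"
  and trig_sin_measurable [measurable]: "trig_sin n a \<in> borel_measurable borel"
  unfolding trig_cos_def trig_sin_def by measurable

lemma set_integrable_mult_bounded:
  fixes f :: "'a \<Rightarrow> real" and h :: "'a \<Rightarrow> 'b::{banach, second_countable_topology, real_normed_field}"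
  assumes f: "set_integrable M A f" and h: "set_borel_measurable M A h" and [measurable]: "A \<in> sets M"
    and b: "\<And>x. x \<in> A \<Longrightarrow> norm (h x) \<le> c"
  shows "set_integrable M A (\<lambda>x. h x * of_real (f x))"
proof -
  have [measurable]: "(\<lambda>x. indicator A x * f x) \<in> borel_measurable M"
    using f unfolding set_integrable_def by auto
  have [measurable]: "(\<lambda>x. indicator A x *\<^sub>R h x) \<in> borel_measurable M"
    using h unfolding set_borel_measurable_def .
  have eq: "indicator A x *\<^sub>R (h x * of_real (f x)) = (indicator A x *\<^sub>R h x) * of_real (indicator A x * f x)" for x
    by (simp split: split_indicator)
  have "integrable M (\<lambda>x. (indicator A x *\<^sub>R h x) * of_real (indicator A x * f x))"
  proof (rule Bochner_Integration.integrable_bound)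
    show "integrable M (\<lambda>x. c * (indicator A x * f x))"
      using f unfolding set_integrable_def by (intro integrable_mult_right) simp
    show "AE x in M. norm ((indicator A x *\<^sub>R h x) * of_real (indicator A x * f x)) \<le> norm (c * (indicator A x * f x))"
      using b by (auto simp: norm_mult abs_mult split: split_indicator intro!: mult_right_mono order_trans[OF b])
  qed measurable
  then show ?thesis unfolding set_integrable_def eq .
qed

lemma borel_measurable_set_borel_measurable:
  fixes h :: "'a \<Rightarrow> 'b::{second_countable_topology, real_normed_vector}"
  assumes [measurable]: "h \<in> borel_measurable M" "A \<in> sets M"
  shows "set_borel_measurable M A h"
  unfolding set_borel_measurable_def by measurable

lemma Re_autocov:
  assumes f: "set_integrable lborel {-pi<..pi} f"
  shows "Re (autocov f h) = (LINT l:{-pi<..pi}|lborel. f l * cos (of_int h * l))"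
proof -
  have i: "set_integrable lborel {-pi<..pi} (\<lambda>l. exp (\<i> * of_int h * of_real l) * complex_of_real (f l))"
    by (rule set_integrable_mult_bounded[OF f, where c=1])
      (auto simp: norm_exp_eq_Re intro!: borel_measurable_set_borel_measurable)
  have "Re (autocov f h) = (LINT l|lborel. Re (indicator {-pi<..pi} l *\<^sub>R (exp (\<i> * of_int h * of_real l) * complex_of_real (f l))))"
    unfolding autocov_def set_lebesgue_integral_def
    using i unfolding set_integrable_def by (rule integral_Re[symmetric])
  also have "\<dots> = (LINT l:{-pi<..pi}|lborel. f l * cos (of_int h * l))"
    unfolding set_lebesgue_integral_def by (intro Bochner_Integration.integral_cong) (auto simp: Re_exp)
  finally show ?thesis .
qed

lemma trig_form_expand:
  assumes f: "set_integrable lborel {-pi<..pi} f"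
  shows "trig_form n f a b = (\<Sum>s\<in>{1..n}. \<Sum>t\<in>{1..n}. a s * b t * Re (autocov f (int s - int t)))"
proof -
  have i: "set_integrable lborel {-pi<..pi} (\<lambda>l. f l * cos (real_of_int (int s - int t) * l))" for s t
    using set_integrable_mult_bounded[OF f, of "\<lambda>l. cos (real_of_int (int s - int t) * l)" 1]
    by (simp add: mult.commute borel_measurable_set_borel_measurable)
  have e: "f l * (trig_cos n a l * trig_cos n b l + trig_sin n a l * trig_sin n b l) =
     (\<Sum>s\<in>{1..n}. \<Sum>t\<in>{1..n}. a s * b t * (f l * cos (real_of_int (int s - int t) * l)))" for l
    unfolding trig_cos_def trig_sin_def sum_product
    by (simp add: sum_distrib_left sum.distrib[symmetric] left_diff_distrib cos_diff algebra_simps)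
  have "trig_form n f a b = (LINT l|lborel. (\<Sum>s\<in>{1..n}. \<Sum>t\<in>{1..n}. a s * b t * (indicator {-pi<..pi} l *\<^sub>R (f l * cos (real_of_int (int s - int t) * l)))))"
    unfolding trig_form_def set_lebesgue_integral_def e
    by (intro Bochner_Integration.integral_cong) (auto split: split_indicator)
  also have "\<dots> = (\<Sum>s\<in>{1..n}. \<Sum>t\<in>{1..n}. a s * b t * Re (autocov f (int s - int t)))"
    unfolding Re_autocov[OF f] set_lebesgue_integral_def
    using i by (simp add: set_integrable_def)
  finally show ?thesis .
qed

lemma gaussian_linear_combination:
  assumes ser: "stationary_gaussian_series W X f" and f: "set_integrable lborel {-pi<..pi} f"
  shows "(CLINT w|W. iexp (\<Sum>t\<in>{1..n}. a t * X (int t) w)) = complex_of_real (exp (- trig_form n f a a / 2))"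
proof -
  from ser have gp: "gaussian_process W X" and mean: "\<And>t. (LINT w|W. X t w) = 0"
    and cov: "\<And>t h. complex_of_real (LINT w|W. X (t + h) w * X t w) = autocov f h"
    by (auto simp: stationary_gaussian_series_def)
  from gp interpret W: prob_space W by (simp add: gaussian_process_def)
  from gp have X[measurable]: "X t \<in> borel_measurable W" for t by (simp add: gaussian_process_def)
  from gp have nrm: "finite S \<Longrightarrow> normal_rv W (\<lambda>w. \<Sum>t\<in>S. a t * X t w)" for S a
    by (simp add: gaussian_process_def)
  have "normal_rv W (X t)" for t using nrm[of "{t}" "\<lambda>_. 1"] by simp
  from normal_rv_centred(1)[OF W.prob_space_axioms this mean]
  have sq: "integrable W (\<lambda>w. (X t w)\<^sup>2)" for t .
  have iX: "integrable W (X t)" for t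
    by (rule W.square_integrable_imp_integrable[OF _ sq]) simp
  have prod: "integrable W (\<lambda>w. X s w * X t w)" for s t
  proof (rule Bochner_Integration.integrable_bound)
    show "integrable W (\<lambda>w. (X s w)\<^sup>2 + (X t w)\<^sup>2)" using sq by simp
    have "\<bar>x * y\<bar> \<le> x\<^sup>2 + y\<^sup>2" for x y :: real
    proof -
      have "2 * \<bar>x * y\<bar> \<le> x\<^sup>2 + y\<^sup>2" using sum_squares_bound[of "\<bar>x\<bar>" "\<bar>y\<bar>"] by (simp add: abs_mult)
      then show ?thesis using abs_ge_zero[of "x*y"] by linarith
    qed
    then show "AE w in W. norm (X s w * X t w) \<le> norm ((X s w)\<^sup>2 + (X t w)\<^sup>2)" by auto
  qed measurable
  have cov': "(LINT w|W. X (int s) w * X (int t) w) = Re (autocov f (int s - int t))" for s t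
    using arg_cong[OF cov[of "int t" "int s - int t"], of Re] by simp
  let ?Y = "\<lambda>w. \<Sum>t\<in>{1..n}. a t * X (int t) w"
  have "?Y = (\<lambda>w. \<Sum>t\<in>int ` {1..n}. a (nat t) * X t w)"
    by (subst sum.reindex) (auto simp: inj_on_def)
  then have nY: "normal_rv W ?Y" using nrm[of "int ` {1..n}" "\<lambda>t. a (nat t)"] by simp
  have mY: "(LINT w|W. ?Y w) = 0" using iX mean by simp
  have "(LINT w|W. (?Y w)\<^sup>2) = (LINT w|W. (\<Sum>s\<in>{1..n}. \<Sum>t\<in>{1..n}. a s * a t * (X (int s) w * X (int t) w)))"
    by (simp add: power2_eq_square sum_product mult_ac)
  also have "\<dots> = trig_form n f a a"
    unfolding trig_form_expand[OF f] using prod cov' by simp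
  finally have v: "(LINT w|W. (?Y w)\<^sup>2) = trig_form n f a a" .
  show ?thesis using normal_rv_centred(2)[OF W.prob_space_axioms nY mY] v by simp
qed

section \<open>Simultaneous diagonalization\<close>

definition matrix_form :: "'i set \<Rightarrow> ('i \<Rightarrow> 'i \<Rightarrow> real) \<Rightarrow> ('i \<Rightarrow> real) \<Rightarrow> ('i \<Rightarrow> real) \<Rightarrow> real" where
  "matrix_form I G a b = (\<Sum>s\<in>I. \<Sum>t\<in>I. a s * b t * G s t)"

lemma matrix_form_cong:
  "(\<And>t. t \<in> I \<Longrightarrow> a t = a' t) \<Longrightarrow> (\<And>t. t \<in> I \<Longrightarrow> b t = b' t) \<Longrightarrow> matrix_form I G a b = matrix_form I G a' b'"
  unfolding matrix_form_def by (intro sum.cong) auto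

lemma matrix_form_commute:
  assumes "\<And>s t. G s t = G t s"
  shows "matrix_form I G a b = matrix_form I G b a"
  unfolding matrix_form_def using assms by (subst sum.swap) (simp add: mult_ac)

lemma matrix_form_add_right: "matrix_form I G a (\<lambda>t. b t + c t) = matrix_form I G a b + matrix_form I G a c"
  unfolding matrix_form_def by (simp add: algebra_simps sum.distrib)

lemma matrix_form_diff_right: "matrix_form I G a (\<lambda>t. b t - c t) = matrix_form I G a b - matrix_form I G a c"
  unfolding matrix_form_def by (simp add: algebra_simps sum_subtractf)

lemma matrix_form_scale_right: "matrix_form I G a (\<lambda>t. r * b t) = r * matrix_form I G a b"
  unfolding matrix_form_def by (simp add: algebra_simps sum_distrib_left)

lemma matrix_form_add_left: "matrix_form I G (\<lambda>t. b t + c t) a = matrix_form I G b a + matrix_form I G c a"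
  unfolding matrix_form_def by (simp add: algebra_simps sum.distrib)

lemma matrix_form_scale_left: "matrix_form I G (\<lambda>t. r * b t) a = r * matrix_form I G b a"
  unfolding matrix_form_def by (simp add: algebra_simps sum_distrib_left)

lemma matrix_form_zero [simp]: "matrix_form I G a (\<lambda>t. 0) = 0" "matrix_form I G (\<lambda>t. 0) a = 0"
  unfolding matrix_form_def by simp_all

lemma matrix_form_sum_right:
  "matrix_form I G a (\<lambda>t. \<Sum>i\<in>J. c i * u i t) = (\<Sum>i\<in>J. c i * matrix_form I G a (u i))"
  by (induction J rule: infinite_finite_induct) (simp_all add: matrix_form_add_right matrix_form_scale_right)

lemma matrix_form_sum_left:
  "matrix_form I G (\<lambda>t. \<Sum>i\<in>J. c i * u i t) a = (\<Sum>i\<in>J. c i * matrix_form I G (u i) a)"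
  by (induction J rule: infinite_finite_induct) (simp_all add: matrix_form_add_left matrix_form_scale_left)

text \<open>Bessel's inequality in dual form: applied to evaluation functionals it bounds the
  diagonal of the reproducing kernel.\<close>

lemma orthonormal_functional_bound:
  assumes J: "finite J" and m: "0 < m"
    and G: "\<And>a. m * (\<Sum>t\<in>I. (a t)\<^sup>2) \<le> matrix_form I G a a"
    and on: "\<And>i j. i \<in> J \<Longrightarrow> j \<in> J \<Longrightarrow> matrix_form I G (u i) (u j) = (if i = j then 1 else 0)"
  shows "(\<Sum>i\<in>J. (\<Sum>t\<in>I. u i t * v t)\<^sup>2) \<le> (\<Sum>t\<in>I. (v t)\<^sup>2) / m"
proof -
  define c where "c i = (\<Sum>t\<in>I. u i t * v t)" for i
  \<comment> \<open>For this \<open>a\<close> both the form at \<open>a\<close> and the functional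
    \<open>v\<close> at \<open>a\<close> equal \<open>S\<close>. Cauchy-Schwarz then bounds
    \<open>S^2\<close> by \<open>S\<close> times the desired bound, and a factor \<open>S\<close>
    cancels.\<close>
  define a where "a t = (\<Sum>i\<in>J. c i * u i t)" for t
  define S where "S = (\<Sum>i\<in>J. (c i)\<^sup>2)"
  have "matrix_form I G a a = (\<Sum>i\<in>J. \<Sum>j\<in>J. c i * (c j * matrix_form I G (u i) (u j)))"
    unfolding a_def matrix_form_sum_left matrix_form_sum_right by (simp add: sum_distrib_left)
  also have "\<dots> = S" unfolding S_def
    using J by (intro sum.cong refl) (simp add: on if_distrib power2_eq_square cong: if_cong)
  finally have GS: "matrix_form I G a a = S" .
  have "(\<Sum>t\<in>I. a t * v t) = (\<Sum>i\<in>J. \<Sum>t\<in>I. c i * u i t * v t)"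
    unfolding a_def sum_distrib_right by (rule sum.swap)
  also have "\<dots> = S" unfolding S_def c_def by (simp add: power2_eq_square sum_distrib_left mult.assoc)
  finally have "S\<^sup>2 \<le> (\<Sum>t\<in>I. (a t)\<^sup>2) * (\<Sum>t\<in>I. (v t)\<^sup>2)"
    using Cauchy_Schwarz_ineq_sum[of a v I] by simp
  also have "\<dots> \<le> (S / m) * (\<Sum>t\<in>I. (v t)\<^sup>2)"
    using G[of a] m by (intro mult_right_mono) (auto simp: GS field_simps sum_nonneg)
  finally have *: "S * S \<le> S * ((\<Sum>t\<in>I. (v t)\<^sup>2) / m)" by (simp add: power2_eq_square)
  have "S \<ge> 0" unfolding S_def by (simp add: sum_nonneg)
  moreover have "0 \<le> (\<Sum>t\<in>I. (v t)\<^sup>2) / m" using m by (simp add: sum_nonneg)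
  ultimately have "S \<le> (\<Sum>t\<in>I. (v t)\<^sup>2) / m"
    using mult_le_cancel_left_pos[of S S "(\<Sum>t\<in>I. (v t)\<^sup>2) / m"] * by (cases "S = 0") linarith+
  then show ?thesis by (simp add: S_def c_def)
qed

text \<open>The first-order condition at the minimum \<open>s = 0\<close>. For nonzero
  \<open>p\<close> the step \<open>- p / r\<close>, with \<open>r\<close> a positive upper bound of
  \<open>q\<close>, would make the expression negative.\<close>

lemma linear_coefficient_eq_0:
  fixes p q :: real
  assumes "\<And>s. 0 \<le> 2 * s * p + s\<^sup>2 * q"
  shows "p = 0"
proof (rule ccontr)
  assume p: "p \<noteq> 0"
  define r where "r = \<bar>q\<bar> + 1"
  have r: "r > 0" "q \<le> r" by (auto simp: r_def)
  have "0 \<le> 2 * (- p / r) * p + (- p / r)\<^sup>2 * q" by (rule assms)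
  also have "\<dots> \<le> 2 * (- p / r) * p + (- p / r)\<^sup>2 * r" using r by (intro add_left_mono mult_left_mono) auto
  also have "\<dots> = - (p\<^sup>2 / r)" using r by (simp add: power2_eq_square field_simps)
  finally show False using p r by (simp add: divide_le_0_iff)
qed

text \<open>Generalized eigenvectors of the pencil \<open>H - e G\<close>, orthonormal for
  \<open>G\<close>, with the eigenvalue equation in weak form against every \<open>b\<close>.
  Completeness is not demanded: partial systems are extended until they span.\<close>

definition eigensystem :: "'i set \<Rightarrow> ('i \<Rightarrow> 'i \<Rightarrow> real) \<Rightarrow> ('i \<Rightarrow> 'i \<Rightarrow> real) \<Rightarrow> nat \<Rightarrow>
    (nat \<Rightarrow> 'i \<Rightarrow> real) \<Rightarrow> (nat \<Rightarrow> real) \<Rightarrow> bool" where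
  "eigensystem I G H k u e \<longleftrightarrow>
     (\<forall>i<k. \<forall>j<k. matrix_form I G (u i) (u j) = (if i = j then 1 else 0)) \<and>
     (\<forall>i<k. \<forall>b. matrix_form I H (u i) b = e i * matrix_form I G (u i) b)"

section \<open>Eigenvectors by maximizing the Rayleigh quotient\<close>

context
  fixes I :: "'i set" and G H :: "'i \<Rightarrow> 'i \<Rightarrow> real" and m :: real
  assumes fin: "finite I" and m: "0 < m"
    and symG: "\<And>s t. G s t = G t s" and symH: "\<And>s t. H s t = H t s"
    and posG: "\<And>a. m * (\<Sum>t\<in>I. (a t)\<^sup>2) \<le> matrix_form I G a a"
begin

text \<open>A substitute for the dimension bound. The values \<open>G (u i) (u i) = 1\<close> add up
  to \<open>k\<close>, each is at most \<open>C\<close> times a Euclidean norm, and by the dual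
  Bessel inequality at unit vectors every coordinate contributes at most \<open>1 / m\<close> over
  the whole system. Any finite bound serves, since it only has to yield a largest system.\<close>

lemma eigensystem_size_bounded: "\<exists>N. \<forall>k u e. eigensystem I G H k u e \<longrightarrow> k \<le> N"
proof -
  define C where "C = (\<Sum>s\<in>I. \<Sum>t\<in>I. \<bar>G s t\<bar>)"
  have C0: "C \<ge> 0" unfolding C_def by (intro sum_nonneg) auto
  have bd: "matrix_form I G a a \<le> C * (\<Sum>t\<in>I. (a t)\<^sup>2)" for a
  proof -
    have "a s * a t * G s t \<le> \<bar>G s t\<bar> * (\<Sum>t\<in>I. (a t)\<^sup>2)" if "s \<in> I" "t \<in> I" for s t
    proof -
      have le: "(a r)\<^sup>2 \<le> (\<Sum>t\<in>I. (a t)\<^sup>2)" if "r \<in> I" for r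
        using fin that by (intro member_le_sum) auto
      have "2 * \<bar>a s * a t\<bar> \<le> (a s)\<^sup>2 + (a t)\<^sup>2" using sum_squares_bound[of "\<bar>a s\<bar>" "\<bar>a t\<bar>"] by (simp add: abs_mult)
      then have "\<bar>a s * a t\<bar> \<le> (\<Sum>t\<in>I. (a t)\<^sup>2)" using le[OF that(1)] le[OF that(2)] by linarith
      then have "\<bar>a s * a t\<bar> * \<bar>G s t\<bar> \<le> (\<Sum>t\<in>I. (a t)\<^sup>2) * \<bar>G s t\<bar>" by (rule mult_right_mono) simp
      moreover have "a s * a t * G s t \<le> \<bar>a s * a t\<bar> * \<bar>G s t\<bar>" by (metis abs_ge_self abs_mult)
      ultimately show ?thesis by (simp add: mult.commute)
    qed
    then show ?thesis unfolding matrix_form_def C_def sum_distrib_right by (intro sum_mono) auto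
  qed
  have "real k \<le> C * (real (card I) / m)" if E: "eigensystem I G H k u e" for k u e
  proof -
    have on: "matrix_form I G (u i) (u j) = (if i = j then 1 else 0)" if "i \<in> {..<k}" "j \<in> {..<k}" for i j
      using E that by (simp add: eigensystem_def)
    have 1: "(\<Sum>i<k. (u i t)\<^sup>2) \<le> 1 / m" if t: "t \<in> I" for t
    proof -
      have "(\<Sum>s\<in>I. u i s * (if s = t then 1 else 0)) = u i t" for i
        using fin t by (simp add: if_distrib cong: if_cong)
      moreover have "(\<Sum>s\<in>I. ((if s = t then 1 else 0)::real)\<^sup>2) = 1"
        using fin t by (simp add: if_distrib[of "\<lambda>x. x\<^sup>2"] cong: if_cong)
      ultimately show ?thesis
        using orthonormal_functional_bound[OF finite_lessThan m posG on, where v="\<lambda>s. if s = t then 1 else 0"] by simp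
    qed
    have "real k = (\<Sum>i<k. matrix_form I G (u i) (u i))" using on by simp
    also have "\<dots> \<le> (\<Sum>i<k. C * (\<Sum>t\<in>I. (u i t)\<^sup>2))" by (intro sum_mono bd)
    also have "\<dots> = C * (\<Sum>t\<in>I. \<Sum>i<k. (u i t)\<^sup>2)" unfolding sum_distrib_left[symmetric] by (subst sum.swap) simp
    also have "\<dots> \<le> C * (\<Sum>t\<in>I. 1 / m)" using C0 1 by (intro mult_left_mono sum_mono) auto
    finally show ?thesis by simp
  qed
  then have "k \<le> nat \<lceil>C * (real (card I) / m)\<rceil>" if "eigensystem I G H k u e" for k u e
    using that le_of_int_ceiling[of "C * (real (card I) / m)"] by (smt (verit) of_nat_le_iff of_nat_nat zero_le_ceiling nat_ceiling_le_eq order.refl real_nat_ceiling_ge)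
  then show ?thesis by blast
qed

text \<open>The new vector maximizes \<open>H b b\<close> on the unit sphere of \<open>G\<close>
  within the \<open>G\<close>-orthogonal complement of the system; \<open>a\<close> witnesses that
  this complement is not trivial.\<close>

lemma eigensystem_extend:
  assumes E: "eigensystem I G H k u e"
    and a: "\<And>i. i < k \<Longrightarrow> matrix_form I G (u i) a = 0" and a0: "\<exists>t\<in>I. a t \<noteq> 0"
  shows "\<exists>u e. eigensystem I G H (Suc k) u e"
proof -
  have on: "\<And>i j. i < k \<Longrightarrow> j < k \<Longrightarrow> matrix_form I G (u i) (u j) = (if i = j then 1 else 0)"
    and ev: "\<And>i b. i < k \<Longrightarrow> matrix_form I H (u i) b = e i * matrix_form I G (u i) b"
    using E by (auto simp: eigensystem_def)
  have comm: "matrix_form I G a b = matrix_form I G b a" "matrix_form I H a b = matrix_form I H b a" for a b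
    by (rule matrix_form_commute, rule symG symH)+
  have Gpos: "0 < matrix_form I G b b" if "\<exists>t\<in>I. b t \<noteq> 0" for b
  proof -
    from that have "0 < (\<Sum>t\<in>I. (b t)\<^sup>2)" using fin by (auto intro!: sum_pos2)
    then have "0 < m * (\<Sum>t\<in>I. (b t)\<^sup>2)" using m by simp
    with posG[of b] show ?thesis by linarith
  qed
  define K where "K = {b. (\<forall>t. t \<notin> I \<longrightarrow> b t = 0) \<and> matrix_form I G b b = 1 \<and> (\<forall>i<k. matrix_form I G (u i) b = 0)}"
  have K_norm: "(\<lambda>t. if t \<in> I then b t / sqrt (matrix_form I G b b) else 0) \<in> K"
    if "\<exists>t\<in>I. b t \<noteq> 0" and orth: "\<And>i. i < k \<Longrightarrow> matrix_form I G (u i) b = 0" for b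
  proof -
    let ?r = "1 / sqrt (matrix_form I G b b)"
    have eq: "matrix_form I G (\<lambda>t. if t \<in> I then b t / sqrt (matrix_form I G b b) else 0)
          (\<lambda>t. if t \<in> I then b t / sqrt (matrix_form I G b b) else 0) = matrix_form I G (\<lambda>t. ?r * b t) (\<lambda>t. ?r * b t)"
      by (rule matrix_form_cong) auto
    have eq2: "matrix_form I G c (\<lambda>t. if t \<in> I then b t / sqrt (matrix_form I G b b) else 0) = matrix_form I G c (\<lambda>t. ?r * b t)" for c
      by (rule matrix_form_cong) auto
    show ?thesis
      using Gpos[OF that(1)] orth
      unfolding K_def mem_Collect_eq eq eq2 matrix_form_scale_left matrix_form_scale_right by auto
  qed
  then have K_ne: "K \<noteq> {}" using a a0 by blast
  have cont: "continuous_on UNIV (\<lambda>b. matrix_form I Q b b)" "continuous_on UNIV (\<lambda>b. matrix_form I Q c b)" for Q c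
    unfolding matrix_form_def by (intro continuous_intros continuous_on_product_coordinates)+
  have clK: "closed K"
  proof -
    have "K = (\<Inter>t\<in>-I. {b. b t = 0}) \<inter> {b. matrix_form I G b b = 1} \<inter> (\<Inter>i\<in>{..<k}. {b. matrix_form I G (u i) b = 0})"
      by (auto simp: K_def)
    also have "closed \<dots>"
      by (intro closed_Int closed_INT ballI closed_Collect_eq cont continuous_on_const continuous_on_product_coordinates)
    finally show ?thesis .
  qed
  \<comment> \<open>Coercivity of \<open>G\<close> bounds the coordinates on \<open>K\<close> by
    \<open>R\<close>, and they vanish outside \<open>I\<close>. So \<open>K\<close> lies in a
    product of compact sets, which is compact in the product topology of the function space.\<close>
  define R where "R = sqrt (1 / m)"
  define Bx where "Bx = PiE UNIV (\<lambda>t. if t \<in> I then {-R..R} else {0::real})"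
  have "compactin (product_topology (\<lambda>_. euclidean) UNIV) Bx"
    unfolding Bx_def by (subst compactin_PiE) auto
  then have "compact Bx" by (simp add: euclidean_product_topology)
  moreover have "K \<subseteq> Bx"
  proof
    fix b assume b: "b \<in> K"
    have "b t \<in> {-R..R}" if "t \<in> I" for t
    proof -
      have "(b t)\<^sup>2 \<le> (\<Sum>t\<in>I. (b t)\<^sup>2)" using fin that by (intro member_le_sum) auto
      also have "\<dots> \<le> 1 / m" using posG[of b] b m by (simp add: K_def field_simps)
      finally have "\<bar>b t\<bar> \<le> R" unfolding R_def using real_sqrt_le_mono by fastforce
      then show ?thesis by auto
    qed
    then show "b \<in> Bx" using b by (auto simp: Bx_def K_def)
  qed
  ultimately have "compact K" using clK compact_Int_closed[of Bx K] by (simp add: Int_absorb1)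
  then obtain v where v: "v \<in> K" and vmax: "\<And>b. b \<in> K \<Longrightarrow> matrix_form I H b b \<le> matrix_form I H v v"
    using continuous_attains_sup[OF _ K_ne, of "\<lambda>b. matrix_form I H b b"] continuous_on_subset[OF cont(1)] by blast
  define e' where "e' = matrix_form I H v v"
  have vv: "matrix_form I G v v = 1" and vo: "\<And>i. i < k \<Longrightarrow> matrix_form I G (u i) v = 0" using v by (auto simp: K_def)
  have ray: "matrix_form I H b b \<le> e' * matrix_form I G b b" if orth: "\<And>i. i < k \<Longrightarrow> matrix_form I G (u i) b = 0" for b
  proof (cases "\<exists>t\<in>I. b t \<noteq> 0")
    case True
    let ?b = "\<lambda>t. if t \<in> I then b t / sqrt (matrix_form I G b b) else 0"
    let ?r = "1 / sqrt (matrix_form I G b b)"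
    have "matrix_form I H ?b ?b = matrix_form I H (\<lambda>t. ?r * b t) (\<lambda>t. ?r * b t)"
      by (rule matrix_form_cong) auto
    also have "\<dots> = matrix_form I H b b / matrix_form I G b b"
      using Gpos[OF True] unfolding matrix_form_scale_left matrix_form_scale_right by simp
    finally show ?thesis using vmax[OF K_norm[OF True orth]] Gpos[OF True]
      by (simp only: e'_def pos_divide_le_eq)
  next
    case False
    then have "matrix_form I Q b b = matrix_form I Q (\<lambda>t. 0) (\<lambda>t. 0)" for Q by (intro matrix_form_cong) auto
    then show ?thesis by simp
  qed
  \<comment> \<open>On the complement \<open>e' * G - H\<close> is nonnegative and it vanishes at
    \<open>v\<close>; perturbing \<open>v\<close> in the direction \<open>b\<close> therefore kills
    the linear term.\<close>
  have ev1: "matrix_form I H v b = e' * matrix_form I G v b" if orth: "\<And>i. i < k \<Longrightarrow> matrix_form I G (u i) b = 0" for b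
  proof -
    have "0 \<le> 2 * s * (e' * matrix_form I G v b - matrix_form I H v b) + s\<^sup>2 * (e' * matrix_form I G b b - matrix_form I H b b)" for s
    proof -
      have "matrix_form I H (\<lambda>t. v t + s * b t) (\<lambda>t. v t + s * b t) \<le> e' * matrix_form I G (\<lambda>t. v t + s * b t) (\<lambda>t. v t + s * b t)"
        by (rule ray) (simp add: matrix_form_add_right matrix_form_scale_right vo orth)
      then show ?thesis
        by (simp add: matrix_form_add_right matrix_form_scale_right matrix_form_add_left matrix_form_scale_left
              comm[of b v] vv e'_def[symmetric] power2_eq_square algebra_simps)
    qed
    from linear_coefficient_eq_0[OF this] show ?thesis by simp
  qed
  \<comment> \<open>A general \<open>b\<close> differs from an element of the complement by a
    combination of the \<open>u i\<close>. There both sides vanish: \<open>G v (u i) = 0\<close> by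
    orthogonality, and \<open>H v (u i)\<close> is \<open>e i\<close> times it by symmetry.\<close>
  have ev2: "matrix_form I H v b = e' * matrix_form I G v b" for b
  proof -
    define b' where "b' t = b t - (\<Sum>i<k. matrix_form I G (u i) b * u i t)" for t
    have "matrix_form I G (u j) b' = 0" if "j < k" for j
      unfolding b'_def matrix_form_diff_right matrix_form_sum_right using that
      by (simp add: on if_distrib cong: if_cong)
    from ev1[OF this] have "matrix_form I H v b' = e' * matrix_form I G v b'" .
    moreover have "matrix_form I G v b' = matrix_form I G v b"
      unfolding b'_def matrix_form_diff_right matrix_form_sum_right by (simp add: comm[of v] vo)
    moreover have "matrix_form I H v b' = matrix_form I H v b"
      unfolding b'_def matrix_form_diff_right matrix_form_sum_right
      by (simp add: comm[of v "u _"] ev vo)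
    ultimately show ?thesis by simp
  qed
  have "eigensystem I G H (Suc k) (u(k := v)) (e(k := e'))"
    unfolding eigensystem_def using on ev ev2 vv vo by (auto simp: less_Suc_eq comm[of v "u _"])
  then show ?thesis by blast
qed

text \<open>A system of maximal size must span: a nonzero residual of \<open>a\<close> after
  \<open>G\<close>-projection would be orthogonal to the system and permit an extension.\<close>

lemma simultaneous_diagonalization:
  obtains k u e where "eigensystem I G H k u e"
    and "\<And>a t. t \<in> I \<Longrightarrow> a t = (\<Sum>i<k. matrix_form I G (u i) a * u i t)"
proof -
  let ?P = "\<lambda>k. \<exists>u e. eigensystem I G H k u e"
  have "?P 0" by (simp add: eigensystem_def)
  moreover obtain N where N: "\<And>k. ?P k \<Longrightarrow> k \<le> N" using eigensystem_size_bounded by blast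
  ultimately have g: "?P (Greatest ?P)" "\<And>k. ?P k \<Longrightarrow> k \<le> Greatest ?P"
    using GreatestI_nat[of ?P 0 N] Greatest_le_nat[of ?P _ N] by auto
  define k where "k = Greatest ?P"
  from g obtain u e where E: "eigensystem I G H k u e" by (auto simp: k_def)
  then have on: "\<And>i j. i < k \<Longrightarrow> j < k \<Longrightarrow> matrix_form I G (u i) (u j) = (if i = j then 1 else 0)"
    by (auto simp: eigensystem_def)
  have "a t = (\<Sum>i<k. matrix_form I G (u i) a * u i t)" if "t \<in> I" for a t
  proof (rule ccontr)
    assume ne: "a t \<noteq> (\<Sum>i<k. matrix_form I G (u i) a * u i t)"
    define b where "b t = a t - (\<Sum>i<k. matrix_form I G (u i) a * u i t)" for t
    have "matrix_form I G (u j) b = 0" if "j < k" for j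
      unfolding b_def matrix_form_diff_right matrix_form_sum_right using that
      by (simp add: on if_distrib cong: if_cong)
    moreover have "\<exists>t\<in>I. b t \<noteq> 0" using ne \<open>t \<in> I\<close> by (auto simp: b_def)
    ultimately have "?P (Suc k)" by (rule eigensystem_extend[OF E])
    from g(2)[OF this] show False by (simp add: k_def)
  qed
  with E show ?thesis by (rule that)
qed

end

section \<open>Toeplitz forms\<close>

definition toeplitz :: "(real \<Rightarrow> real) \<Rightarrow> nat \<Rightarrow> nat \<Rightarrow> real" where
  "toeplitz f s t = Re (autocov f (int s - int t))"

definition trig_power :: "nat \<Rightarrow> (nat \<Rightarrow> real) \<Rightarrow> real \<Rightarrow> real" where
  "trig_power n a l = (trig_cos n a l)\<^sup>2 + (trig_sin n a l)\<^sup>2"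

lemma trig_power_nonneg [simp]: "0 \<le> trig_power n a l"
  by (simp add: trig_power_def)

lemma trig_power_measurable [measurable]: "trig_power n a \<in> borel_measurable borel"
  unfolding trig_power_def by measurable

lemma trig_power_le: "trig_power n a l \<le> 2 * (\<Sum>t\<in>{1..n}. \<bar>a t\<bar>)\<^sup>2"
proof -
  have "\<bar>trig_cos n a l\<bar> \<le> (\<Sum>t\<in>{1..n}. \<bar>a t\<bar>)"
    unfolding trig_cos_def by (rule order_trans[OF sum_abs]) (auto intro!: sum_mono simp: abs_mult mult_left_le)
  moreover have "\<bar>trig_sin n a l\<bar> \<le> (\<Sum>t\<in>{1..n}. \<bar>a t\<bar>)"
    unfolding trig_sin_def by (rule order_trans[OF sum_abs]) (auto intro!: sum_mono simp: abs_mult mult_left_le)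
  ultimately have "(trig_cos n a l)\<^sup>2 \<le> (\<Sum>t\<in>{1..n}. \<bar>a t\<bar>)\<^sup>2" "(trig_sin n a l)\<^sup>2 \<le> (\<Sum>t\<in>{1..n}. \<bar>a t\<bar>)\<^sup>2"
    by (auto simp: abs_le_square_iff[symmetric])
  then show ?thesis by (simp add: trig_power_def)
qed

lemma trig_form_self: "trig_form n f a a = (LINT l:{-pi<..pi}|lborel. f l * trig_power n a l)"
  unfolding trig_form_def trig_power_def power2_eq_square ..

lemma set_integrable_trig_power:
  assumes f: "set_integrable lborel {-pi<..pi} f"
  shows "set_integrable lborel {-pi<..pi} (\<lambda>l. f l * trig_power n a l)"
  using set_integrable_mult_bounded[OF f, of "trig_power n a" "2 * (\<Sum>t\<in>{1..n}. \<bar>a t\<bar>)\<^sup>2"] trig_power_le[of n a]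
  by (simp add: mult.commute borel_measurable_set_borel_measurable)

lemma trig_form_mono:
  assumes "set_integrable lborel {-pi<..pi} f" "set_integrable lborel {-pi<..pi} g"
    and "\<And>l. l \<in> {-pi<..pi} \<Longrightarrow> f l \<le> g l"
  shows "trig_form n f a a \<le> trig_form n g a a"
  unfolding trig_form_self using assms
  by (intro set_integral_mono set_integrable_trig_power mult_right_mono) auto

lemma trig_form_eq_matrix_form:
  assumes f: "set_integrable lborel {-pi<..pi} f"
  shows "trig_form n f a b = matrix_form {1..n} (toeplitz f) a b"
  unfolding trig_form_expand[OF f] matrix_form_def toeplitz_def ..

lemma toeplitz_commute:
  assumes f: "set_integrable lborel {-pi<..pi} f"
  shows "toeplitz f s t = toeplitz f t s"
proof -
  have "cos (real_of_int (int s - int t) * l) = cos (real_of_int (int t - int s) * l)" for l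
    using cos_minus[of "real_of_int (int s - int t) * l"] by (simp add: algebra_simps)
  then show ?thesis unfolding toeplitz_def Re_autocov[OF f] by presburger
qed

lemma set_integrable_const_circle [simp]: "set_integrable lborel {-pi<..pi} (\<lambda>_. c::real)"
  by (simp add: set_integrable_def)

lemma set_integral_cos_int:
  "(LINT l:{-pi<..pi}|lborel. cos (of_int h * l)) = (if h = 0 then 2 * pi else 0)"
proof (cases "h = 0")
  case True
  then show ?thesis by (simp add: set_lebesgue_integral_def)
next
  case False
  have "AE l in lborel. l \<noteq> -pi" by (rule AE_lborel_singleton)
  then have "(LINT l:{-pi<..pi}|lborel. cos (of_int h * l)) = (LINT l|lborel. cos (of_int h * l) * indicator {-pi..pi} l)"
    unfolding set_lebesgue_integral_def by (intro integral_cong_AE) (auto split: split_indicator elim!: eventually_mono)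
  also have "\<dots> = sin (of_int h * pi) / of_int h - sin (of_int h * (-pi)) / of_int h"
    by (rule integral_FTC_Icc_real)
      (use False in \<open>auto intro!: derivative_eq_intros continuous_intros\<close>)
  also have "\<dots> = 0" by (simp add: mult.commute)
  finally show ?thesis using False by simp
qed

lemma trig_form_const: "trig_form n (\<lambda>_. c) a a = 2 * pi * c * (\<Sum>t\<in>{1..n}. (a t)\<^sup>2)"
proof -
  have "Re (autocov (\<lambda>_. c) (int s - int t)) = (if s = t then 2 * pi * c else 0)" for s t
    by (subst Re_autocov, simp, subst set_integral_mult_right, subst set_integral_cos_int) auto
  then have "trig_form n (\<lambda>_. c) a a = (\<Sum>s\<in>{1..n}. \<Sum>t\<in>{1..n}. if s = t then a s * a t * (2 * pi * c) else 0)"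
    by (subst trig_form_expand, simp) (intro sum.cong refl, simp)
  then show ?thesis by (simp add: power2_eq_square sum_distrib_left mult_ac)
qed

text \<open>Comparison with white noise of spectral density \<open>c\<close>, whose form is explicit
  by Parseval. It supplies the coercivity constant \<open>m = 2 * pi * c\<close> for the
  diagonalization.\<close>

lemma trig_form_ge:
  assumes f: "set_integrable lborel {-pi<..pi} f" and c: "\<And>l. l \<in> {-pi<..pi} \<Longrightarrow> c \<le> f l"
  shows "2 * pi * c * (\<Sum>t\<in>{1..n}. (a t)\<^sup>2) \<le> trig_form n f a a"
  using trig_form_mono[of "\<lambda>_. c" f n a, OF set_integrable_const_circle f] assms by (simp add: trig_form_const)

lemma set_integrable_bounded_mult:
  fixes f g :: "real \<Rightarrow> real"
  assumes f: "set_integrable lborel A f" and g: "set_integrable lborel A g"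
    and [measurable]: "A \<in> sets lborel" and b: "\<And>x. x \<in> A \<Longrightarrow> \<bar>f x\<bar> \<le> C"
  shows "set_integrable lborel A (\<lambda>x. f x * g x)"
proof -
  have "set_borel_measurable lborel A f"
    using f unfolding set_integrable_def set_borel_measurable_def by auto
  from set_integrable_mult_bounded[OF g this, of C] assms(3) b show ?thesis by simp
qed

text \<open>Cauchy-Schwarz for the measure with density \<open>q\<close>, whose mass is at most
  \<open>1 / c\<close>. It comes from integrating \<open>(h - s)^2 * q\<close>, which is
  nonnegative, with \<open>s = c * E\<close>.\<close>

lemma weighted_square_integral:
  fixes h q :: "real \<Rightarrow> real"
  assumes h: "set_integrable lborel A (\<lambda>l. h l * q l)" and h2: "set_integrable lborel A (\<lambda>l. (h l)\<^sup>2 * q l)"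
    and q: "set_integrable lborel A q" and q0: "\<And>l. l \<in> A \<Longrightarrow> 0 \<le> q l"
    and c: "c * (LINT l:A|lborel. q l) \<le> 1" "0 < c"
  shows "c * (LINT l:A|lborel. h l * q l)\<^sup>2 \<le> (LINT l:A|lborel. (h l)\<^sup>2 * q l)"
proof -
  define E where "E = (LINT l:A|lborel. h l * q l)"
  define s where "s = c * E"
  have "(LINT l:A|lborel. (2 * s) * (h l * q l) - s\<^sup>2 * q l) \<le> (LINT l:A|lborel. (h l)\<^sup>2 * q l)"
  proof (rule set_integral_mono)
    show "set_integrable lborel A (\<lambda>l. 2 * s * (h l * q l) - s\<^sup>2 * q l)"
      by (intro set_integral_diff set_integrable_mult_right h q)
    fix l assume "l \<in> A"
    have "0 \<le> (h l - s)\<^sup>2 * q l" using q0[OF \<open>l \<in> A\<close>] by simp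
    then show "2 * s * (h l * q l) - s\<^sup>2 * q l \<le> (h l)\<^sup>2 * q l" by (simp add: power2_eq_square algebra_simps)
  qed (rule h2)
  moreover have "(LINT l:A|lborel. (2 * s) * (h l * q l) - s\<^sup>2 * q l) = 2 * s * E - s\<^sup>2 * (LINT l:A|lborel. q l)"
    unfolding E_def by (subst set_integral_diff) (auto intro!: set_integrable_mult_right h q)
  moreover have "s\<^sup>2 * (LINT l:A|lborel. q l) = c * E\<^sup>2 * (c * (LINT l:A|lborel. q l))"
    by (simp add: s_def power2_eq_square)
  moreover have "\<dots> \<le> c * E\<^sup>2 * 1" using c by (intro mult_left_mono) auto
  moreover have "2 * s * E = 2 * (c * E\<^sup>2)" by (simp add: s_def power2_eq_square)
  ultimately show ?thesis by (simp add: E_def)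
qed

text \<open>Each \<open>e i - 1\<close> is the integral of \<open>f - g\<close> against
  \<open>trig_power n (u i)\<close>, a weight of mass at most \<open>1 / c\<close> because
  \<open>g\<close> is at least \<open>c\<close> and \<open>u i\<close> is normalized for
  \<open>g\<close>. Squaring inside the integral and summing over \<open>i\<close> before
  integrating leaves the diagonal of the reproducing kernel, bounded uniformly in the frequency.
  This is how the sup norm is avoided and the L2 distance enters.\<close>

lemma eigenvalue_deviation_bound:
  assumes f: "set_integrable lborel {-pi<..pi} f" and g: "set_integrable lborel {-pi<..pi} g"
    and c: "0 < c"
    and fb: "\<And>l. l \<in> {-pi<..pi} \<Longrightarrow> c \<le> f l \<and> f l \<le> C" and gb: "\<And>l. l \<in> {-pi<..pi} \<Longrightarrow> c \<le> g l \<and> g l \<le> C"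
    and E: "eigensystem {1..n} (toeplitz g) (toeplitz f) k u e"
  shows "(\<Sum>i<k. (e i - 1)\<^sup>2) \<le> real n / (2 * pi * c\<^sup>2) * (l2_norm (\<lambda>l. f l - g l))\<^sup>2"
proof -
  let ?A = "{-pi<..pi}"
  let ?h = "\<lambda>l. f l - g l"
  have on: "matrix_form {1..n} (toeplitz g) (u i) (u j) = (if i = j then 1 else 0)" if "i < k" "j < k" for i j
    using E that by (auto simp: eigensystem_def)
  have h: "set_integrable lborel ?A ?h" using f g by (rule set_integral_diff)
  have hb: "\<bar>?h l\<bar> \<le> 2 * C" if "l \<in> ?A" for l using fb[OF that] gb[OF that] c by (auto simp: abs_if)
  have h2: "set_integrable lborel ?A (\<lambda>l. (?h l)\<^sup>2)"
    unfolding power2_eq_square by (rule set_integrable_bounded_mult[OF h h _ hb]) auto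
  have dev: "c * (e i - 1)\<^sup>2 \<le> (LINT l:?A|lborel. (?h l)\<^sup>2 * trig_power n (u i) l)" if i: "i < k" for i
  proof -
    have gi: "trig_form n g (u i) (u i) = 1" using on[OF i i] by (simp add: trig_form_eq_matrix_form[OF g])
    have fi: "trig_form n f (u i) (u i) = e i" using on[OF i i] E i
      by (simp add: trig_form_eq_matrix_form[OF f] eigensystem_def)
    have "e i - 1 = (LINT l:?A|lborel. ?h l * trig_power n (u i) l)"
      unfolding gi[symmetric] fi[symmetric] trig_form_self left_diff_distrib
      by (rule set_integral_diff(2)[symmetric]; rule set_integrable_trig_power; fact)
    moreover have "c * (LINT l:?A|lborel. trig_power n (u i) l) \<le> 1"
    proof -
      have "c * (LINT l:?A|lborel. trig_power n (u i) l) = trig_form n (\<lambda>_. c) (u i) (u i)" by (simp add: trig_form_self)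
      also have "\<dots> \<le> trig_form n g (u i) (u i)" using gb g by (intro trig_form_mono) auto
      finally show ?thesis using gi by simp
    qed
    ultimately show ?thesis
      using weighted_square_integral[of ?A ?h "trig_power n (u i)" c] set_integrable_trig_power[OF h] set_integrable_trig_power[OF h2]
        set_integrable_trig_power[OF set_integrable_const_circle[of 1]] c by simp
  qed
  \<comment> \<open>Bessel's inequality for the evaluation functionals with coefficients
    \<open>cos (t * l)\<close> and \<open>sin (t * l)\<close>, whose squares sum to
    \<open>n\<close>.\<close>
  have kernel: "(\<Sum>i<k. trig_power n (u i) l) \<le> real n / (2 * pi * c)" for l
  proof -
    have m: "2 * pi * c * (\<Sum>t\<in>{1..n}. (a t)\<^sup>2) \<le> matrix_form {1..n} (toeplitz g) a a" for a
      using trig_form_ge[OF g, of c a n] gb by (simp add: trig_form_eq_matrix_form[OF g])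
    have "(\<Sum>i<k. (trig_cos n (u i) l)\<^sup>2) \<le> (\<Sum>t\<in>{1..n}. (cos (real t * l))\<^sup>2) / (2 * pi * c)"
      unfolding trig_cos_def by (rule orthonormal_functional_bound) (use c m on in auto)
    moreover have "(\<Sum>i<k. (trig_sin n (u i) l)\<^sup>2) \<le> (\<Sum>t\<in>{1..n}. (sin (real t * l))\<^sup>2) / (2 * pi * c)"
      unfolding trig_sin_def by (rule orthonormal_functional_bound) (use c m on in auto)
    moreover have "(\<Sum>t\<in>{1..n}. (cos (real t * l))\<^sup>2) + (\<Sum>t\<in>{1..n}. (sin (real t * l))\<^sup>2) = real n"
      by (simp flip: sum.distrib)
    ultimately show ?thesis unfolding trig_power_def sum.distrib
      by (metis (no_types, lifting) add_divide_distrib add_mono)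
  qed
  have "c * (\<Sum>i<k. (e i - 1)\<^sup>2) \<le> (\<Sum>i<k. (LINT l:?A|lborel. (?h l)\<^sup>2 * trig_power n (u i) l))"
    unfolding sum_distrib_left by (intro sum_mono dev) auto
  also have "\<dots> = (LINT l|lborel. (\<Sum>i<k. indicator ?A l *\<^sub>R ((?h l)\<^sup>2 * trig_power n (u i) l)))"
    unfolding set_lebesgue_integral_def
    using set_integrable_trig_power[OF h2] by (subst Bochner_Integration.integral_sum) (auto simp: set_integrable_def)
  also have "\<dots> = (LINT l:?A|lborel. (?h l)\<^sup>2 * (\<Sum>i<k. trig_power n (u i) l))"
    unfolding set_lebesgue_integral_def by (simp add: sum_distrib_left)
  also have "\<dots> \<le> (LINT l:?A|lborel. (?h l)\<^sup>2 * (real n / (2 * pi * c)))"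
  proof (rule set_integral_mono)
    show "set_integrable lborel ?A (\<lambda>l. (?h l)\<^sup>2 * (\<Sum>i<k. trig_power n (u i) l))"
      unfolding set_integrable_def sum_distrib_left scaleR_sum_right
      by (intro Bochner_Integration.integrable_sum set_integrable_trig_power[OF h2, unfolded set_integrable_def])
    show "set_integrable lborel ?A (\<lambda>l. (?h l)\<^sup>2 * (real n / (2 * pi * c)))" using h2 by (rule set_integrable_mult_left)
    show "(?h l)\<^sup>2 * (\<Sum>i<k. trig_power n (u i) l) \<le> (?h l)\<^sup>2 * (real n / (2 * pi * c))" for l
      using kernel by (intro mult_left_mono) auto
  qed
  also have "\<dots> = (l2_norm ?h)\<^sup>2 * (real n / (2 * pi * c))"
    unfolding l2_norm_def by (simp add: set_lebesgue_integral_def integral_nonneg)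
  finally have "(\<Sum>i<k. (e i - 1)\<^sup>2) \<le> (l2_norm ?h)\<^sup>2 * (real n / (2 * pi * c)) / c"
    using c by (simp only: pos_le_divide_eq mult.commute)
  then show ?thesis by (simp add: power2_eq_square mult_ac)
qed

section \<open>Gaussian likelihood ratios\<close>

text \<open>The parameter is the variance, not the standard deviation: the eigenvalues are variances
  of coordinates.\<close>

definition centred_normal :: "real \<Rightarrow> real measure" where
  "centred_normal v = density lborel (\<lambda>x. ennreal (normal_density 0 (sqrt v) x))"

lemma sets_centred_normal [simp, measurable_cong]: "sets (centred_normal v) = sets borel"
  by (simp add: centred_normal_def)

lemma space_centred_normal [simp]: "space (centred_normal v) = UNIV"
  by (simp add: centred_normal_def)

lemma real_distribution_centred_normal:
  assumes "0 < v" shows "real_distribution (centred_normal v)"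
proof -
  interpret prob_space "centred_normal v"
    unfolding centred_normal_def using assms by (intro prob_space_normal_density) simp
  show ?thesis by standard auto
qed

lemma char_centred_normal:
  assumes v: "0 < v"
  shows "char (centred_normal v) t = complex_of_real (exp (- v * t\<^sup>2 / 2))"
proof -
  interpret S: real_distribution std_normal_distribution by (rule real_dist_normal_dist)
  have "distributed std_normal_distribution lborel (\<lambda>x. x) (\<lambda>x. ennreal (std_normal_density x))"
    by (auto simp: distributed_def distr_id2)
  then have "distributed std_normal_distribution lborel (\<lambda>x. 0 + sqrt v * x) (normal_density (0 + sqrt v * 0) (\<bar>sqrt v\<bar> * 1))"
    using v by (intro S.normal_density_affine) auto
  then have e: "centred_normal v = distr std_normal_distribution lborel (\<lambda>x. sqrt v * x)"
    using v by (simp add: distributed_def centred_normal_def)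
  have "char (centred_normal v) t = (CLINT x|std_normal_distribution. iexp (t * (sqrt v * x)))"
    unfolding e char_def by (subst integral_distr) auto
  also have "\<dots> = char std_normal_distribution (t * sqrt v)"
    by (simp add: char_def mult.assoc)
  also have "\<dots> = complex_of_real (exp (- v * t\<^sup>2 / 2))"
    using v by (simp add: char_std_normal_distribution power_mult_distrib mult.commute)
  finally show ?thesis .
qed

text \<open>The density of the normal law of variance \<open>v\<close> relative to the standard
  normal law, as a single exponential so that its powers are again Gaussian kernels.\<close>

definition normal_ratio :: "real \<Rightarrow> real \<Rightarrow> real" where
  "normal_ratio v y = exp (- (ln v + (1 / v - 1) * y\<^sup>2) / 2)"

lemma normal_ratio_pos: "0 < normal_ratio v y"
  by (simp add: normal_ratio_def)

lemma normal_ratio_measurable [measurable]: "normal_ratio v \<in> borel_measurable borel"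
  unfolding normal_ratio_def by measurable

lemma exp_half_ln: "0 < v \<Longrightarrow> exp (- ln v / 2) = 1 / sqrt v"
  by (simp add: exp_minus ln_sqrt[symmetric] inverse_eq_divide)

lemma centred_normal_eq_density:
  assumes v: "0 < v"
  shows "centred_normal v = density (centred_normal 1) (\<lambda>y. ennreal (normal_ratio v y))"
proof -
  have eq: "normal_density 0 (sqrt v) y = normal_density 0 (sqrt 1) y * normal_ratio v y" for y
  proof -
    have "normal_ratio v y = exp (- ln v / 2) * exp (- ((1 / v - 1) * y\<^sup>2) / 2)"
      unfolding normal_ratio_def exp_add[symmetric] by (simp add: field_simps)
    also have "\<dots> = 1 / sqrt v * exp (- ((1 / v - 1) * y\<^sup>2) / 2)" using exp_half_ln[OF v] by simp
    finally have r: "normal_ratio v y = 1 / sqrt v * exp (- ((1 / v - 1) * y\<^sup>2) / 2)" .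
    have e: "- (y\<^sup>2 / (2 * v)) = - y\<^sup>2 / 2 + (- ((1 / v - 1) * y\<^sup>2) / 2)" using v by (simp add: field_simps)
    show ?thesis unfolding normal_density_def r using v
      by (simp add: real_sqrt_mult e[simplified] flip: exp_add)
  qed
  show ?thesis
    unfolding centred_normal_def
    by (subst density_density_eq) (auto simp: eq ennreal_mult' normal_ratio_pos less_imp_le)
qed

text \<open>With \<open>s = \<alpha> (v - 1)\<close> the moment equals \<open>exp (- (\<alpha> ln v + ln (1 - s)) / 2)\<close>, in whose
  exponent the terms linear in \<open>v - 1\<close> cancel.\<close>

lemma normal_ratio_moment:
  assumes L: "0 < L" "L \<le> v" and \<alpha>: "0 < \<alpha>" and s: "\<alpha> * (v - 1) \<le> 1/2"
  shows "(\<integral>\<^sup>+y. ennreal (normal_ratio v y powr (1 + \<alpha>)) \<partial>centred_normal 1)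
    \<le> ennreal (exp ((\<alpha> / L / 2 + \<alpha>\<^sup>2) * (v - 1)\<^sup>2))"
proof -
  have v: "0 < v" using L by linarith
  \<comment> \<open>The precision of the Gaussian kernel obtained by multiplying the standard
    density with the power \<open>1 + \<alpha>\<close> of the ratio. The moment is finite because
    \<open>\<alpha> * (v - 1)\<close> below 1 keeps it positive.\<close>
  define \<kappa> where "\<kappa> = (1 - \<alpha> * (v - 1)) / v"
  have \<kappa>: "0 < \<kappa>" unfolding \<kappa>_def using s v by simp
  define c where "c = exp (- (1 + \<alpha>) * ln v / 2) / sqrt \<kappa>"
  have c0: "0 \<le> c" using \<kappa> by (simp add: c_def)
  have \<kappa>_eq: "\<kappa> = 1 + (1 + \<alpha>) * (1 / v - 1)" using v by (simp add: \<kappa>_def field_simps)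
  have eq: "normal_density 0 (sqrt 1) y * normal_ratio v y powr (1 + \<alpha>) = c * normal_density 0 (1 / sqrt \<kappa>) y" for y
  proof -
    have "normal_density 0 (sqrt 1) y * normal_ratio v y powr (1 + \<alpha>)
      = 1 / sqrt (2 * pi) * exp (- y\<^sup>2 / 2 + (1 + \<alpha>) * (- (ln v + (1 / v - 1) * y\<^sup>2) / 2))"
      by (simp add: normal_density_def normal_ratio_def powr_def mult_exp_exp)
    also have "- y\<^sup>2 / 2 + (1 + \<alpha>) * (- (ln v + (1 / v - 1) * y\<^sup>2) / 2) = - (1 + \<alpha>) * ln v / 2 + - (\<kappa> * y\<^sup>2) / 2"
      unfolding \<kappa>_eq by (simp add: field_simps)
    also have "1 / sqrt (2 * pi) * exp (- (1 + \<alpha>) * ln v / 2 + - (\<kappa> * y\<^sup>2) / 2) = c * normal_density 0 (1 / sqrt \<kappa>) y"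
      using \<kappa> unfolding exp_add c_def normal_density_def by (simp add: power_divide real_sqrt_divide)
    finally show ?thesis .
  qed
  have "(\<integral>\<^sup>+y. ennreal (normal_ratio v y powr (1 + \<alpha>)) \<partial>centred_normal 1)
    = (\<integral>\<^sup>+y. ennreal (normal_density 0 (sqrt 1) y) * ennreal (normal_ratio v y powr (1 + \<alpha>)) \<partial>lborel)"
    unfolding centred_normal_def by (subst nn_integral_density) auto
  also have "\<dots> = (\<integral>\<^sup>+y. ennreal c * ennreal (normal_density 0 (1 / sqrt \<kappa>) y) \<partial>lborel)"
    by (intro nn_integral_cong) (simp only: ennreal_mult[symmetric] c0 normal_density_nonneg powr_ge_zero eq)
  also have "\<dots> = ennreal c * (\<integral>\<^sup>+y. ennreal (normal_density 0 (1 / sqrt \<kappa>) y) \<partial>lborel)"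
    by (rule nn_integral_cmult) simp
  also have "(\<integral>\<^sup>+y. ennreal (normal_density 0 (1 / sqrt \<kappa>) y) \<partial>lborel) = 1"
    using \<kappa> by (subst nn_integral_eq_integral) auto
  also have "c \<le> exp ((\<alpha> / L / 2 + \<alpha>\<^sup>2) * (v - 1)\<^sup>2)"
  proof -
    define s where "s = \<alpha> * (v - 1)"
    have s': "s \<le> 1/2" "0 < 1 - s" using s by (auto simp: s_def)
    have \<kappa>_exp: "1 / sqrt \<kappa> = exp (- ln \<kappa> / 2)" using exp_half_ln[OF \<kappa>] by simp
    have "c = exp (- (1 + \<alpha>) * ln v / 2) * (1 / sqrt \<kappa>)" by (simp add: c_def)
    then have "c = exp (- (1 + \<alpha>) * ln v / 2 + - ln \<kappa> / 2)" unfolding \<kappa>_exp exp_add .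
    moreover have "ln \<kappa> = ln (1 - s) - ln v" using s' v by (simp add: \<kappa>_def s_def ln_div)
    moreover have "- (1 + \<alpha>) * ln v / 2 + - (ln (1 - s) - ln v) / 2 = - (\<alpha> * ln v + ln (1 - s)) / 2"
      by (simp add: field_simps)
    ultimately have c: "c = exp (- (\<alpha> * ln v + ln (1 - s)) / 2)" by (simp only:)
    \<comment> \<open>Both logarithms are bounded below by \<open>1 - 1 / x\<close>. The quadratic
      remainders are controlled by \<open>v \<ge> L\<close> in the first and by
      \<open>1 - s \<ge> 1/2\<close> in the second.\<close>
    have "1 - 1 / v \<le> ln v" using ln_le_minus_one[of "1 / v"] v by (simp add: ln_div)
    moreover have "1 - 1 / v = (v - 1) - (v - 1)\<^sup>2 / v" using v by (simp add: power2_eq_square field_simps)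
    moreover have "(v - 1)\<^sup>2 / v \<le> (v - 1)\<^sup>2 / L" using L v by (intro divide_left_mono) auto
    ultimately have "(v - 1) - (v - 1)\<^sup>2 / L \<le> ln v" by linarith
    then have 1: "\<alpha> * ((v - 1) - (v - 1)\<^sup>2 / L) \<le> \<alpha> * ln v" using \<alpha> by (intro mult_left_mono) auto
    have "1 - 1 / (1 - s) \<le> ln (1 - s)" using ln_le_minus_one[of "1 / (1 - s)"] s' by (simp add: ln_div)
    moreover have "1 - 1 / (1 - s) = - s - s\<^sup>2 / (1 - s)" using s' by (simp add: power2_eq_square field_simps)
    moreover have "s\<^sup>2 / (1 - s) \<le> s\<^sup>2 / (1/2)" using s' by (intro divide_left_mono) auto
    ultimately have 2: "- s - 2 * s\<^sup>2 \<le> ln (1 - s)" by simp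
    define T where "T = (\<alpha> / L / 2 + \<alpha>\<^sup>2) * (v - 1)\<^sup>2"
    have "\<alpha> * ((v - 1) - (v - 1)\<^sup>2 / L) + (- s - 2 * s\<^sup>2) = - 2 * T"
      using L(1) by (simp add: T_def s_def power2_eq_square field_simps)
    with add_mono[OF 1 2] have "- 2 * T \<le> \<alpha> * ln v + ln (1 - s)" by (simp only:)
    then have "- (\<alpha> * ln v + ln (1 - s)) / 2 \<le> T" by simp
    then have "- (\<alpha> * ln v + ln (1 - s)) / 2 \<le> (\<alpha> / L / 2 + \<alpha>\<^sup>2) * (v - 1)\<^sup>2" by (simp only: T_def)
    then show ?thesis unfolding c by simp
  qed
  finally show ?thesis using c0 by (simp add: ennreal_leI)
qed

section \<open>Sample laws as images of product measures\<close>

lemma PiM_density: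
  assumes J: "finite J" and N: "\<And>i. prob_space (N i)" and D: "\<And>i. prob_space (density (N i) (h i))"
    and h[measurable]: "\<And>i. h i \<in> borel_measurable (N i)"
  shows "PiM J (\<lambda>i. density (N i) (h i)) = density (PiM J N) (\<lambda>y. \<Prod>i\<in>J. h i (y i))"
proof -
  interpret N: prob_space "N i" for i by (rule N)
  interpret PN: product_prob_space N J ..
  interpret D: prob_space "density (N i) (h i)" for i by (rule D)
  interpret PD: product_prob_space "\<lambda>i. density (N i) (h i)" J ..
  show ?thesis
  proof (rule PD.PiM_eqI[OF J, symmetric])
    show "sets (density (PiM J N) (\<lambda>y. \<Prod>i\<in>J. h i (y i))) = sets (PiM J (\<lambda>i. density (N i) (h i)))"
      by (simp cong: sets_PiM_cong)
    fix A assume "\<And>i. i \<in> J \<Longrightarrow> A i \<in> sets (density (N i) (h i))"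
    then have A[measurable]: "\<And>i. i \<in> J \<Longrightarrow> A i \<in> sets (N i)" by simp
    have [measurable]: "Pi\<^sub>E J A \<in> sets (PiM J N)" using J A by (intro sets_PiM_I_finite) auto
    have "emeasure (density (PiM J N) (\<lambda>y. \<Prod>i\<in>J. h i (y i))) (Pi\<^sub>E J A)
      = (\<integral>\<^sup>+y. (\<Prod>i\<in>J. h i (y i)) * indicator (Pi\<^sub>E J A) y \<partial>PiM J N)"
      by (subst emeasure_density) auto
    also have "\<dots> = (\<integral>\<^sup>+y. (\<Prod>i\<in>J. h i (y i) * indicator (A i) (y i)) \<partial>PiM J N)"
    proof (rule nn_integral_cong)
      fix y assume y: "y \<in> space (PiM J N)"
      have "indicator (Pi\<^sub>E J A) y = (\<Prod>i\<in>J. indicator (A i) (y i) :: ennreal)"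
        using J y by (auto simp: indicator_def PiE_def Pi_def space_PiM)
      then show "(\<Prod>i\<in>J. h i (y i)) * indicator (Pi\<^sub>E J A) y = (\<Prod>i\<in>J. h i (y i) * indicator (A i) (y i))"
        by (simp add: prod.distrib)
    qed
    also have "\<dots> = (\<Prod>i\<in>J. \<integral>\<^sup>+x. h i x * indicator (A i) x \<partial>N i)"
      by (rule PN.product_nn_integral_prod[OF J]) auto
    also have "\<dots> = (\<Prod>i\<in>J. emeasure (density (N i) (h i)) (A i))"
      by (intro prod.cong refl) (simp add: emeasure_density)
    finally show "emeasure (density (PiM J N) (\<lambda>y. \<Prod>i\<in>J. h i (y i))) (Pi\<^sub>E J A) = (\<Prod>i\<in>J. emeasure (density (N i) (h i)) (A i))" .
  qed
qed

text \<open>Uncorrelated jointly Gaussian coordinates are independent: along directions orthogonal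
  for the covariance form the exponent of the characteristic function splits into a sum.\<close>

lemma gaussian_coordinates_law:
  fixes u :: "nat \<Rightarrow> nat \<Rightarrow> real"
  assumes ser: "stationary_gaussian_series W X f" and f: "set_integrable lborel {-pi<..pi} f"
    and orth: "\<And>i j. i < k \<Longrightarrow> j < k \<Longrightarrow> matrix_form {1..n} (toeplitz f) (u i) (u j) = (if i = j then v i else 0)"
    and v: "\<And>i. 0 < v i"
  shows "distr W (PiM {..<k} (\<lambda>_. borel)) (\<lambda>w. \<lambda>i\<in>{..<k}. \<Sum>t\<in>{1..n}. u i t * X (int t) w)
     = PiM {..<k} (\<lambda>i. centred_normal (v i))"
proof (rule joint_law_eq_PiM)
  from ser have gp: "gaussian_process W X" by (simp add: stationary_gaussian_series_def)
  then show "prob_space W" by (simp add: gaussian_process_def)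
  have [measurable]: "\<And>t. X t \<in> borel_measurable W" using gp by (simp add: gaussian_process_def)
  show "(\<lambda>w. \<Sum>t\<in>{1..n}. u i t * X (int t) w) \<in> borel_measurable W" for i by measurable
  show "real_distribution (centred_normal (v i))" for i by (rule real_distribution_centred_normal[OF v])
  fix t :: "nat \<Rightarrow> real"
  define a where "a s = (\<Sum>i<k. t i * u i s)" for s
  have "(\<Sum>i<k. t i * (\<Sum>s\<in>{1..n}. u i s * X (int s) w)) = (\<Sum>s\<in>{1..n}. a s * X (int s) w)" for w
    unfolding a_def sum_distrib_left sum_distrib_right by (subst sum.swap) (simp add: mult.assoc)
  then have "(CLINT w|W. iexp (\<Sum>i<k. t i * (\<Sum>s\<in>{1..n}. u i s * X (int s) w))) = complex_of_real (exp (- trig_form n f a a / 2))"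
    using gaussian_linear_combination[OF ser f, of a n] by presburger
  also have "trig_form n f a a = (\<Sum>i<k. \<Sum>j<k. t i * (t j * matrix_form {1..n} (toeplitz f) (u i) (u j)))"
    unfolding trig_form_eq_matrix_form[OF f] a_def matrix_form_sum_left matrix_form_sum_right
    by (simp add: sum_distrib_left)
  also have "\<dots> = (\<Sum>i<k. v i * (t i)\<^sup>2)"
  proof (intro sum.cong refl)
    fix i assume "i \<in> {..<k}"
    then have i: "i < k" by simp
    have "(\<Sum>j<k. t i * (t j * matrix_form {1..n} (toeplitz f) (u i) (u j))) = (\<Sum>j<k. if j = i then v i * (t i)\<^sup>2 else 0)"
      by (intro sum.cong refl) (use orth[OF i] in \<open>auto simp: power2_eq_square\<close>)
    then show "(\<Sum>j<k. t i * (t j * matrix_form {1..n} (toeplitz f) (u i) (u j))) = v i * (t i)\<^sup>2"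
      using i by simp
  qed
  also have "complex_of_real (exp (- (\<Sum>i<k. v i * (t i)\<^sup>2) / 2)) = (\<Prod>i<k. char (centred_normal (v i)) (t i))"
    by (simp add: char_centred_normal[OF v] exp_sum sum_negf[symmetric] sum_divide_distrib del: sum_negf flip: of_real_prod of_real_exp)
  finally show "(CLINT w|W. iexp (\<Sum>i\<in>{..<k}. t i * (\<Sum>s\<in>{1..n}. u i s * X (int s) w))) = (\<Prod>i\<in>{..<k}. char (centred_normal (v i)) (t i))" .
qed simp

lemma sum_mult_unit:
  fixes x :: "'i \<Rightarrow> real"
  assumes "finite I" "t \<in> I"
  shows "(\<Sum>s\<in>I. (if s = t then 1 else 0) * x s) = x t" "(\<Sum>s\<in>I. x s * (if t = s then 1 else 0)) = x t"
proof -
  have "(\<Sum>s\<in>I. (if s = t then 1 else 0) * x s) = (\<Sum>s\<in>I. if s = t then x s else 0)"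
    by (intro sum.cong) auto
  also have "\<dots> = x t" using assms by simp
  finally show "(\<Sum>s\<in>I. (if s = t then 1 else 0) * x s) = x t" .
  have "(\<Sum>s\<in>I. x s * (if t = s then 1 else 0)) = (\<Sum>s\<in>I. if s = t then x s else 0)"
    by (intro sum.cong) auto
  also have "\<dots> = x t" using assms by simp
  finally show "(\<Sum>s\<in>I. x s * (if t = s then 1 else 0)) = x t" .
qed

text \<open>In the common eigenbasis both laws are images of product measures under the same
  bijection \<open>decode\<close>, so the ratio is a product of univariate ratios and its moment a
  product of moments. The hypothesis \<open>fg\<close> bounds every eigenvalue by
  \<open>1 + 1 / (2 * \<alpha>)\<close>, precisely the condition under which the univariate moment
  was estimated.\<close>

lemma gaussian_likelihood_ratio:
  assumes serf: "stationary_gaussian_series W X f" and serg: "stationary_gaussian_series W' X' g"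
    and f: "set_integrable lborel {-pi<..pi} f" and g: "set_integrable lborel {-pi<..pi} g"
    and c: "0 < c"
    and fb: "\<And>l. l \<in> {-pi<..pi} \<Longrightarrow> c \<le> f l \<and> f l \<le> C" and gb: "\<And>l. l \<in> {-pi<..pi} \<Longrightarrow> c \<le> g l \<and> g l \<le> C"
    and \<alpha>: "0 < \<alpha>" and fg: "\<And>l. l \<in> {-pi<..pi} \<Longrightarrow> f l \<le> (1 + 1 / (2 * \<alpha>)) * g l"
  obtains r where "r \<in> borel_measurable (sample_space n)" "\<And>x. 0 < r x"
    "sample_law W X n = density (sample_law W' X' n) (\<lambda>x. ennreal (r x))"
    "(\<integral>\<^sup>+x. ennreal (r x powr (1 + \<alpha>)) \<partial>sample_law W' X' n)
      \<le> ennreal (exp ((\<alpha> * C / c / 2 + \<alpha>\<^sup>2) * (real n / (2 * pi * c\<^sup>2) * (l2_norm (\<lambda>l. f l - g l))\<^sup>2)))"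
proof -
  let ?I = "{1..n}" and ?G = "toeplitz g" and ?H = "toeplitz f"
  have posG: "2 * pi * c * (\<Sum>t\<in>?I. (a t)\<^sup>2) \<le> matrix_form ?I ?G a a" for a
    using trig_form_ge[OF g, of c a n] gb by (simp add: trig_form_eq_matrix_form[OF g])
  obtain k u e where E: "eigensystem ?I ?G ?H k u e"
    and span: "\<And>a t. t \<in> ?I \<Longrightarrow> a t = (\<Sum>i<k. matrix_form ?I ?G (u i) a * u i t)"
  proof (rule simultaneous_diagonalization[of ?I "2 * pi * c" ?G ?H])
    show "?G s t = ?G t s" "?H s t = ?H t s" for s t
      by (rule toeplitz_commute[OF g], rule toeplitz_commute[OF f])
  qed (use c posG in auto)
  have on: "matrix_form ?I ?G (u i) (u j) = (if i = j then 1 else 0)" if "i < k" "j < k" for i j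
    using E that by (auto simp: eigensystem_def)
  have orth: "matrix_form ?I ?H (u i) (u j) = (if i = j then e i else 0)" if "i < k" "j < k" for i j
    using E on that by (auto simp: eigensystem_def)
  \<comment> \<open>Pointwise \<open>L * g \<le> c \<le> f\<close>, so monotonicity of the forms
    puts every eigenvalue above \<open>L\<close>.\<close>
  define L where "L = c / C"
  have Cpos: "0 < C" using fb[of 0] c by auto
  have e_lower: "L \<le> e i" and e_upper: "\<alpha> * (e i - 1) \<le> 1 / 2" if i: "i < k" for i
  proof -
    have tg: "trig_form n g (u i) (u i) = 1" and tf: "trig_form n f (u i) (u i) = e i"
      using on orth i by (auto simp: trig_form_eq_matrix_form f g)
    have scale: "trig_form n (\<lambda>l. b * g l) (u i) (u i) = b" for b
      using tg unfolding trig_form_self by (simp add: mult.assoc)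
    have "trig_form n (\<lambda>l. L * g l) (u i) (u i) \<le> trig_form n f (u i) (u i)"
    proof (rule trig_form_mono)
      fix l assume l: "l \<in> {-pi<..pi}"
      have "L * g l \<le> L * C" using gb[OF l] c Cpos by (intro mult_left_mono) (auto simp: L_def)
      then show "L * g l \<le> f l" using fb[OF l] Cpos by (simp add: L_def)
    qed (use f g in auto)
    then show "L \<le> e i" using scale tf by simp
    have "trig_form n f (u i) (u i) \<le> trig_form n (\<lambda>l. (1 + 1 / (2 * \<alpha>)) * g l) (u i) (u i)"
      by (rule trig_form_mono) (use f g fg in auto)
    then have "e i - 1 \<le> 1 / (2 * \<alpha>)" using scale tf by simp
    then have "\<alpha> * (e i - 1) \<le> \<alpha> * (1 / (2 * \<alpha>))" using \<alpha> by (intro mult_left_mono) auto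
    then show "\<alpha> * (e i - 1) \<le> 1 / 2" using \<alpha> by simp
  qed
  have Lpos: "0 < L" using c Cpos by (simp add: L_def)
  \<comment> \<open>The value 1 beyond \<open>k\<close> keeps every factor of the indexed family a
    probability measure.\<close>
  define v where "v i = (if i < k then e i else 1)" for i
  have v: "0 < v i" for i using Lpos e_lower[of i] by (auto simp: v_def)
  define coord where "coord x = (\<lambda>i\<in>{..<k}. \<Sum>t\<in>?I. u i t * x t)" for x :: "nat \<Rightarrow> real"
  \<comment> \<open>The expansion of unit vectors in the eigenbasis recovers the observations from
    their coordinates. Spanning makes \<open>decode\<close> a left inverse of \<open>coord\<close>
    on \<open>{1..n}\<close>, and orthonormality makes it a right inverse; thus no count of
    \<open>k\<close> against \<open>n\<close> enters.\<close>
  define decode where "decode y = (\<lambda>t\<in>?I. \<Sum>i<k. matrix_form ?I ?G (u i) (\<lambda>s. if s = t then 1 else 0) * y i)" for y :: "nat \<Rightarrow> real"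
  have [measurable]: "coord \<in> measurable (sample_space n) (PiM {..<k} (\<lambda>_. borel))"
    unfolding coord_def by measurable
  have [measurable]: "decode \<in> measurable (PiM {..<k} (\<lambda>_. borel)) (sample_space n)"
    unfolding decode_def by measurable
  have decode_coord: "decode (coord x) = (\<lambda>t\<in>?I. x t)" for x
  proof
    fix t
    show "decode (coord x) t = (\<lambda>t\<in>?I. x t) t"
    proof (cases "t \<in> ?I")
      case True
      let ?\<delta> = "\<lambda>s. if s = t then 1 else 0 :: real"
      have "x t = (\<Sum>s\<in>?I. ?\<delta> s * x s)" using True sum_mult_unit(1)[of ?I t x] by simp
      also have "\<dots> = (\<Sum>s\<in>?I. (\<Sum>i<k. matrix_form ?I ?G (u i) ?\<delta> * u i s) * x s)"
        by (intro sum.cong refl arg_cong[where f="\<lambda>z. z * _"] span)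
      also have "\<dots> = (\<Sum>i<k. matrix_form ?I ?G (u i) ?\<delta> * (\<Sum>s\<in>?I. u i s * x s))"
        unfolding sum_distrib_left sum_distrib_right by (subst sum.swap) (simp add: mult.assoc)
      finally show ?thesis using True by (simp add: decode_def coord_def)
    qed (auto simp: decode_def)
  qed
  have coord_decode: "coord (decode y) = y" if "y \<in> space (PiM {..<k} (\<lambda>_. borel))" for y
  proof
    fix i
    show "coord (decode y) i = y i"
    proof (cases "i < k")
      case True
      have "(\<Sum>t\<in>?I. u i t * (\<Sum>j<k. matrix_form ?I ?G (u j) (\<lambda>s. if s = t then 1 else 0) * y j))
        = (\<Sum>j<k. y j * (\<Sum>t\<in>?I. u i t * matrix_form ?I ?G (u j) (\<lambda>s. if s = t then 1 else 0)))"
        unfolding sum_distrib_left by (subst sum.swap) (simp add: mult_ac)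
      also have "\<dots> = (\<Sum>j<k. y j * matrix_form ?I ?G (u j) (\<lambda>s. \<Sum>t\<in>?I. u i t * (if s = t then 1 else 0)))"
        unfolding matrix_form_sum_right ..
      also have "\<dots> = (\<Sum>j<k. y j * matrix_form ?I ?G (u j) (u i))"
        by (intro sum.cong refl arg_cong[where f="\<lambda>z. _ * z"] matrix_form_cong sum_mult_unit(2)) auto
      also have "\<dots> = y i"
      proof -
        have "(\<Sum>j<k. y j * matrix_form ?I ?G (u j) (u i)) = (\<Sum>j<k. y j * (if i = j then 1 else 0))"
          using True by (intro sum.cong refl) (simp only: on lessThan_iff eq_commute[of i])
        then show ?thesis using True sum_mult_unit(2)[of "{..<k}" i y] by simp
      qed
      finally show ?thesis using True by (simp add: coord_def decode_def)
    next
      case False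
      then show ?thesis using that by (auto simp: coord_def space_PiM PiE_def extensional_def)
    qed
  qed
  have law: "sample_law V Z n = distr (PiM {..<k} (\<lambda>i. centred_normal (w i))) (sample_space n) decode"
    if ser: "stationary_gaussian_series V Z h" and h: "set_integrable lborel {-pi<..pi} h"
      and w: "\<And>i. 0 < w i"
      and o: "\<And>i j. i < k \<Longrightarrow> j < k \<Longrightarrow> matrix_form ?I (toeplitz h) (u i) (u j) = (if i = j then w i else 0)" for V :: "'z measure" and Z h w
  proof -
    have [measurable]: "\<And>t. Z t \<in> borel_measurable V" using ser by (simp add: stationary_gaussian_series_def gaussian_process_def)
    have "distr (PiM {..<k} (\<lambda>i. centred_normal (w i))) (sample_space n) decode
      = distr (distr V (PiM {..<k} (\<lambda>_. borel)) (\<lambda>x. \<lambda>i\<in>{..<k}. \<Sum>t\<in>?I. u i t * Z (int t) x)) (sample_space n) decode"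
      by (subst gaussian_coordinates_law[OF ser h, where v=w and u=u]) (use o w in auto)
    also have "\<dots> = distr V (sample_space n) (\<lambda>x. decode (coord (\<lambda>t. Z (int t) x)))"
      by (subst distr_distr) (auto simp: comp_def coord_def simp del: One_nat_def)
    also have "\<dots> = sample_law V Z n" unfolding decode_coord sample_law_def ..
    finally show ?thesis ..
  qed
  have lawf: "sample_law W X n = distr (PiM {..<k} (\<lambda>i. centred_normal (v i))) (sample_space n) decode"
  proof (rule law[OF serf f v])
    show "matrix_form ?I ?H (u i) (u j) = (if i = j then v i else 0)" if "i < k" "j < k" for i j
      using orth[OF that] that by (simp add: v_def)
  qed
  have lawg: "sample_law W' X' n = distr (PiM {..<k} (\<lambda>i. centred_normal 1)) (sample_space n) decode"
    by (rule law[OF serg g _ on]) auto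
  define \<rho> where "\<rho> y = (\<Prod>i<k. normal_ratio (v i) (y i))" for y :: "nat \<Rightarrow> real"
  have \<rho>_pos: "0 < \<rho> y" for y unfolding \<rho>_def by (intro prod_pos) (auto simp: normal_ratio_pos)
  have [measurable]: "\<rho> \<in> borel_measurable (PiM {..<k} (\<lambda>_. borel))" unfolding \<rho>_def by measurable
  define r where "r x = \<rho> (coord x)" for x
  have r_meas [measurable]: "r \<in> borel_measurable (sample_space n)" unfolding r_def by measurable
  have r_pos: "0 < r x" for x unfolding r_def by (rule \<rho>_pos)
  let ?Q = "PiM {..<k} (\<lambda>i. centred_normal 1)"
  have setsQ[measurable_cong]: "sets ?Q = sets (PiM {..<k} (\<lambda>_. borel))" by (intro sets_PiM_cong) auto
  have spaceQ: "space ?Q = space (PiM {..<k} (\<lambda>_. borel))" by (rule sets_eq_imp_space_eq[OF setsQ])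
  have prob: "prob_space (centred_normal (w :: real))" if "0 < w" for w
    using real_distribution_centred_normal[OF that] by (simp add: real_distribution_def)
  have "PiM {..<k} (\<lambda>i. centred_normal (v i)) = PiM {..<k} (\<lambda>i. density (centred_normal 1) (\<lambda>y. ennreal (normal_ratio (v i) y)))"
    using centred_normal_eq_density[OF v] by simp
  also have "\<dots> = density ?Q (\<lambda>y. \<Prod>i<k. ennreal (normal_ratio (v i) (y i)))"
    by (rule PiM_density) (use prob v in \<open>auto simp flip: centred_normal_eq_density\<close>)
  also have "\<dots> = density ?Q (\<lambda>y. ennreal (\<rho> y))"
    by (simp add: \<rho>_def prod_ennreal normal_ratio_pos less_imp_le)
  also have "\<dots> = density ?Q (\<lambda>y. ennreal (r (decode y)))"
    by (intro density_cong) (auto simp: r_def coord_decode spaceQ simp del: One_nat_def)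
  finally have dens: "PiM {..<k} (\<lambda>i. centred_normal (v i)) = density ?Q (\<lambda>y. ennreal (r (decode y)))" .
  have "sample_law W X n = density (sample_law W' X' n) (\<lambda>x. ennreal (r x))"
    unfolding lawf lawg dens by (subst density_distr) (auto simp del: One_nat_def)
  moreover have "(\<integral>\<^sup>+x. ennreal (r x powr (1 + \<alpha>)) \<partial>sample_law W' X' n)
      \<le> ennreal (exp ((\<alpha> * C / c / 2 + \<alpha>\<^sup>2) * (real n / (2 * pi * c\<^sup>2) * (l2_norm (\<lambda>l. f l - g l))\<^sup>2)))"
  proof -
    interpret N: prob_space "centred_normal 1" by (rule prob) simp
    interpret PN: product_prob_space "\<lambda>_. centred_normal 1" "{..<k}" ..
    have "(\<integral>\<^sup>+x. ennreal (r x powr (1 + \<alpha>)) \<partial>sample_law W' X' n) = (\<integral>\<^sup>+y. ennreal (\<rho> y powr (1 + \<alpha>)) \<partial>?Q)"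
      unfolding lawg by (subst nn_integral_distr) (auto simp: r_def coord_decode spaceQ simp del: One_nat_def intro!: nn_integral_cong)
    also have "\<dots> = (\<integral>\<^sup>+y. (\<Prod>i<k. ennreal (normal_ratio (v i) (y i) powr (1 + \<alpha>))) \<partial>?Q)"
      by (intro nn_integral_cong) (simp add: \<rho>_def prod_powr_distrib prod_ennreal)
    also have "\<dots> = (\<Prod>i<k. \<integral>\<^sup>+y. ennreal (normal_ratio (v i) y powr (1 + \<alpha>)) \<partial>centred_normal 1)"
      by (rule PN.product_nn_integral_prod) auto
    also have "\<dots> \<le> (\<Prod>i<k. ennreal (exp ((\<alpha> / L / 2 + \<alpha>\<^sup>2) * (e i - 1)\<^sup>2)))"
    proof (rule prod_mono_ennreal)
      fix i assume "i \<in> {..<k}"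
      then have "i < k" by simp
      with normal_ratio_moment[OF Lpos e_lower \<alpha> e_upper, of i]
      show "(\<integral>\<^sup>+y. ennreal (normal_ratio (v i) y powr (1 + \<alpha>)) \<partial>centred_normal 1) \<le> ennreal (exp ((\<alpha> / L / 2 + \<alpha>\<^sup>2) * (e i - 1)\<^sup>2))"
        by (simp add: v_def)
    qed
    also have "\<dots> = ennreal (exp ((\<alpha> / L / 2 + \<alpha>\<^sup>2) * (\<Sum>i<k. (e i - 1)\<^sup>2)))"
      by (simp add: prod_ennreal exp_sum sum_distrib_left)
    also have "\<dots> \<le> ennreal (exp ((\<alpha> / L / 2 + \<alpha>\<^sup>2) * (real n / (2 * pi * c\<^sup>2) * (l2_norm (\<lambda>l. f l - g l))\<^sup>2)))"
    proof (intro ennreal_leI exp_mono mult_left_mono)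
      show "(\<Sum>i<k. (e i - 1)\<^sup>2) \<le> real n / (2 * pi * c\<^sup>2) * (l2_norm (\<lambda>l. f l - g l))\<^sup>2"
        by (rule eigenvalue_deviation_bound[OF f g c fb gb E])
    qed (use Lpos \<alpha> in auto)
    finally show ?thesis by (simp add: L_def)
  qed
  ultimately show ?thesis by (rule that[OF r_meas r_pos])
qed

section \<open>Posterior mass in dominated models\<close>

lemma ennreal_inverse_antimono: "x \<le> y \<Longrightarrow> inverse y \<le> inverse (x :: ennreal)"
  by (simp add: less_eq_ennreal.rep_eq inverse_ennreal.rep_eq ereal_inverse_antimono)

text \<open>Cauchy-Schwarz for \<open>r * \<psi>\<close> under \<open>Q\<close>, with the square of
  \<psi> bounded by \<psi>. The square root is the reason why the exponent \<open>2 * a\<close> of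
  the test is halved.\<close>

lemma likelihood_ratio_change_of_measure:
  fixes r \<psi> :: "'x \<Rightarrow> real"
  assumes dens: "P = density Q (\<lambda>x. ennreal (r x))"
    and r: "r \<in> borel_measurable Q" "\<And>x. 0 < r x"
    and moment: "(\<integral>\<^sup>+x. ennreal (r x powr (1 + 1)) \<partial>Q) \<le> ennreal (exp b)"
    and \<psi>: "\<psi> \<in> borel_measurable Q" "\<And>x. x \<in> space Q \<Longrightarrow> 0 \<le> \<psi> x \<and> \<psi> x \<le> 1"
    and small: "(\<integral>\<^sup>+x. ennreal (\<psi> x) \<partial>Q) \<le> ennreal (exp (- (2 * a)))"
  shows "(\<integral>\<^sup>+x. ennreal (\<psi> x) \<partial>P) \<le> ennreal (exp (b / 2 - a))"
proof -
  note [measurable] = r(1) \<psi>(1)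
  \<comment> \<open>The balancing weight: it makes both terms of the AM-GM bound equal to half of
    the result.\<close>
  define s where "s = exp (a + b / 2)"
  have s: "0 < s" by (simp add: s_def)
  have amgm: "r x * \<psi> x \<le> s / 2 * \<psi> x + 1 / (2 * s) * r x powr (1 + 1)" if x: "x \<in> space Q" for x
  proof -
    have "0 \<le> (s * \<psi> x - r x)\<^sup>2" by simp
    then have "2 * s * (r x * \<psi> x) \<le> s\<^sup>2 * (\<psi> x)\<^sup>2 + (r x)\<^sup>2" by (simp add: power2_eq_square algebra_simps)
    also have "\<dots> \<le> s\<^sup>2 * \<psi> x + (r x)\<^sup>2"
      using \<psi>(2)[OF x] by (intro add_right_mono mult_left_mono) (auto simp: power2_eq_square mult_left_le)
    finally have "2 * s * (r x * \<psi> x) \<le> s\<^sup>2 * \<psi> x + (r x)\<^sup>2" .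
    then have "r x * \<psi> x \<le> (s\<^sup>2 * \<psi> x + (r x)\<^sup>2) / (2 * s)" using s by (simp add: field_simps)
    also have "\<dots> = s / 2 * \<psi> x + 1 / (2 * s) * (r x)\<^sup>2" using s by (simp add: field_simps power2_eq_square)
    also have "(r x)\<^sup>2 = r x powr (1 + 1)" using r(2)[of x] by (simp add: powr_numeral)
    finally show ?thesis .
  qed
  have "(\<integral>\<^sup>+x. ennreal (\<psi> x) \<partial>P) = (\<integral>\<^sup>+x. ennreal (r x) * ennreal (\<psi> x) \<partial>Q)"
    unfolding dens by (subst nn_integral_density) auto
  also have "\<dots> \<le> (\<integral>\<^sup>+x. ennreal (s / 2) * ennreal (\<psi> x) + ennreal (1 / (2 * s)) * ennreal (r x powr (1 + 1)) \<partial>Q)"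
  proof (rule nn_integral_mono)
    fix x assume x: "x \<in> space Q"
    have "ennreal (r x) * ennreal (\<psi> x) = ennreal (r x * \<psi> x)" using r(2)[of x] \<psi>(2)[OF x] by (simp add: ennreal_mult)
    also have "\<dots> \<le> ennreal (s / 2 * \<psi> x + 1 / (2 * s) * r x powr (1 + 1))" by (rule ennreal_leI[OF amgm[OF x]])
    also have "\<dots> = ennreal (s / 2) * ennreal (\<psi> x) + ennreal (1 / (2 * s)) * ennreal (r x powr (1 + 1))"
      using s \<psi>(2)[OF x] by (subst ennreal_plus) (auto simp: ennreal_mult[symmetric])
    finally show "ennreal (r x) * ennreal (\<psi> x) \<le> ennreal (s / 2) * ennreal (\<psi> x) + ennreal (1 / (2 * s)) * ennreal (r x powr (1 + 1))" .
  qed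
  also have "\<dots> = ennreal (s / 2) * (\<integral>\<^sup>+x. ennreal (\<psi> x) \<partial>Q) + ennreal (1 / (2 * s)) * (\<integral>\<^sup>+x. ennreal (r x powr (1 + 1)) \<partial>Q)"
    by (subst nn_integral_add) (auto simp: nn_integral_cmult)
  also have "\<dots> \<le> ennreal (s / 2) * ennreal (exp (- (2 * a))) + ennreal (1 / (2 * s)) * ennreal (exp b)"
    by (intro add_mono mult_left_mono small moment) auto
  also have "\<dots> = ennreal (s / 2 * exp (- (2 * a)) + 1 / (2 * s) * exp b)"
    using s by (subst ennreal_plus) (auto simp: ennreal_mult[symmetric])
  also have "s / 2 * exp (- (2 * a)) + 1 / (2 * s) * exp b = exp (b / 2 - a)"
  proof -
    have 1: "s * exp (- (2 * a)) = exp (b / 2 - a)" unfolding s_def mult_exp_exp by (simp add: algebra_simps)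
    have "exp b = s * exp (b / 2 - a)" unfolding s_def mult_exp_exp by (simp add: algebra_simps)
    then have 2: "1 / (2 * s) * exp b = exp (b / 2 - a) / 2" using s by (simp add: field_simps)
    from 1 2 show ?thesis by (simp add: algebra_simps)
  qed
  finally show ?thesis .
qed

text \<open>On the event \<open>p = q * r\<close> forces \<open>c * r \<ge> 1\<close>, hence
  \<open>(c * r) powr \<alpha> \<ge> 1\<close>. This is Markov's inequality for
  \<open>r powr \<alpha>\<close> under \<open>p\<close>, and passing to \<open>q\<close> raises the
  order of the moment by one.\<close>

lemma likelihood_ratio_markov:
  fixes r :: "'x \<Rightarrow> real" and p q :: "'x \<Rightarrow> ennreal"
  assumes \<mu>: "sigma_finite_measure \<mu>" and p[measurable]: "p \<in> borel_measurable \<mu>" and q[measurable]: "q \<in> borel_measurable \<mu>"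
    and dens: "density \<mu> p = density (density \<mu> q) (\<lambda>x. ennreal (r x))"
    and r: "r \<in> borel_measurable \<mu>" "\<And>x. 0 < r x" and \<alpha>: "0 < \<alpha>" and c: "0 < c"
    and moment: "(\<integral>\<^sup>+x. ennreal (r x powr (1 + \<alpha>)) \<partial>density \<mu> q) \<le> ennreal b"
  shows "emeasure (density \<mu> p) {x\<in>space \<mu>. q x < ennreal c * p x} \<le> ennreal (c powr \<alpha> * b)"
proof -
  note [measurable] = r(1)
  interpret sigma_finite_measure \<mu> by fact
  have "density (density \<mu> q) (\<lambda>x. ennreal (r x)) = density \<mu> (\<lambda>x. q x * ennreal (r x))"
    by (rule density_density_eq) auto
  with dens have ae: "AE x in \<mu>. p x = q x * ennreal (r x)"
    by (intro density_unique) auto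
  have "emeasure (density \<mu> p) {x\<in>space \<mu>. q x < ennreal c * p x}
     = (\<integral>\<^sup>+x. p x * indicator {x\<in>space \<mu>. q x < ennreal c * p x} x \<partial>\<mu>)"
    by (subst emeasure_density) auto
  also have "\<dots> \<le> (\<integral>\<^sup>+x. ennreal (c powr \<alpha>) * (q x * ennreal (r x powr (1 + \<alpha>))) \<partial>\<mu>)"
  proof (rule nn_integral_mono_AE)
    show "AE x in \<mu>. p x * indicator {x\<in>space \<mu>. q x < ennreal c * p x} x \<le> ennreal (c powr \<alpha>) * (q x * ennreal (r x powr (1 + \<alpha>)))"
      using ae
    proof eventually_elim
      fix x assume px: "p x = q x * ennreal (r x)"
      show "p x * indicator {x\<in>space \<mu>. q x < ennreal c * p x} x \<le> ennreal (c powr \<alpha>) * (q x * ennreal (r x powr (1 + \<alpha>)))"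
      proof (cases "q x < ennreal c * p x")
        case True
        have rx: "0 < r x" by (rule r(2))
        have "1 \<le> c * r x"
        proof (rule ccontr)
          assume "\<not> 1 \<le> c * r x"
          then have "ennreal (c * r x) \<le> 1" by (simp add: ennreal_le_1)
          then have "q x * ennreal (c * r x) \<le> q x * 1" by (rule mult_left_mono) simp
          moreover have "ennreal c * p x = q x * ennreal (c * r x)" using c rx by (simp add: px ennreal_mult mult_ac)
          ultimately show False using True by simp
        qed
        then have "1 \<le> (c * r x) powr \<alpha>" using \<alpha> by (intro ge_one_powr_ge_zero) auto
        then have "r x \<le> c powr \<alpha> * r x powr (1 + \<alpha>)"
          using c rx mult_left_mono[of 1 "(c * r x) powr \<alpha>" "r x"] by (simp add: powr_mult powr_add mult_ac)
        then have "ennreal (r x) \<le> ennreal (c powr \<alpha>) * ennreal (r x powr (1 + \<alpha>))"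
          by (simp add: ennreal_mult[symmetric] ennreal_leI)
        then have "q x * ennreal (r x) \<le> q x * (ennreal (c powr \<alpha>) * ennreal (r x powr (1 + \<alpha>)))" by (rule mult_left_mono) simp
        then show ?thesis unfolding px by (auto simp: mult_ac split: split_indicator)
      qed simp
    qed
  qed
  also have "\<dots> = ennreal (c powr \<alpha>) * (\<integral>\<^sup>+x. ennreal (r x powr (1 + \<alpha>)) \<partial>density \<mu> q)"
    by (subst nn_integral_cmult) (auto simp: nn_integral_density)
  also have "\<dots> \<le> ennreal (c powr \<alpha>) * ennreal b" by (intro mult_left_mono moment) auto
  also have "\<dots> = ennreal (c powr \<alpha> * b)" by (simp add: ennreal_mult')
  finally show ?thesis .
qed

section \<open>Evidence and posterior mass under a prior\<close>

context
  fixes Pr :: "'f measure" and Q :: "'f \<Rightarrow> 'x measure" and \<mu> :: "'x measure" and p :: "'f \<Rightarrow> 'x \<Rightarrow> ennreal" and f0 :: 'f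
  assumes prior: "prob_space Pr" and model: "dominated_model Pr Q \<mu> p" and f0: "f0 \<in> space Pr"
begin

lemma model_facts:
  shows "sigma_finite_measure \<mu>" and model_measurable: "(\<lambda>(f, x). p f x) \<in> borel_measurable (Pr \<Otimes>\<^sub>M \<mu>)"
    and Q_density: "f \<in> space Pr \<Longrightarrow> Q f = density \<mu> (p f)"
    and p_measurable: "f \<in> space Pr \<Longrightarrow> p f \<in> borel_measurable \<mu>"
    and p_swap_measurable: "(\<lambda>(x, f). p f x) \<in> borel_measurable (\<mu> \<Otimes>\<^sub>M Pr)"
proof -
  show m: "(\<lambda>(f, x). p f x) \<in> borel_measurable (Pr \<Otimes>\<^sub>M \<mu>)" and "sigma_finite_measure \<mu>"
    and "f \<in> space Pr \<Longrightarrow> Q f = density \<mu> (p f)"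
    using model by (auto simp: dominated_model_def)
  show "p f \<in> borel_measurable \<mu>" if "f \<in> space Pr"
    using measurable_compose[OF measurable_Pair1'[OF that] m] by simp
  show "(\<lambda>(x, f). p f x) \<in> borel_measurable (\<mu> \<Otimes>\<^sub>M Pr)"
    using measurable_pair_swap[OF m] by (simp add: case_prod_beta')
qed

lemma partial_marginal_measurable:
  assumes [measurable]: "A \<in> sets Pr"
  shows "(\<lambda>x. \<integral>\<^sup>+f\<in>A. p f x \<partial>Pr) \<in> borel_measurable \<mu>"
proof -
  interpret Pr: prob_space Pr by (rule prior)
  note [measurable] = p_swap_measurable
  have "(\<lambda>(x, f). p f x * indicator A f) \<in> borel_measurable (\<mu> \<Otimes>\<^sub>M Pr)" by measurable
  then show ?thesis by (rule Pr.borel_measurable_nn_integral)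
qed

text \<open>If the evidence from \<open>B\<close> falls short of \<open>c\<close> times its
  reference value, then at least half of the prior mass of \<open>B\<close> sits on parameters whose
  likelihood ratio is below \<open>2 * c\<close>. By Fubini the expected mass of such parameters is
  at most \<delta> times that of \<open>B\<close>, and Markov's inequality yields the factor
  2.\<close>

lemma evidence_lower_bound:
  assumes B[measurable]: "B \<in> sets Pr" and Bpos: "0 < emeasure Pr B" and c: "0 < c"
    and ratio: "\<And>f. f \<in> B \<Longrightarrow> emeasure (Q f0) {x\<in>space \<mu>. p f x < ennreal (2 * c) * p f0 x} \<le> \<delta>"
  shows "emeasure (Q f0) {x\<in>space \<mu>. (\<integral>\<^sup>+f\<in>B. p f x \<partial>Pr) < ennreal c * emeasure Pr B * p f0 x} \<le> 2 * \<delta>"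
proof -
  interpret Pr: prob_space Pr by (rule prior)
  interpret mu: sigma_finite_measure \<mu> by (rule model_facts)
  interpret pm: pair_sigma_finite Pr \<mu> by standard
  note [measurable] = p_swap_measurable model_measurable p_measurable[OF f0] partial_marginal_measurable[OF B]
  let ?N = "{x\<in>space \<mu>. (\<integral>\<^sup>+f\<in>B. p f x \<partial>Pr) < ennreal c * emeasure Pr B * p f0 x}"
  define L :: "'f \<Rightarrow> 'x \<Rightarrow> ennreal" where
    "L f x = indicator B f * indicator {x\<in>space \<mu>. p f x < ennreal (2 * c) * p f0 x} x" for f x
  have Bfin: "emeasure Pr B < \<infinity>" by (simp add: less_top[symmetric])
  have Lm[measurable]: "(\<lambda>(f, x). L f x) \<in> borel_measurable (Pr \<Otimes>\<^sub>M \<mu>)"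
  proof -
    have "(\<lambda>(f, x). L f x) = (\<lambda>z. indicator (B \<times> space \<mu> \<inter> {z \<in> space (Pr \<Otimes>\<^sub>M \<mu>). p (fst z) (snd z) < ennreal (2 * c) * p f0 (snd z)}) z)"
      using sets.sets_into_space[OF B] by (auto simp: fun_eq_iff indicator_def space_pair_measure L_def)
    moreover have "{z \<in> space (Pr \<Otimes>\<^sub>M \<mu>). p (fst z) (snd z) < ennreal (2 * c) * p f0 (snd z)} \<in> sets (Pr \<Otimes>\<^sub>M \<mu>)"
    proof -
      have [measurable]: "(\<lambda>z. p (fst z) (snd z)) \<in> borel_measurable (Pr \<Otimes>\<^sub>M \<mu>)"
        using model_measurable by (simp add: case_prod_beta')
      have [measurable]: "(\<lambda>z. p f0 (snd z)) \<in> borel_measurable (Pr \<Otimes>\<^sub>M \<mu>)"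
        by (rule measurable_compose[OF measurable_snd p_measurable[OF f0]])
      show ?thesis by measurable
    qed
    ultimately show ?thesis by auto
  qed
  have Lm'[measurable]: "(\<lambda>(x, f). L f x) \<in> borel_measurable (\<mu> \<Otimes>\<^sub>M Pr)"
    using measurable_pair_swap[OF Lm] by (simp add: case_prod_beta')
  have Lx[measurable]: "(\<lambda>x. \<integral>\<^sup>+f. L f x \<partial>Pr) \<in> borel_measurable \<mu>"
    using Pr.borel_measurable_nn_integral[OF Lm'] by simp
  have Lf[measurable]: "(\<lambda>f. L f x) \<in> borel_measurable Pr" if "x \<in> space \<mu>" for x
    using measurable_compose[OF measurable_Pair2'[OF that] Lm] by simp
  have key: "emeasure Pr B * indicator ?N x \<le> 2 * (\<integral>\<^sup>+f. L f x \<partial>Pr)" if x: "x \<in> space \<mu>" for x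
  proof (cases "x \<in> ?N")
    case True
    then have lt: "(\<integral>\<^sup>+f\<in>B. p f x \<partial>Pr) < ennreal c * emeasure Pr B * p f0 x" by simp
    have [measurable]: "(\<lambda>f. p f x) \<in> borel_measurable Pr"
      using measurable_compose[OF measurable_Pair2'[OF x] model_measurable] by simp
    \<comment> \<open>The part of \<open>B\<close> with large likelihood ratio. It contributes at
      least \<open>2 * c * p f0 x\<close> per unit of mass to the evidence, so it fills at most half
      of \<open>B\<close> and the rest is counted by \<open>L\<close>.\<close>
    define G where "G = {f\<in>space Pr. f \<in> B \<and> \<not> p f x < ennreal (2 * c) * p f0 x}"
    have [measurable]: "G \<in> sets Pr" unfolding G_def by measurable
    have "ennreal (2 * c) * p f0 x * emeasure Pr G = (\<integral>\<^sup>+f. ennreal (2 * c) * p f0 x * indicator G f \<partial>Pr)"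
      by (simp add: nn_integral_cmult_indicator)
    also have "\<dots> \<le> (\<integral>\<^sup>+f\<in>B. p f x \<partial>Pr)"
      by (intro nn_integral_mono) (auto simp: G_def not_less split: split_indicator)
    also have "\<dots> < ennreal c * emeasure Pr B * p f0 x" by (rule lt)
    finally have l: "ennreal c * p f0 x * (2 * emeasure Pr G) < ennreal c * p f0 x * emeasure Pr B"
      using c by (simp add: ennreal_mult mult_ac)
    have G2: "2 * emeasure Pr G \<le> emeasure Pr B"
    proof (rule ccontr)
      assume "\<not> ?thesis"
      then have "ennreal c * p f0 x * emeasure Pr B \<le> ennreal c * p f0 x * (2 * emeasure Pr G)"
        by (intro mult_left_mono) auto
      with l show False by simp
    qed
    have "2 * emeasure Pr B = 2 * (\<integral>\<^sup>+f. indicator B f \<partial>Pr)" by simp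
    also have "(\<integral>\<^sup>+f. indicator B f \<partial>Pr) \<le> (\<integral>\<^sup>+f. indicator G f + L f x \<partial>Pr)"
      using x sets.sets_into_space[OF B] by (intro nn_integral_mono) (auto simp: G_def L_def split: split_indicator)
    also have "\<dots> = emeasure Pr G + (\<integral>\<^sup>+f. L f x \<partial>Pr)"
      using Lf[OF x] by (subst nn_integral_add) auto
    finally have "2 * emeasure Pr B \<le> 2 * emeasure Pr G + 2 * (\<integral>\<^sup>+f. L f x \<partial>Pr)"
      by (simp add: distrib_left mult_left_mono)
    also have "\<dots> \<le> emeasure Pr B + 2 * (\<integral>\<^sup>+f. L f x \<partial>Pr)" using G2 by (rule add_right_mono)
    finally have "emeasure Pr B + emeasure Pr B \<le> emeasure Pr B + 2 * (\<integral>\<^sup>+f. L f x \<partial>Pr)" by (simp add: mult_2)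
    then have "emeasure Pr B \<le> 2 * (\<integral>\<^sup>+f. L f x \<partial>Pr)" using Bfin by (simp add: ennreal_add_left_cancel_le)
    then show ?thesis using True by simp
  qed simp
  have "emeasure Pr B * emeasure (Q f0) ?N = (\<integral>\<^sup>+x. p f0 x * (emeasure Pr B * indicator ?N x) \<partial>\<mu>)"
    unfolding Q_density[OF f0]
    by (subst emeasure_density) (auto simp: nn_integral_cmult[symmetric] mult_ac intro!: nn_integral_cong)
  also have "\<dots> \<le> (\<integral>\<^sup>+x. p f0 x * (2 * (\<integral>\<^sup>+f. L f x \<partial>Pr)) \<partial>\<mu>)"
    by (intro nn_integral_mono mult_left_mono key) auto
  also have "\<dots> = 2 * (\<integral>\<^sup>+x. (\<integral>\<^sup>+f. p f0 x * L f x \<partial>Pr) \<partial>\<mu>)"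
  proof -
    have "p f0 x * (2 * (\<integral>\<^sup>+f. L f x \<partial>Pr)) = 2 * (\<integral>\<^sup>+f. p f0 x * L f x \<partial>Pr)" if x: "x \<in> space \<mu>" for x
      using Lf[OF x] by (subst nn_integral_cmult) (auto simp: mult.left_commute)
    then have "(\<integral>\<^sup>+x. p f0 x * (2 * (\<integral>\<^sup>+f. L f x \<partial>Pr)) \<partial>\<mu>) = (\<integral>\<^sup>+x. 2 * (\<integral>\<^sup>+f. p f0 x * L f x \<partial>Pr) \<partial>\<mu>)"
      by (intro nn_integral_cong) auto
    moreover have "(\<lambda>x. \<integral>\<^sup>+f. p f0 x * L f x \<partial>Pr) \<in> borel_measurable \<mu>"
    proof -
      have "(\<lambda>z. p f0 (fst z) * (case z of (x, f) \<Rightarrow> L f x)) \<in> borel_measurable (\<mu> \<Otimes>\<^sub>M Pr)"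
        by (intro borel_measurable_times_ennreal Lm' measurable_compose[OF measurable_fst p_measurable[OF f0]])
      from Pr.borel_measurable_nn_integral[of "\<lambda>x f. p f0 x * L f x" \<mu>] this show ?thesis by (simp add: case_prod_beta')
    qed
    ultimately show ?thesis by (simp add: nn_integral_cmult)
  qed
  finally have bound: "emeasure Pr B * emeasure (Q f0) ?N \<le> 2 * (\<integral>\<^sup>+x. (\<integral>\<^sup>+f. p f0 x * L f x \<partial>Pr) \<partial>\<mu>)" .
  have "(\<integral>\<^sup>+x. (\<integral>\<^sup>+f. p f0 x * L f x \<partial>Pr) \<partial>\<mu>) = (\<integral>\<^sup>+f. (\<integral>\<^sup>+x. p f0 x * L f x \<partial>\<mu>) \<partial>Pr)"
  proof (rule pm.Fubini')
    have "(\<lambda>z. p f0 (snd z) * (case z of (f, x) \<Rightarrow> L f x)) \<in> borel_measurable (Pr \<Otimes>\<^sub>M \<mu>)"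
      by (intro borel_measurable_times_ennreal Lm measurable_compose[OF measurable_snd p_measurable[OF f0]])
    then show "(\<lambda>(f, x). p f0 x * L f x) \<in> borel_measurable (Pr \<Otimes>\<^sub>M \<mu>)" by (simp add: case_prod_beta')
  qed
  also have "\<dots> \<le> (\<integral>\<^sup>+f. \<delta> * indicator B f \<partial>Pr)"
  proof (rule nn_integral_mono)
    fix f assume f: "f \<in> space Pr"
    note [measurable] = p_measurable[OF f]
    have "(\<integral>\<^sup>+x. p f0 x * L f x \<partial>\<mu>) = indicator B f * emeasure (Q f0) {x\<in>space \<mu>. p f x < ennreal (2 * c) * p f0 x}"
      unfolding Q_density[OF f0] L_def
      by (subst emeasure_density) (auto simp: nn_integral_cmult[symmetric] mult_ac)
    also have "\<dots> \<le> \<delta> * indicator B f" using ratio[of f] by (auto split: split_indicator)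
    finally show "(\<integral>\<^sup>+x. p f0 x * L f x \<partial>\<mu>) \<le> \<delta> * indicator B f" .
  qed
  also have "\<dots> = \<delta> * emeasure Pr B" by (simp add: nn_integral_cmult_indicator)
  finally have "2 * (\<integral>\<^sup>+x. (\<integral>\<^sup>+f. p f0 x * L f x \<partial>Pr) \<partial>\<mu>) \<le> 2 * (\<delta> * emeasure Pr B)"
    by (rule mult_left_mono) simp
  with bound have "emeasure Pr B * emeasure (Q f0) ?N \<le> emeasure Pr B * (2 * \<delta>)"
    by (simp add: mult_ac)
  then show ?thesis using Bpos Bfin by (simp add: ennreal_mult_le_mult_iff)
qed

text \<open>Each shell has its own test. Where \<open>\<phi> j\<close> rejects, the posterior mass
  is bounded by 1; where it accepts, the evidence is replaced by \<open>c * p f0 x\<close>.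
  Integration under \<open>Q f0\<close> then cancels \<open>p f0 x\<close>, and Fubini turns the
  numerator into a prior average of errors of the second kind.\<close>

lemma posterior_mass_bound:
  fixes S :: "nat \<Rightarrow> 'f set" and \<phi> :: "nat \<Rightarrow> 'x \<Rightarrow> ennreal"
  assumes A[measurable]: "A \<in> sets Pr" and S[measurable]: "\<And>j. S j \<in> sets Pr" and AS: "A \<subseteq> (\<Union>j. S j)"
    and B[measurable]: "B \<in> sets Pr" and c: "0 < c"
    and \<phi>[measurable]: "\<And>j. \<phi> j \<in> borel_measurable \<mu>" and \<phi>1: "\<And>j x. x \<in> space \<mu> \<Longrightarrow> \<phi> j x \<le> 1"
    and evidence: "emeasure (Q f0) {x\<in>space \<mu>. (\<integral>\<^sup>+f\<in>B. p f x \<partial>Pr) < c * p f0 x} \<le> \<delta>"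
    and type1: "\<And>j. (\<integral>\<^sup>+x. \<phi> j x \<partial>Q f0) \<le> a j"
    and type2: "\<And>j f. f \<in> S j \<Longrightarrow> (\<integral>\<^sup>+x. 1 - \<phi> j x \<partial>Q f) \<le> b j"
  shows "(\<integral>\<^sup>+x. posterior Pr p A x \<partial>Q f0) \<le> \<delta> + (\<Sum>j. a j + b j * emeasure Pr (S j) / c)"
proof -
  interpret Pr: prob_space Pr by (rule prior)
  interpret mu: sigma_finite_measure \<mu> by (rule model_facts)
  interpret pm: pair_sigma_finite Pr \<mu> by standard
  note [measurable] = p_swap_measurable model_measurable p_measurable[OF f0] partial_marginal_measurable
  let ?m = "\<lambda>A x. \<integral>\<^sup>+f\<in>A. p f x \<partial>Pr"
  let ?N = "{x\<in>space \<mu>. ?m B x < c * p f0 x}"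
  have setsQ[measurable_cong]: "sets (Q f0) = sets \<mu>" by (simp add: Q_density[OF f0])
  have spQ: "space (Q f0) = space \<mu>" by (rule sets_eq_imp_space_eq[OF setsQ])
  have den: "?m C x \<le> (\<integral>\<^sup>+f. p f x \<partial>Pr)" for C x
    by (intro nn_integral_mono) (auto split: split_indicator)
  have le1: "posterior Pr p C x \<le> 1" for C x
  proof -
    have "posterior Pr p C x \<le> (\<integral>\<^sup>+f. p f x \<partial>Pr) / (\<integral>\<^sup>+f. p f x \<partial>Pr)"
      unfolding posterior_def by (intro divide_right_mono_ennreal den)
    also have "\<dots> \<le> 1" using ennreal_divide_self[of "\<integral>\<^sup>+f. p f x \<partial>Pr"] by (cases "(\<integral>\<^sup>+f. p f x \<partial>Pr) = 0 \<or> (\<integral>\<^sup>+f. p f x \<partial>Pr) = top") (auto simp: less_top)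
    finally show ?thesis .
  qed
  have shells: "posterior Pr p A x \<le> (\<Sum>j. posterior Pr p (S j) x)" if x: "x \<in> space \<mu>" for x
  proof -
    have [measurable]: "(\<lambda>f. p f x) \<in> borel_measurable Pr"
      using measurable_compose[OF measurable_Pair2'[OF x] model_measurable] by simp
    have "?m A x \<le> (\<integral>\<^sup>+f. (\<Sum>j. p f x * indicator (S j) f) \<partial>Pr)"
    proof (rule nn_integral_mono)
      fix f
      show "p f x * indicator A f \<le> (\<Sum>j. p f x * indicator (S j) f)"
      proof (cases "f \<in> A")
        case True
        then obtain j where "f \<in> S j" using AS by auto
        then show ?thesis using sum_le_suminf[of "\<lambda>j. p f x * indicator (S j) f" "{j}"] True by auto
      qed simp
    qed
    also have "\<dots> = (\<Sum>j. ?m (S j) x)" by (rule nn_integral_suminf) measurable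
    finally have "?m A x / (\<integral>\<^sup>+f. p f x \<partial>Pr) \<le> (\<Sum>j. ?m (S j) x) / (\<integral>\<^sup>+f. p f x \<partial>Pr)" by (rule divide_right_mono_ennreal)
    also have "\<dots> = (\<Sum>j. ?m (S j) x / (\<integral>\<^sup>+f. p f x \<partial>Pr))" unfolding divide_ennreal_def by (rule ennreal_suminf_multc[symmetric])
    finally show ?thesis unfolding posterior_def .
  qed
  let ?R = "\<lambda>j x. (1 - \<phi> j x) * (?m (S j) x / (c * p f0 x))"
  have pt: "posterior Pr p A x \<le> indicator ?N x + (\<Sum>j. \<phi> j x + ?R j x)" if x: "x \<in> space \<mu>" for x
  proof (cases "x \<in> ?N")
    case True
    then show ?thesis using le1[of A x] by (auto intro: order_trans)
  next
    case False
    then have ge: "c * p f0 x \<le> (\<integral>\<^sup>+f. p f x \<partial>Pr)" using x den[of x B] by (auto simp: not_less intro: order_trans)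
    have "posterior Pr p (S j) x \<le> \<phi> j x + ?R j x" for j
    proof -
      have "\<phi> j x + (1 - \<phi> j x) = 1" using \<phi>1[OF x, of j] by (simp add: diff_add_cancel_ennreal add.commute[of "\<phi> j x"])
      then have "posterior Pr p (S j) x = (\<phi> j x + (1 - \<phi> j x)) * posterior Pr p (S j) x" by (simp only: mult_1_left)
      also have "\<dots> = \<phi> j x * posterior Pr p (S j) x + (1 - \<phi> j x) * posterior Pr p (S j) x" by (rule distrib_right)
      also have "\<dots> \<le> \<phi> j x * 1 + (1 - \<phi> j x) * (?m (S j) x / (c * p f0 x))"
      proof (intro add_mono mult_left_mono le1)
        show "posterior Pr p (S j) x \<le> ?m (S j) x / (c * p f0 x)"
          unfolding posterior_def divide_ennreal_def by (intro mult_left_mono ennreal_inverse_antimono ge) simp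
      qed auto
      finally show ?thesis by simp
    qed
    then have "(\<Sum>j. posterior Pr p (S j) x) \<le> (\<Sum>j. \<phi> j x + ?R j x)" by (intro suminf_le) auto
    with shells[OF x] False show ?thesis by (auto intro: order_trans)
  qed
  have mR[measurable]: "?R j \<in> borel_measurable \<mu>" for j by measurable
  have part: "(\<integral>\<^sup>+x. ?R j x \<partial>Q f0) \<le> b j * emeasure Pr (S j) / c" for j
  proof -
    have "(\<integral>\<^sup>+x. ?R j x \<partial>Q f0) = (\<integral>\<^sup>+x. p f0 x * ?R j x \<partial>\<mu>)"
      unfolding Q_density[OF f0] by (subst nn_integral_density) auto
    also have "\<dots> \<le> (\<integral>\<^sup>+x. ((1 - \<phi> j x) * ?m (S j) x) / c \<partial>\<mu>)"
    proof (rule nn_integral_mono)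
      fix x
      \<comment> \<open>The cancellation is only an inequality: for \<open>q\<close> equal to 0 or
        \<open>top\<close> the left side is 0 by convention.\<close>
      have aux: "q * inverse (c * q) \<le> inverse c" for q :: ennreal
      proof (cases "q = 0 \<or> q = top")
        case True then show ?thesis using c by (auto simp: ennreal_mult_top)
      next
        case False
        show ?thesis
        proof (cases "c = top")
          case True with False show ?thesis by (simp add: ennreal_top_mult)
        next
          case cf: False
          with False c have "inverse (c * q) = inverse c * inverse q" by (intro ennreal_inverse_mult) (auto simp: less_top)
          moreover have "q * inverse q = 1" using False ennreal_divide_self[of q] by (simp add: divide_ennreal_def less_top)
          moreover have "q * (inverse c * inverse q) = inverse c * (q * inverse q)" by (simp only: mult_ac)
          ultimately show ?thesis by simp
        qed
      qed
      have "p f0 x * ?R j x = (1 - \<phi> j x) * ?m (S j) x * (p f0 x * inverse (c * p f0 x))"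
        by (simp add: divide_ennreal_def mult_ac)
      also have "\<dots> \<le> (1 - \<phi> j x) * ?m (S j) x * inverse c" by (intro mult_left_mono aux) auto
      finally show "p f0 x * ?R j x \<le> ((1 - \<phi> j x) * ?m (S j) x) / c" by (simp add: divide_ennreal_def)
    qed
    also have "\<dots> = (\<integral>\<^sup>+x. (1 - \<phi> j x) * ?m (S j) x \<partial>\<mu>) / c" by (rule nn_integral_divide) measurable
    also have "(\<integral>\<^sup>+x. (1 - \<phi> j x) * ?m (S j) x \<partial>\<mu>) = (\<integral>\<^sup>+x. (\<integral>\<^sup>+f. (1 - \<phi> j x) * (p f x * indicator (S j) f) \<partial>Pr) \<partial>\<mu>)"
    proof (rule nn_integral_cong)
      fix x assume x: "x \<in> space \<mu>"
      have [measurable]: "(\<lambda>f. p f x) \<in> borel_measurable Pr"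
        using measurable_compose[OF measurable_Pair2'[OF x] model_measurable] by simp
      show "(1 - \<phi> j x) * ?m (S j) x = (\<integral>\<^sup>+f. (1 - \<phi> j x) * (p f x * indicator (S j) f) \<partial>Pr)"
        by (subst nn_integral_cmult) auto
    qed
    also have "\<dots> = (\<integral>\<^sup>+f. (\<integral>\<^sup>+x. (1 - \<phi> j x) * (p f x * indicator (S j) f) \<partial>\<mu>) \<partial>Pr)"
      by (rule pm.Fubini') measurable
    also have "\<dots> \<le> (\<integral>\<^sup>+f. b j * indicator (S j) f \<partial>Pr)"
    proof (rule nn_integral_mono)
      fix f assume f: "f \<in> space Pr"
      note [measurable] = p_measurable[OF f]
      have "(\<integral>\<^sup>+x. (1 - \<phi> j x) * (p f x * indicator (S j) f) \<partial>\<mu>) = indicator (S j) f * (\<integral>\<^sup>+x. p f x * (1 - \<phi> j x) \<partial>\<mu>)"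
        by (subst nn_integral_cmult[symmetric]) (auto simp: mult_ac)
      also have "(\<integral>\<^sup>+x. p f x * (1 - \<phi> j x) \<partial>\<mu>) = (\<integral>\<^sup>+x. 1 - \<phi> j x \<partial>Q f)"
        unfolding Q_density[OF f] by (subst nn_integral_density) auto
      also have "indicator (S j) f * \<dots> \<le> b j * indicator (S j) f" using type2[of f j] by (auto split: split_indicator)
      finally show "(\<integral>\<^sup>+x. (1 - \<phi> j x) * (p f x * indicator (S j) f) \<partial>\<mu>) \<le> b j * indicator (S j) f" .
    qed
    also have "\<dots> = b j * emeasure Pr (S j)" by (simp add: nn_integral_cmult_indicator)
    finally show ?thesis by (simp add: divide_right_mono_ennreal)
  qed
  have "(\<integral>\<^sup>+x. posterior Pr p A x \<partial>Q f0) \<le> (\<integral>\<^sup>+x. indicator ?N x + (\<Sum>j. \<phi> j x + ?R j x) \<partial>Q f0)"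
    by (intro nn_integral_mono pt) (simp add: spQ)
  also have "\<dots> = emeasure (Q f0) ?N + (\<Sum>j. (\<integral>\<^sup>+x. \<phi> j x \<partial>Q f0) + (\<integral>\<^sup>+x. ?R j x \<partial>Q f0))"
  proof -
    have [measurable]: "?R j \<in> borel_measurable (Q f0)" "\<phi> j \<in> borel_measurable (Q f0)" for j
      using mR \<phi> by (simp_all add: measurable_cong_sets[OF setsQ refl])
    have [measurable]: "?N \<in> sets (Q f0)" unfolding setsQ by measurable
    have "(\<integral>\<^sup>+x. indicator ?N x + (\<Sum>j. \<phi> j x + ?R j x) \<partial>Q f0) = (\<integral>\<^sup>+x. indicator ?N x \<partial>Q f0) + (\<integral>\<^sup>+x. (\<Sum>j. \<phi> j x + ?R j x) \<partial>Q f0)"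
      by (rule nn_integral_add) measurable
    also have "(\<integral>\<^sup>+x. (\<Sum>j. \<phi> j x + ?R j x) \<partial>Q f0) = (\<Sum>j. \<integral>\<^sup>+x. \<phi> j x + ?R j x \<partial>Q f0)"
      by (rule nn_integral_suminf) measurable
    also have "\<dots> = (\<Sum>j. (\<integral>\<^sup>+x. \<phi> j x \<partial>Q f0) + (\<integral>\<^sup>+x. ?R j x \<partial>Q f0))"
      by (intro arg_cong[where f=suminf] ext nn_integral_add) measurable
    finally show ?thesis by simp
  qed
  also have "\<dots> \<le> \<delta> + (\<Sum>j. a j + b j * emeasure Pr (S j) / c)"
    by (intro add_mono evidence suminf_le type1 part) auto
  finally show ?thesis .
qed

end

section \<open>Regular spectral densities\<close>

lemma sup_norm_le_iff: "sup_norm g \<le> ereal e \<longleftrightarrow> (\<forall>l\<in>{-pi<..pi}. \<bar>g l\<bar> \<le> e)"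
  unfolding sup_norm_def by (subst SUP_le_iff) simp

lemma regular_densityD:
  assumes "regular_density \<Gamma> M f"
  shows "set_integrable lborel {-pi<..pi} f"
    and "l \<in> {-pi<..pi} \<Longrightarrow> exp (- \<Gamma>) \<le> f l \<and> f l \<le> exp \<Gamma>"
proof -
  show "set_integrable lborel {-pi<..pi} f" using assms by (simp add: regular_density_def spectral_density_def)
  assume l: "l \<in> {-pi<..pi}"
  have "0 < f l" "\<bar>ln (f l)\<bar> \<le> \<Gamma>" using assms l by (auto simp: regular_density_def sup_norm_le_iff)
  then have "exp (- \<Gamma>) \<le> exp (ln (f l))" "exp (ln (f l)) \<le> exp \<Gamma>" by (auto simp del: exp_ln)
  with \<open>0 < f l\<close> show "exp (- \<Gamma>) \<le> f l \<and> f l \<le> exp \<Gamma>" by simp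
qed

lemma square_convex_combination:
  fixes s x y :: real
  assumes "0 \<le> s" "s \<le> 1"
  shows "((1 - s) * x + s * y)\<^sup>2 \<le> (1 - s) * x\<^sup>2 + s * y\<^sup>2"
proof -
  have "(1 - s) * x\<^sup>2 + s * y\<^sup>2 - ((1 - s) * x + s * y)\<^sup>2 = s * (1 - s) * (x - y)\<^sup>2"
    by (simp add: power2_eq_square algebra_simps)
  also have "\<dots> \<ge> 0" using assms by simp
  finally show ?thesis by simp
qed

lemma autocov_convex_combination:
  assumes f: "set_integrable lborel {-pi<..pi} f" and g: "set_integrable lborel {-pi<..pi} g"
  shows "autocov (\<lambda>l. (1 - s) * f l + s * g l) h = of_real (1 - s) * autocov f h + of_real s * autocov g h"
proof -
  let ?e = "\<lambda>l. exp (\<i> * of_int h * of_real l)"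
  have i: "set_integrable lborel {-pi<..pi} (\<lambda>l. ?e l * complex_of_real (f l))" if "set_integrable lborel {-pi<..pi} f" for f
    by (rule set_integrable_mult_bounded[OF that, where c=1])
      (auto simp: norm_exp_eq_Re intro!: borel_measurable_set_borel_measurable)
  have "autocov (\<lambda>l. (1 - s) * f l + s * g l) h
    = (LINT l:{-pi<..pi}|lborel. of_real (1 - s) * (?e l * complex_of_real (f l)) + of_real s * (?e l * complex_of_real (g l)))"
    unfolding autocov_def by (simp add: algebra_simps)
  also have "\<dots> = of_real (1 - s) * autocov f h + of_real s * autocov g h"
    unfolding autocov_def set_integral_mult_right[symmetric]
    by (rule set_integral_add; intro set_integrable_mult_right i f g)
  finally show ?thesis .
qed

text \<open>The bound on the logarithm confines \<open>f\<close> to a fixed interval, and the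
  autocovariances are linear in \<open>f\<close>, so convexity of the square preserves the weighted
  sum. Hence a density can be moved towards the centre of a test without losing the testing
  bounds.\<close>

lemma regular_density_convex:
  assumes f: "regular_density \<Gamma> M f" and g: "regular_density \<Gamma> M g" and s: "0 \<le> s" "s \<le> 1"
  shows "regular_density \<Gamma> M (\<lambda>l. (1 - s) * f l + s * g l)"
proof -
  let ?k = "\<lambda>l. (1 - s) * f l + s * g l"
  let ?a = "\<lambda>f h. real_of_int \<bar>h\<bar> * (cmod (autocov f h))\<^sup>2"
  note fi = regular_densityD(1)[OF f] and gi = regular_densityD(1)[OF g]
  have bd: "exp (- \<Gamma>) \<le> ?k l \<and> ?k l \<le> exp \<Gamma>" if l: "l \<in> {-pi<..pi}" for l
  proof -
    have "(1 - s) * exp (- \<Gamma>) + s * exp (- \<Gamma>) \<le> ?k l" "?k l \<le> (1 - s) * exp \<Gamma> + s * exp \<Gamma>"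
      using regular_densityD(2)[OF f l] regular_densityD(2)[OF g l] s by (auto intro!: add_mono mult_left_mono)
    then show ?thesis by (simp add: algebra_simps)
  qed
  have pos: "0 < ?k l" if "l \<in> {-pi<..pi}" for l
    using bd[OF that] less_le_trans[OF exp_gt_zero, of "-\<Gamma>" "?k l"] by simp
  have "\<bar>ln (?k l)\<bar> \<le> \<Gamma>" if l: "l \<in> {-pi<..pi}" for l
  proof -
    have "ln (exp (- \<Gamma>)) \<le> ln (?k l)" "ln (?k l) \<le> ln (exp \<Gamma>)"
      using bd[OF l] pos[OF l] by (subst ln_le_cancel_iff; simp)+
    then show ?thesis by simp
  qed
  then have 1: "sup_norm (\<lambda>l. ln (?k l)) \<le> ereal \<Gamma>" by (simp add: sup_norm_le_iff)
  have "AE l in lborel. l \<in> {-pi<..<pi} \<longrightarrow> f (- l) = f l" "AE l in lborel. l \<in> {-pi<..<pi} \<longrightarrow> g (- l) = g l"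
    using f g by (auto simp: regular_density_def spectral_density_def)
  then have "AE l in lborel. l \<in> {-pi<..<pi} \<longrightarrow> ?k (- l) = ?k l" by eventually_elim simp
  then have 2: "spectral_density ?k"
    unfolding spectral_density_def using pos fi gi by (auto intro!: set_integral_add set_integrable_mult_right less_imp_le)
  have sf: "?a f summable_on UNIV" "(\<Sum>\<^sub>\<infinity>h. ?a f h) \<le> M" and sg: "?a g summable_on UNIV" "(\<Sum>\<^sub>\<infinity>h. ?a g h) \<le> M"
    using f g by (auto simp: regular_density_def)
  have le: "?a ?k h \<le> (1 - s) * ?a f h + s * ?a g h" for h
  proof -
    have "cmod (autocov ?k h) \<le> (1 - s) * cmod (autocov f h) + s * cmod (autocov g h)"
      unfolding autocov_convex_combination[OF fi gi]
      by (rule order_trans[OF norm_triangle_ineq]) (use s in \<open>simp add: norm_mult del: of_real_diff\<close>)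
    then have "(cmod (autocov ?k h))\<^sup>2 \<le> ((1 - s) * cmod (autocov f h) + s * cmod (autocov g h))\<^sup>2" by (rule power_mono) simp
    also have "\<dots> \<le> (1 - s) * (cmod (autocov f h))\<^sup>2 + s * (cmod (autocov g h))\<^sup>2" by (rule square_convex_combination[OF s])
    finally have "real_of_int \<bar>h\<bar> * (cmod (autocov ?k h))\<^sup>2 \<le> real_of_int \<bar>h\<bar> * ((1 - s) * (cmod (autocov f h))\<^sup>2 + s * (cmod (autocov g h))\<^sup>2)"
      by (rule mult_left_mono) simp
    then show ?thesis by (simp add: algebra_simps)
  qed
  have sm: "(\<lambda>h. (1 - s) * ?a f h + s * ?a g h) summable_on UNIV"
    by (intro summable_on_add summable_on_cmult_right sf sg)
  have sk: "?a ?k summable_on UNIV"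
    by (rule summable_on_comparison_test[OF sm]) (use le in auto)
  have "(\<Sum>\<^sub>\<infinity>h. ?a ?k h) \<le> (\<Sum>\<^sub>\<infinity>h. (1 - s) * ?a f h + s * ?a g h)"
    by (rule infsum_mono[OF sk sm]) (rule le)
  also have "\<dots> = (1 - s) * (\<Sum>\<^sub>\<infinity>h. ?a f h) + s * (\<Sum>\<^sub>\<infinity>h. ?a g h)"
    unfolding infsum_add[OF summable_on_cmult_right[OF sf(1)] summable_on_cmult_right[OF sg(1)]] infsum_cmult_right' ..
  also have "\<dots> \<le> (1 - s) * M + s * M" using sf sg s by (intro add_mono mult_left_mono) auto
  finally have "(\<Sum>\<^sub>\<infinity>h. ?a ?k h) \<le> M" by (simp add: algebra_simps)
  with 1 2 pos sk show ?thesis unfolding regular_density_def by auto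
qed

lemma l2_norm_commute: "l2_norm (\<lambda>l. f l - g l) = l2_norm (\<lambda>l. g l - f l)"
  unfolding l2_norm_def by (simp add: power2_commute)

lemma l2_norm_nonneg: "0 \<le> l2_norm h"
  by (simp add: l2_norm_def set_lebesgue_integral_def integral_nonneg)

lemma l2_norm_square_le:
  assumes h: "set_integrable lborel {-pi<..pi} h" and b: "\<And>l. l \<in> {-pi<..pi} \<Longrightarrow> \<bar>h l\<bar> \<le> b"
  shows "(l2_norm h)\<^sup>2 \<le> 2 * pi * b\<^sup>2"
proof -
  have "(l2_norm h)\<^sup>2 = (LINT l:{-pi<..pi}|lborel. (h l)\<^sup>2)"
    unfolding l2_norm_def by (simp add: set_lebesgue_integral_def integral_nonneg)
  also have "\<dots> \<le> (LINT l:{-pi<..pi}|lborel. b\<^sup>2)"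
  proof (rule set_integral_mono)
    show "set_integrable lborel {-pi<..pi} (\<lambda>l. (h l)\<^sup>2)"
      unfolding power2_eq_square by (rule set_integrable_bounded_mult[OF h h _ b]) auto
    show "(h l)\<^sup>2 \<le> b\<^sup>2" if "l \<in> {-pi<..pi}" for l using b[OF that] by (simp add: abs_le_square_iff[symmetric])
  qed simp
  also have "\<dots> = 2 * pi * b\<^sup>2" by (simp add: set_lebesgue_integral_def)
  finally show ?thesis .
qed

text \<open>With \<open>c = exp (- \<Gamma>)\<close> and \<open>C = exp \<Gamma>\<close> both
  \<open>C / c\<close> and \<open>1 / c^2\<close> are \<open>exp (2 * \<Gamma>)\<close>, so the
  constant in the exponent depends on \<Gamma> and \<alpha> only.\<close>

lemma regular_likelihood_ratio:
  assumes series: "\<And>f. regular_density \<Gamma> M f \<Longrightarrow> stationary_gaussian_series (W f) (X f) f"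
    and f: "regular_density \<Gamma> M f" and g: "regular_density \<Gamma> M g"
    and \<alpha>: "0 < \<alpha>" and fg: "\<And>l. l \<in> {-pi<..pi} \<Longrightarrow> f l \<le> (1 + 1 / (2 * \<alpha>)) * g l"
  obtains r where "r \<in> borel_measurable (sample_space n)" "\<And>x. 0 < r x"
    "sample_law (W f) (X f) n = density (sample_law (W g) (X g) n) (\<lambda>x. ennreal (r x))"
    "(\<integral>\<^sup>+x. ennreal (r x powr (1 + \<alpha>)) \<partial>sample_law (W g) (X g) n)
      \<le> ennreal (exp ((\<alpha> * exp (2 * \<Gamma>) / 2 + \<alpha>\<^sup>2) * exp (2 * \<Gamma>) / (2 * pi) * (real n * (l2_norm (\<lambda>l. f l - g l))\<^sup>2)))"
proof -
  have e1: "exp \<Gamma> = exp (2 * \<Gamma>) * exp (- \<Gamma>)" by (simp add: mult_exp_exp)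
  have e2: "(exp (- \<Gamma>))\<^sup>2 * exp (2 * \<Gamma>) = 1" by (simp add: power2_eq_square mult_exp_exp)
  have "(\<alpha> * exp \<Gamma> / exp (- \<Gamma>) / 2 + \<alpha>\<^sup>2) * (real n / (2 * pi * (exp (- \<Gamma>))\<^sup>2) * (l2_norm (\<lambda>l. f l - g l))\<^sup>2)
    = (\<alpha> * exp (2 * \<Gamma>) / 2 + \<alpha>\<^sup>2) * exp (2 * \<Gamma>) / (2 * pi) * (real n * (l2_norm (\<lambda>l. f l - g l))\<^sup>2)"
  proof -
    have "1 / (exp (- \<Gamma>))\<^sup>2 = exp (2 * \<Gamma>)" using e2 by (simp add: field_simps)
    then have "real n / (2 * pi * (exp (- \<Gamma>))\<^sup>2) = exp (2 * \<Gamma>) / (2 * pi) * real n" by (simp add: field_simps)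
    moreover have "\<alpha> * exp \<Gamma> / exp (- \<Gamma>) = \<alpha> * exp (2 * \<Gamma>)" unfolding e1 by simp
    ultimately show ?thesis by simp
  qed
  note exponent = this
  obtain r where r: "r \<in> borel_measurable (sample_space n)" "\<And>x. 0 < r x"
    "sample_law (W f) (X f) n = density (sample_law (W g) (X g) n) (\<lambda>x. ennreal (r x))"
    and mom: "(\<integral>\<^sup>+x. ennreal (r x powr (1 + \<alpha>)) \<partial>sample_law (W g) (X g) n)
      \<le> ennreal (exp ((\<alpha> * exp \<Gamma> / exp (- \<Gamma>) / 2 + \<alpha>\<^sup>2) * (real n / (2 * pi * (exp (- \<Gamma>))\<^sup>2) * (l2_norm (\<lambda>l. f l - g l))\<^sup>2)))"
    by (rule gaussian_likelihood_ratio[where n=n, OF series[OF f] series[OF g] regular_densityD(1)[OF f] regular_densityD(1)[OF g]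
      exp_gt_zero[of "-\<Gamma>"] regular_densityD(2)[OF f] regular_densityD(2)[OF g] \<alpha> fg that])
  show ?thesis by (rule that[OF r mom[unfolded exponent]])
qed

text \<open>The test for \<open>f1\<close> also has power at densities slightly outside its ball: such a density is
  compared with the point of the segment to \<open>f1\<close> on the boundary of the ball.  Doubling the radius
  of a covering ball, in order to centre it in the class, oversteps the testing radius by the
  factor \<open>(j + 1) / j\<close>.\<close>

lemma extended_test_power:
  assumes series: "\<And>f. regular_density \<Gamma> M f \<Longrightarrow> stationary_gaussian_series (W f) (X f) f"
    and f: "regular_density \<Gamma> M f" and f1: "regular_density \<Gamma> M f1"
    and j: "2 * exp (2 * \<Gamma>) \<le> real (Suc j)"
    and close: "\<And>l. l \<in> {-pi<..pi} \<Longrightarrow> \<bar>f l - f1 l\<bar> \<le> real (Suc j) * d"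
    and \<phi>: "is_test n \<phi>"
    and power: "\<And>h. regular_density \<Gamma> M h \<Longrightarrow> (\<And>l. l \<in> {-pi<..pi} \<Longrightarrow> \<bar>h l - f1 l\<bar> \<le> real j * d) \<Longrightarrow>
      (LINT x|sample_law (W h) (X h) n. 1 - \<phi> x) \<le> exp (- (2 * a))"
  shows "(\<integral>\<^sup>+x. ennreal (1 - \<phi> x) \<partial>sample_law (W f) (X f) n)
    \<le> ennreal (exp ((exp (2 * \<Gamma>) / 2 + 1) * exp (2 * \<Gamma>) / 2 * (real n * d\<^sup>2) - a))"
proof -
  define s where "s = real j / real (Suc j)"
  have s: "0 \<le> s" "s \<le> 1" and s1: "1 - s = 1 / real (Suc j)" by (auto simp: s_def field_simps)
  define h where "h l = (1 - s) * f1 l + s * f l" for l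
  have h: "regular_density \<Gamma> M h" unfolding h_def by (rule regular_density_convex[OF f1 f s])
  have hf1: "\<bar>h l - f1 l\<bar> \<le> real j * d" if "l \<in> {-pi<..pi}" for l
  proof -
    have "h l - f1 l = s * (f l - f1 l)" by (simp add: h_def algebra_simps)
    then have "\<bar>h l - f1 l\<bar> \<le> s * (real (Suc j) * d)" using close[OF that] s by (simp add: abs_mult mult_left_mono)
    also have "\<dots> = real j * d" by (simp add: s_def)
    finally show ?thesis .
  qed
  have fh: "f l - h l = (f l - f1 l) / real (Suc j)" for l
  proof -
    have "f l - h l = (1 - s) * (f l - f1 l)" by (simp add: h_def algebra_simps)
    then show ?thesis unfolding s1 by simp
  qed
  have fh_d: "\<bar>f l - h l\<bar> \<le> d" if "l \<in> {-pi<..pi}" for l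
    using close[OF that] unfolding fh abs_divide by (simp add: field_simps)
  \<comment> \<open>The lower bound on \<open>j\<close> comes from here: it makes
    \<open>f - h\<close> at most \<open>exp (- \<Gamma>) / 2\<close>, hence at most
    \<open>h / 2\<close>, as second moments (\<alpha> = 1) demand.\<close>
  have ratio: "f l \<le> (1 + 1 / (2 * 1)) * h l" if l: "l \<in> {-pi<..pi}" for l
  proof -
    have "f l - f1 l \<le> exp \<Gamma>" using regular_densityD(2)[OF f l] regular_densityD(2)[OF f1 l] less_le_trans[OF exp_gt_zero, of "-\<Gamma>" "f1 l"] by linarith
    then have "f l - h l \<le> exp \<Gamma> / real (Suc j)" unfolding fh by (rule divide_right_mono) simp
    also have "\<dots> \<le> exp \<Gamma> / (2 * exp (2 * \<Gamma>))" using j by (intro divide_left_mono) auto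
    also have "\<dots> = exp (- \<Gamma>) / 2"
    proof -
      have "exp (2 * \<Gamma>) = exp \<Gamma> * exp \<Gamma>" by (simp add: mult_exp_exp)
      then show ?thesis by (simp add: exp_minus field_simps)
    qed
    also have "\<dots> \<le> h l / 2" using regular_densityD(2)[OF h l] by simp
    finally show ?thesis by simp
  qed
  obtain r where r: "r \<in> borel_measurable (sample_space n)" "\<And>x. 0 < r x"
    and dens: "sample_law (W f) (X f) n = density (sample_law (W h) (X h) n) (\<lambda>x. ennreal (r x))"
    and mom: "(\<integral>\<^sup>+x. ennreal (r x powr (1 + 1)) \<partial>sample_law (W h) (X h) n)
      \<le> ennreal (exp ((1 * exp (2 * \<Gamma>) / 2 + 1\<^sup>2) * exp (2 * \<Gamma>) / (2 * pi) * (real n * (l2_norm (\<lambda>l. f l - h l))\<^sup>2)))"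
    by (rule regular_likelihood_ratio[where n=n, OF series f h zero_less_one ratio that])
  let ?b = "(exp (2 * \<Gamma>) / 2 + 1) * exp (2 * \<Gamma>) * (real n * d\<^sup>2)"
  have "(l2_norm (\<lambda>l. f l - h l))\<^sup>2 \<le> 2 * pi * d\<^sup>2"
    by (rule l2_norm_square_le) (use fh_d regular_densityD(1)[OF f] regular_densityD(1)[OF h] in auto)
  then have "(1 * exp (2 * \<Gamma>) / 2 + 1\<^sup>2) * exp (2 * \<Gamma>) / (2 * pi) * (real n * (l2_norm (\<lambda>l. f l - h l))\<^sup>2)
    \<le> (1 * exp (2 * \<Gamma>) / 2 + 1\<^sup>2) * exp (2 * \<Gamma>) / (2 * pi) * (real n * (2 * pi * d\<^sup>2))"
    by (intro mult_left_mono) (auto intro!: add_nonneg_nonneg divide_nonneg_pos mult_nonneg_nonneg)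
  also have "\<dots> = ?b" by simp
  finally have mom': "(\<integral>\<^sup>+x. ennreal (r x powr (1 + 1)) \<partial>sample_law (W h) (X h) n) \<le> ennreal (exp ?b)"
    by (intro order_trans[OF mom] ennreal_leI exp_mono)
  have ss: "sets (sample_law (W h) (X h) n) = sets (sample_space n)" by (simp add: sample_law_def)
  have sp: "space (sample_law (W h) (X h) n) = space (sample_space n)" by (simp add: sample_law_def)
  interpret Wh: prob_space "W h" using series[OF h] by (simp add: stationary_gaussian_series_def gaussian_process_def)
  have [measurable]: "\<And>t. X h t \<in> borel_measurable (W h)" using series[OF h] by (simp add: stationary_gaussian_series_def gaussian_process_def)
  interpret Ph: prob_space "sample_law (W h) (X h) n" unfolding sample_law_def by (rule Wh.prob_space_distr) measurable
  have \<phi>m: "\<phi> \<in> borel_measurable (sample_law (W h) (X h) n)" using \<phi> by (simp add: is_test_def measurable_cong_sets[OF ss refl])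
  have \<phi>b: "0 \<le> \<phi> x \<and> \<phi> x \<le> 1" if "x \<in> space (sample_law (W h) (X h) n)" for x using \<phi> that by (simp add: is_test_def sp)
  have "(\<integral>\<^sup>+x. ennreal (1 - \<phi> x) \<partial>sample_law (W h) (X h) n) = ennreal (LINT x|sample_law (W h) (X h) n. 1 - \<phi> x)"
    using \<phi>m \<phi>b by (intro nn_integral_eq_integral Ph.integrable_const_bound[where B=1]) auto
  also have "\<dots> \<le> ennreal (exp (- (2 * a)))" by (intro ennreal_leI power h hf1)
  finally have small: "(\<integral>\<^sup>+x. ennreal (1 - \<phi> x) \<partial>sample_law (W h) (X h) n) \<le> ennreal (exp (- (2 * a)))" .
  have "(\<integral>\<^sup>+x. ennreal (1 - \<phi> x) \<partial>sample_law (W f) (X f) n) \<le> ennreal (exp (?b / 2 - a))"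
    by (rule likelihood_ratio_change_of_measure[OF dens _ r(2) mom' _ _ small])
      (use r(1) \<phi>m \<phi>b in \<open>auto simp: measurable_cong_sets[OF ss refl]\<close>)
  then show ?thesis by simp
qed

section \<open>Tests for the shells\<close>

lemma log_covering_numberE:
  assumes "log_covering_number e A \<le> ereal b"
  obtains S where "finite S" "A \<subseteq> (\<Union>c\<in>S. {g. sup_norm (\<lambda>l. g l - c l) \<le> ereal e})" "real (card S) \<le> exp b"
proof -
  let ?T = "{S. finite S \<and> A \<subseteq> (\<Union>c\<in>S. {g. sup_norm (\<lambda>l. g l - c l) \<le> ereal e})}"
  let ?V = "(\<lambda>S. enat (card S)) ` ?T"
  obtain k where k: "Inf ?V = enat k" and kb: "ln (real k) \<le> b"
    using assms unfolding log_covering_number_def covering_number_def by (auto split: enat.splits)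
  then have "?V \<noteq> {}" by (metis Inf_empty enat_ord_code(3) enat.distinct(1) top_enat_def)
  then have "Inf ?V \<in> ?V" unfolding Inf_enat_def by (auto intro: LeastI)
  then obtain S where "S \<in> ?T" "card S = k" unfolding k by auto
  moreover have "real k \<le> exp b"
  \<comment> \<open>An empty cover needs separate treatment, since \<open>ln 0 = 0\<close>.\<close>
  proof (cases "k = 0")
    case False
    then have "real k = exp (ln (real k))" by simp
    also have "\<dots> \<le> exp b" using kb by (simp only: exp_le_cancel_iff)
    finally show ?thesis .
  qed simp
  ultimately show ?thesis using that by blast
qed

lemma sample_law_prob_space:
  assumes "stationary_gaussian_series V Z f"
  shows "prob_space (sample_law V Z n)"
proof -
  interpret V: prob_space V using assms by (simp add: stationary_gaussian_series_def gaussian_process_def)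
  have [measurable]: "\<And>t. Z t \<in> borel_measurable V" using assms by (simp add: stationary_gaussian_series_def gaussian_process_def)
  show ?thesis unfolding sample_law_def by (rule V.prob_space_distr) measurable
qed

lemma sets_sample_law [simp]: "sets (sample_law V Z n) = sets (sample_space n)"
  by (simp add: sample_law_def)

lemma space_sample_law [simp]: "space (sample_law V Z n) = space (sample_space n)"
  by (simp add: sample_law_def)

lemma test_integrable:
  assumes "prob_space Q" "sets Q = sets (sample_space n)" "is_test n \<phi>"
  shows "integrable Q \<phi>" "0 \<le> (LINT x|Q. \<phi> x)" "(LINT x|Q. 1 - \<phi> x) \<le> 1"
proof -
  interpret prob_space Q by fact
  have sp: "space Q = space (sample_space n)" by (rule sets_eq_imp_space_eq) fact
  have m: "\<phi> \<in> borel_measurable Q" using assms by (simp add: is_test_def measurable_cong_sets[OF assms(2) refl])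
  have b: "0 \<le> \<phi> x \<and> \<phi> x \<le> 1" if "x \<in> space Q" for x using assms(3) that by (simp add: is_test_def sp)
  show i: "integrable Q \<phi>" using m b by (intro integrable_const_bound[where B=1]) auto
  show nn: "0 \<le> (LINT x|Q. \<phi> x)" using b by (intro Bochner_Integration.integral_nonneg_AE) auto
  have "(LINT x|Q. 1 - \<phi> x) = 1 - (LINT x|Q. \<phi> x)" using i by (subst Bochner_Integration.integral_diff) (auto simp: prob_space)
  then show "(LINT x|Q. 1 - \<phi> x) \<le> 1" using nn by simp
qed

text \<open>The constants are instantiated at the class of all regular densities instead of
  \<open>F\<close>, so that tests are also powerful at convex combinations outside \<open>F\<close>.
  Pointwise errors can be read off the real supremum because errors are bounded by 1.\<close>

lemma testing_constantsE:
  assumes P_eq: "\<And>n f. P n f = sample_law (W f) (X f) n"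
    and series: "\<And>f. regular_density \<Gamma> M f \<Longrightarrow> stationary_gaussian_series (W f) (X f) f"
    and "testing_constants P \<Gamma> M \<xi> K"
  obtains c0 where "0 < \<xi>" "0 < K" "0 < c0"
    "\<And>n e f0 f1. 1 \<le> n \<Longrightarrow> c0 / sqrt (real n) \<le> e \<Longrightarrow> regular_density \<Gamma> M f0 \<Longrightarrow> regular_density \<Gamma> M f1 \<Longrightarrow>
       e \<le> l2_norm (\<lambda>l. f1 l - f0 l) \<Longrightarrow>
       \<exists>\<phi>. is_test n \<phi> \<and> (LINT x|P n f0. \<phi> x) \<le> exp (- K * real n * e\<^sup>2) \<and>
         (\<forall>f. regular_density \<Gamma> M f \<longrightarrow> (\<forall>l\<in>{-pi<..pi}. \<bar>f l - f1 l\<bar> \<le> \<xi> * e) \<longrightarrow>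
           (LINT x|P n f. 1 - \<phi> x) \<le> exp (- K * real n * e\<^sup>2))"
proof -
  let ?G = "{f. regular_density \<Gamma> M f}"
  obtain c0 where c: "0 < \<xi>" "0 < K" "0 < c0"
    and T: "\<And>n e f0 f1. 1 \<le> n \<Longrightarrow> c0 / sqrt (real n) \<le> e \<Longrightarrow> f0 \<in> ?G \<Longrightarrow> f1 \<in> ?G \<Longrightarrow>
       e \<le> l2_norm (\<lambda>l. f1 l - f0 l) \<Longrightarrow>
       \<exists>\<phi>. is_test n \<phi> \<and> max (LINT x|P n f0. \<phi> x)
                  (SUP f\<in>{f\<in>?G. sup_norm (\<lambda>l. f l - f1 l) \<le> ereal (\<xi> * e)}. LINT x|P n f. 1 - \<phi> x)
              \<le> exp (- K * real n * e\<^sup>2)"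
    using assms(3) unfolding testing_constants_def by (elim conjE exE) (drule spec[of _ ?G], auto)
  have "\<exists>\<phi>. is_test n \<phi> \<and> (LINT x|P n f0. \<phi> x) \<le> exp (- K * real n * e\<^sup>2) \<and>
         (\<forall>f. regular_density \<Gamma> M f \<longrightarrow> (\<forall>l\<in>{-pi<..pi}. \<bar>f l - f1 l\<bar> \<le> \<xi> * e) \<longrightarrow>
           (LINT x|P n f. 1 - \<phi> x) \<le> exp (- K * real n * e\<^sup>2))"
    if hyps: "1 \<le> n" "c0 / sqrt (real n) \<le> e" "regular_density \<Gamma> M f0" "regular_density \<Gamma> M f1"
       "e \<le> l2_norm (\<lambda>l. f1 l - f0 l)" for n e f0 f1
  proof -
    let ?B = "{f\<in>?G. sup_norm (\<lambda>l. f l - f1 l) \<le> ereal (\<xi> * e)}"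
    obtain \<phi> where \<phi>: "is_test n \<phi>" and le: "max (LINT x|P n f0. \<phi> x) (SUP f\<in>?B. LINT x|P n f. 1 - \<phi> x) \<le> exp (- K * real n * e\<^sup>2)"
      using T[of n e f0 f1] hyps by auto
    have bdd: "bdd_above ((\<lambda>f. LINT x|P n f. 1 - \<phi> x) ` ?B)"
      by (rule bdd_aboveI2[where M=1]) (auto simp: P_eq intro!: test_integrable(3)[OF sample_law_prob_space[OF series] _ \<phi>])
    have "(LINT x|P n f. 1 - \<phi> x) \<le> exp (- K * real n * e\<^sup>2)"
      if "regular_density \<Gamma> M f" "\<forall>l\<in>{-pi<..pi}. \<bar>f l - f1 l\<bar> \<le> \<xi> * e" for f
    proof -
      have "f \<in> ?B" using that by (simp add: sup_norm_le_iff)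
      from cSUP_upper[OF this bdd] le show ?thesis by simp
    qed
    then show ?thesis using \<phi> le by auto
  qed
  with c show ?thesis by (rule that) auto
qed

text \<open>One test per ball of the cover, combined by a truncated sum: the errors of the first
  kind add up, which costs the factor \<open>exp (n * \<epsilon>^2)\<close> from the entropy, while
  the error of the second kind is no larger than that of any single test.\<close>

lemma shell_test:
  fixes F :: "(real \<Rightarrow> real) set" and f0 :: "real \<Rightarrow> real" and \<epsilon> :: real
  defines "d \<equiv> \<lambda>f. l2_norm (\<lambda>l. f l - f0 l)"
  assumes series: "\<And>f. regular_density \<Gamma> M f \<Longrightarrow> stationary_gaussian_series (W f) (X f) f"
    and F: "\<And>f. f \<in> F \<Longrightarrow> regular_density \<Gamma> M f" and f0: "f0 \<in> F"
    and test: "\<And>f1. regular_density \<Gamma> M f1 \<Longrightarrow> real j * \<epsilon> \<le> d f1 \<Longrightarrow>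
       \<exists>\<phi>. is_test n \<phi> \<and> (LINT x|sample_law (W f0) (X f0) n. \<phi> x) \<le> exp (- K * real n * (real j * \<epsilon>)\<^sup>2) \<and>
         (\<forall>f. regular_density \<Gamma> M f \<longrightarrow> (\<forall>l\<in>{-pi<..pi}. \<bar>f l - f1 l\<bar> \<le> \<xi> * (real j * \<epsilon>)) \<longrightarrow>
           (LINT x|sample_law (W f) (X f) n. 1 - \<phi> x) \<le> exp (- K * real n * (real j * \<epsilon>)\<^sup>2))"
    and j: "2 * exp (2 * \<Gamma>) \<le> real (Suc j)"
    and entropy: "log_covering_number (\<xi> * (real (Suc j) * \<epsilon>) / 2) {f\<in>F. d f \<le> real (Suc j) * \<epsilon>} \<le> ereal (real n * \<epsilon>\<^sup>2)"
  obtains \<phi> where "is_test n \<phi>"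
    "(\<integral>\<^sup>+x. ennreal (\<phi> x) \<partial>sample_law (W f0) (X f0) n) \<le> ennreal (exp (real n * \<epsilon>\<^sup>2 - K * real n * (real j * \<epsilon>)\<^sup>2))"
    "\<And>f. f \<in> F \<Longrightarrow> real j * \<epsilon> < d f \<Longrightarrow> d f \<le> real (Suc j) * \<epsilon> \<Longrightarrow>
      (\<integral>\<^sup>+x. ennreal (1 - \<phi> x) \<partial>sample_law (W f) (X f) n)
        \<le> ennreal (exp ((exp (2 * \<Gamma>) / 2 + 1) * exp (2 * \<Gamma>) / 2 * (real n * (\<xi> * \<epsilon>)\<^sup>2) - K * real n * (real j * \<epsilon>)\<^sup>2 / 2))"
proof -
  let ?P = "\<lambda>f. sample_law (W f) (X f) n"
  let ?t = "exp (- K * real n * (real j * \<epsilon>)\<^sup>2)"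
  obtain S where S: "finite S" and cov: "{f\<in>F. d f \<le> real (Suc j) * \<epsilon>} \<subseteq> (\<Union>c\<in>S. {g. sup_norm (\<lambda>l. g l - c l) \<le> ereal (\<xi> * (real (Suc j) * \<epsilon>) / 2)})"
    and card: "real (card S) \<le> exp (real n * \<epsilon>\<^sup>2)"
    by (rule log_covering_numberE[OF entropy])
  define shell where "shell = {f\<in>F. real j * \<epsilon> < d f \<and> d f \<le> real (Suc j) * \<epsilon>}"
  define near where "near c f \<longleftrightarrow> (\<forall>l\<in>{-pi<..pi}. \<bar>f l - c l\<bar> \<le> \<xi> * (real (Suc j) * \<epsilon>) / 2)" for c f :: "real \<Rightarrow> real"
  \<comment> \<open>Covering centres are arbitrary functions. A ball meeting the shell is recentred
    at a point of the shell, which is regular and far enough from \<open>f0\<close> to have a test;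
    the radius doubles, whence the factor 1/2 in the entropy condition.\<close>
  define S' where "S' = {c\<in>S. \<exists>f\<in>shell. near c f}"
  have S': "finite S'" "card S' \<le> card S" using S by (auto simp: S'_def intro: card_mono)
  define g where "g c = (SOME f. f \<in> shell \<and> near c f)" for c
  have g: "g c \<in> shell" "near c (g c)" if "c \<in> S'" for c
    using that someI_ex[of "\<lambda>f. f \<in> shell \<and> near c f"] by (auto simp: S'_def g_def)
  have "\<exists>\<phi>. is_test n \<phi> \<and> (LINT x|?P f0. \<phi> x) \<le> ?t \<and>
         (\<forall>f. regular_density \<Gamma> M f \<longrightarrow> (\<forall>l\<in>{-pi<..pi}. \<bar>f l - g c l\<bar> \<le> \<xi> * (real j * \<epsilon>)) \<longrightarrow> (LINT x|?P f. 1 - \<phi> x) \<le> ?t)"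
    if "c \<in> S'" for c
    using g(1)[OF that] by (intro test F) (auto simp: shell_def)
  then obtain \<psi> where \<psi>: "\<And>c. c \<in> S' \<Longrightarrow> is_test n (\<psi> c)" and \<psi>0: "\<And>c. c \<in> S' \<Longrightarrow> (LINT x|?P f0. \<psi> c x) \<le> ?t"
    and \<psi>1: "\<And>c f. c \<in> S' \<Longrightarrow> regular_density \<Gamma> M f \<Longrightarrow> (\<And>l. l \<in> {-pi<..pi} \<Longrightarrow> \<bar>f l - g c l\<bar> \<le> \<xi> * (real j * \<epsilon>)) \<Longrightarrow> (LINT x|?P f. 1 - \<psi> c x) \<le> ?t"
    by metis
  have \<psi>m [measurable]: "\<psi> c \<in> borel_measurable (sample_space n)" if "c \<in> S'" for c using \<psi>[OF that] by (simp add: is_test_def)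
  have \<psi>b: "0 \<le> \<psi> c x" "\<psi> c x \<le> 1" if "c \<in> S'" "x \<in> space (sample_space n)" for c x
    using \<psi>[OF that(1)] that(2) unfolding is_test_def by blast+
  define \<phi> where "\<phi> x = min 1 (\<Sum>c\<in>S'. \<psi> c x)" for x
  have \<phi>: "is_test n \<phi>"
    unfolding is_test_def
  proof
    show "\<phi> \<in> borel_measurable (sample_space n)" unfolding \<phi>_def by (intro borel_measurable_min borel_measurable_sum \<psi>m) auto
    show "\<forall>x\<in>space (sample_space n). 0 \<le> \<phi> x \<and> \<phi> x \<le> 1" unfolding \<phi>_def using \<psi>b by (auto intro!: sum_nonneg)
  qed
  have type1: "(\<integral>\<^sup>+x. ennreal (\<phi> x) \<partial>?P f0) \<le> ennreal (exp (real n * \<epsilon>\<^sup>2 - K * real n * (real j * \<epsilon>)\<^sup>2))"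
  proof -
    note pr = sample_law_prob_space[OF series[OF F[OF f0]], of n]
    have "(\<integral>\<^sup>+x. ennreal (\<phi> x) \<partial>?P f0) \<le> (\<integral>\<^sup>+x. (\<Sum>c\<in>S'. ennreal (\<psi> c x)) \<partial>?P f0)"
    proof (rule nn_integral_mono)
      fix x assume "x \<in> space (?P f0)"
      then have x: "x \<in> space (sample_space n)" by simp
      have "ennreal (\<phi> x) \<le> ennreal (\<Sum>c\<in>S'. \<psi> c x)" unfolding \<phi>_def by (rule ennreal_leI) simp
      also have "\<dots> = (\<Sum>c\<in>S'. ennreal (\<psi> c x))" using \<psi>b x by (intro sum_ennreal[symmetric]) auto
      finally show "ennreal (\<phi> x) \<le> (\<Sum>c\<in>S'. ennreal (\<psi> c x))" .
    qed
    also have "\<dots> = (\<Sum>c\<in>S'. \<integral>\<^sup>+x. ennreal (\<psi> c x) \<partial>?P f0)"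
      by (rule nn_integral_sum) (use \<psi>m in \<open>auto simp: measurable_cong_sets[OF sets_sample_law refl]\<close>)
    also have "\<dots> \<le> (\<Sum>c\<in>S'. ennreal ?t)"
    proof (rule sum_mono)
      fix c assume c: "c \<in> S'"
      have "(\<integral>\<^sup>+x. ennreal (\<psi> c x) \<partial>?P f0) = ennreal (LINT x|?P f0. \<psi> c x)"
        using test_integrable(1)[OF pr _ \<psi>[OF c]] \<psi>b[OF c] by (intro nn_integral_eq_integral) auto
      then show "(\<integral>\<^sup>+x. ennreal (\<psi> c x) \<partial>?P f0) \<le> ennreal ?t" using \<psi>0[OF c] by (simp add: ennreal_leI)
    qed
    also have "\<dots> = ennreal (real (card S') * ?t)" by (simp add: ennreal_mult' ennreal_of_nat_eq_real_of_nat)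
    also have "\<dots> \<le> ennreal (exp (real n * \<epsilon>\<^sup>2) * ?t)"
      using S'(2) card by (intro ennreal_leI mult_right_mono) auto
    also have "exp (real n * \<epsilon>\<^sup>2) * ?t = exp (real n * \<epsilon>\<^sup>2 - K * real n * (real j * \<epsilon>)\<^sup>2)" by (simp add: mult_exp_exp)
    finally show ?thesis .
  qed
  have "(\<integral>\<^sup>+x. ennreal (1 - \<phi> x) \<partial>?P f)
        \<le> ennreal (exp ((exp (2 * \<Gamma>) / 2 + 1) * exp (2 * \<Gamma>) / 2 * (real n * (\<xi> * \<epsilon>)\<^sup>2) - K * real n * (real j * \<epsilon>)\<^sup>2 / 2))"
    if f: "f \<in> F" "real j * \<epsilon> < d f" "d f \<le> real (Suc j) * \<epsilon>" for f
  proof -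
    have fs: "f \<in> shell" using f by (simp add: shell_def)
    then obtain c where "c \<in> S" and fc: "near c f" using cov by (auto simp: shell_def near_def sup_norm_le_iff)
    then have c: "c \<in> S'" using fs by (auto simp: S'_def)
    have close: "\<bar>f l - g c l\<bar> \<le> real (Suc j) * (\<xi> * \<epsilon>)" if l: "l \<in> {-pi<..pi}" for l
    proof -
      have "\<bar>f l - c l\<bar> \<le> \<xi> * (real (Suc j) * \<epsilon>) / 2" "\<bar>g c l - c l\<bar> \<le> \<xi> * (real (Suc j) * \<epsilon>) / 2"
        using fc g(2)[OF c] l by (auto simp: near_def simp del: of_nat_Suc)
      then have "\<bar>f l - g c l\<bar> \<le> \<xi> * (real (Suc j) * \<epsilon>)" by linarith
      then show ?thesis by (simp only: mult.left_commute)
    qed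
    have "(\<integral>\<^sup>+x. ennreal (1 - \<phi> x) \<partial>?P f) \<le> (\<integral>\<^sup>+x. ennreal (1 - \<psi> c x) \<partial>?P f)"
    proof (rule nn_integral_mono, rule ennreal_leI)
      fix x assume "x \<in> space (?P f)"
      then have x: "x \<in> space (sample_space n)" by simp
      have "\<psi> c x \<le> (\<Sum>c\<in>S'. \<psi> c x)" using S'(1) c \<psi>b x by (intro member_le_sum) auto
      then show "1 - \<phi> x \<le> 1 - \<psi> c x" using \<psi>b[OF c x] by (simp add: \<phi>_def)
    qed
    also have "\<dots> \<le> ennreal (exp ((exp (2 * \<Gamma>) / 2 + 1) * exp (2 * \<Gamma>) / 2 * (real n * (\<xi> * \<epsilon>)\<^sup>2) - K * real n * (real j * \<epsilon>)\<^sup>2 / 2))"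
    proof (rule extended_test_power[OF series F[OF f(1)] _ j close \<psi>[OF c]])
      show "regular_density \<Gamma> M (g c)" using g(1)[OF c] by (auto simp: shell_def F)
      fix h assume "regular_density \<Gamma> M h" "\<And>l. l \<in> {-pi<..pi} \<Longrightarrow> \<bar>h l - g c l\<bar> \<le> real j * (\<xi> * \<epsilon>)"
      then have "(LINT x|?P h. 1 - \<psi> c x) \<le> ?t" by (intro \<psi>1[OF c]) (simp_all add: mult.left_commute)
      then show "(LINT x|?P h. 1 - \<psi> c x) \<le> exp (- (2 * (K * real n * (real j * \<epsilon>)\<^sup>2 / 2)))" by simp
    qed
    finally show ?thesis .
  qed
  with \<phi> type1 show ?thesis by (rule that)
qed

section \<open>Contraction of the posterior\<close>

text \<open>The order \<alpha> is chosen so that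
  \<open>1 / (2 * \<alpha>) = exp (2 * \<Gamma>)\<close>, the largest possible value of
  \<open>f0 / f\<close>; the required moment is then finite for every regular \<open>f\<close>. The
  exponent becomes negative once \<open>D\<close> is large.\<close>

lemma regular_likelihood_lower_tail:
  fixes \<Gamma> :: real
  defines "\<alpha> \<equiv> exp (- 2 * \<Gamma>) / 2"
  assumes series: "\<And>f. regular_density \<Gamma> M f \<Longrightarrow> stationary_gaussian_series (W f) (X f) f"
    and f0: "regular_density \<Gamma> M f0" and f: "regular_density \<Gamma> M f"
    and \<mu>: "sigma_finite_measure \<mu>" and p: "p \<in> borel_measurable \<mu>" and q: "q \<in> borel_measurable \<mu>"
    and P0: "sample_law (W f0) (X f0) n = density \<mu> p" and P1: "sample_law (W f) (X f) n = density \<mu> q"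
    and dist: "l2_norm (\<lambda>l. f l - f0 l) \<le> e"
  shows "emeasure (sample_law (W f0) (X f0) n) {x\<in>space \<mu>. q x < ennreal (exp (- D * (real n * e\<^sup>2))) * p x}
    \<le> ennreal (exp (((\<alpha> * exp (2 * \<Gamma>) / 2 + \<alpha>\<^sup>2) * exp (2 * \<Gamma>) / (2 * pi) - \<alpha> * D) * (real n * e\<^sup>2)))"
proof -
  let ?\<beta> = "(\<alpha> * exp (2 * \<Gamma>) / 2 + \<alpha>\<^sup>2) * exp (2 * \<Gamma>) / (2 * pi)"
  let ?N = "real n * e\<^sup>2"
  have \<alpha>: "0 < \<alpha>" by (simp add: \<alpha>_def)
  have "1 / (2 * \<alpha>) = exp (2 * \<Gamma>)" by (simp add: \<alpha>_def exp_minus inverse_eq_divide)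
  then have ratio: "f0 l \<le> (1 + 1 / (2 * \<alpha>)) * f l" if l: "l \<in> {-pi<..pi}" for l
  proof -
    have fl: "exp (- \<Gamma>) \<le> f l" using regular_densityD(2)[OF f l] by simp
    then have pos: "0 \<le> f l" using less_le_trans[OF exp_gt_zero, of "-\<Gamma>" "f l"] by simp
    have "f0 l \<le> exp \<Gamma>" using regular_densityD(2)[OF f0 l] by simp
    also have "\<dots> = exp (2 * \<Gamma>) * exp (- \<Gamma>)" by (simp add: mult_exp_exp)
    also have "\<dots> \<le> exp (2 * \<Gamma>) * f l" using fl by (rule mult_left_mono) simp
    also have "\<dots> \<le> (1 + exp (2 * \<Gamma>)) * f l" using pos by (intro mult_right_mono) auto
    finally show ?thesis using \<open>1 / (2 * \<alpha>) = exp (2 * \<Gamma>)\<close> by simp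
  qed
  obtain r where r: "r \<in> borel_measurable (sample_space n)" "\<And>x. 0 < r x"
    and dens: "sample_law (W f0) (X f0) n = density (sample_law (W f) (X f) n) (\<lambda>x. ennreal (r x))"
    and mom: "(\<integral>\<^sup>+x. ennreal (r x powr (1 + \<alpha>)) \<partial>sample_law (W f) (X f) n)
      \<le> ennreal (exp (?\<beta> * (real n * (l2_norm (\<lambda>l. f0 l - f l))\<^sup>2)))"
    by (rule regular_likelihood_ratio[where n=n, OF series f0 f \<alpha> ratio that])
  have "(l2_norm (\<lambda>l. f0 l - f l))\<^sup>2 \<le> e\<^sup>2"
    using dist l2_norm_nonneg by (subst l2_norm_commute) (intro power_mono)
  then have "?\<beta> * (real n * (l2_norm (\<lambda>l. f0 l - f l))\<^sup>2) \<le> ?\<beta> * ?N"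
    using \<alpha> by (intro mult_left_mono) auto
  then have mom': "(\<integral>\<^sup>+x. ennreal (r x powr (1 + \<alpha>)) \<partial>density \<mu> q) \<le> ennreal (exp (?\<beta> * ?N))"
    unfolding P1[symmetric] by (intro order_trans[OF mom] ennreal_leI exp_mono)
  have e: "- D * N * \<alpha> + b * N = (b - \<alpha> * D) * N" for b N :: real by (simp add: algebra_simps)
  have "sets \<mu> = sets (sample_space n)" using arg_cong[OF P0, of sets] by simp
  from measurable_cong_sets[OF this refl] r(1) have rm: "r \<in> borel_measurable \<mu>" by blast
  have "emeasure (density \<mu> p) {x\<in>space \<mu>. q x < ennreal (exp (- D * ?N)) * p x} \<le> ennreal (exp (- D * ?N) powr \<alpha> * exp (?\<beta> * ?N))"
    by (rule likelihood_ratio_markov[OF \<mu> p q _ rm r(2) \<alpha> exp_gt_zero mom']) (use dens P0 P1 in simp)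
  also have "exp (- D * ?N) powr \<alpha> * exp (?\<beta> * ?N) = exp ((?\<beta> - \<alpha> * D) * ?N)"
    by (simp only: exp_powr_real mult_exp_exp e)
  finally show ?thesis by (simp only: P0)
qed

text \<open>The budget in units of \<open>N * ?q\<close>, with \<open>?q = K * j^2 / 8\<close>: the
  halved test exponent earns 4, the prior ratio at \<open>j + 1\<close> costs at most 2 because
  \<open>(j + 1)^2 \<le> 2 * j^2\<close> for \<open>j \<ge> 3\<close>, and change of measure and
  evidence together cost at most 1. The remaining unit is weakened to a term linear in
  \<open>j\<close>, so that the shells sum as a geometric series.\<close>

lemma contraction_exponents:
  fixes K N D C2 :: real
  assumes K: "0 < K" and N: "1 \<le> N" and j: "3 \<le> j" and big: "C2 + D + 1 \<le> K * (real j)\<^sup>2 / 8" and pos: "0 \<le> C2 + D"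
  shows "N - K * (N * (real j)\<^sup>2) \<le> - (K / 8 * real j)"
    and "C2 * N - K * (N * (real j)\<^sup>2) / 2 + D * N + K * (N * (real (Suc j))\<^sup>2) / 8 \<le> - (K / 8 * real j)"
proof -
  let ?q = "K * (real j)\<^sup>2 / 8"
  have jj: "real j \<le> (real j)\<^sup>2" using j by (simp add: power2_eq_square)
  then have q: "K / 8 * real j \<le> ?q" using K by (simp add: mult_left_mono)
  have q0: "0 \<le> ?q" using K by simp
  then have qN: "?q \<le> N * ?q" using N mult_right_mono[of 1 N ?q] by simp
  have "N * 1 \<le> N * ?q" using big pos N by (intro mult_left_mono) auto
  moreover have "K * (N * (real j)\<^sup>2) = 8 * (N * ?q)" by simp
  ultimately show "N - K * (N * (real j)\<^sup>2) \<le> - (K / 8 * real j)" using q qN q0 by linarith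
  have "3 * real j \<le> real j * real j" using j by (intro mult_right_mono) auto
  moreover have "(real (Suc j))\<^sup>2 = real j * real j + 2 * real j + 1" by (simp add: power2_eq_square algebra_simps)
  moreover have "3 \<le> real j" using j by simp
  ultimately have "(real (Suc j))\<^sup>2 \<le> 2 * (real j)\<^sup>2" unfolding power2_eq_square[of "real j"] by linarith
  then have "(K * N) * (real (Suc j))\<^sup>2 \<le> (K * N) * (2 * (real j)\<^sup>2)" using K N by (intro mult_left_mono) auto
  then have 1: "K * (N * (real (Suc j))\<^sup>2) / 8 \<le> 2 * (N * ?q)" by (simp add: mult_ac)
  have "N * (C2 + D) \<le> N * ?q" using big N by (intro mult_left_mono) auto
  then have 2: "C2 * N + D * N \<le> N * ?q" by (simp add: algebra_simps)
  have 3: "K * (N * (real j)\<^sup>2) / 2 = 4 * (N * ?q)" by simp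
  show "C2 * N - K * (N * (real j)\<^sup>2) / 2 + D * N + K * (N * (real (Suc j))\<^sup>2) / 8 \<le> - (K / 8 * real j)"
    using 1 2 3 q qN by linarith
qed

text \<open>A bound for a single sample size, free of \<open>n\<close> and \<epsilon> on the right.
  Its first term is the probability that the evidence is too small; the second is the geometric sum
  over the shells from \<open>J\<close> on.\<close>

lemma posterior_contraction_bound:
  fixes F :: "(real \<Rightarrow> real) set" and f0 :: "real \<Rightarrow> real" and \<Gamma> M \<epsilon> \<xi> K C D m :: real and J n :: nat
    and W :: "(real \<Rightarrow> real) \<Rightarrow> 'w measure" and X :: "(real \<Rightarrow> real) \<Rightarrow> int \<Rightarrow> 'w \<Rightarrow> real"
  defines "\<alpha> \<equiv> exp (- 2 * \<Gamma>) / 2"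
  defines "\<beta> \<equiv> (\<alpha> * exp (2 * \<Gamma>) / 2 + \<alpha>\<^sup>2) * exp (2 * \<Gamma>) / (2 * pi)"
  defines "C2 \<equiv> (exp (2 * \<Gamma>) / 2 + 1) * exp (2 * \<Gamma>) / 2 * \<xi>\<^sup>2"
  defines "d \<equiv> \<lambda>f. l2_norm (\<lambda>l. f l - f0 l)"
  defines "P \<equiv> \<lambda>f. sample_law (W f) (X f) n"
  assumes series: "\<And>f. regular_density \<Gamma> M f \<Longrightarrow> stationary_gaussian_series (W f) (X f) f"
    and F: "\<And>f. f \<in> F \<Longrightarrow> regular_density \<Gamma> M f" and f0: "f0 \<in> F"
    and prior: "prob_space Pr" "space Pr = F" and dm: "d \<in> borel_measurable Pr"
    and model: "dominated_model Pr P \<mu> p"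
    and \<epsilon>: "0 < \<epsilon>" "1 \<le> real n * \<epsilon>\<^sup>2"
    and test: "\<And>j f1. J \<le> j \<Longrightarrow> regular_density \<Gamma> M f1 \<Longrightarrow> real j * \<epsilon> \<le> d f1 \<Longrightarrow>
       \<exists>\<phi>. is_test n \<phi> \<and> (LINT x|P f0. \<phi> x) \<le> exp (- K * real n * (real j * \<epsilon>)\<^sup>2) \<and>
         (\<forall>f. regular_density \<Gamma> M f \<longrightarrow> (\<forall>l\<in>{-pi<..pi}. \<bar>f l - f1 l\<bar> \<le> \<xi> * (real j * \<epsilon>)) \<longrightarrow>
           (LINT x|P f. 1 - \<phi> x) \<le> exp (- K * real n * (real j * \<epsilon>)\<^sup>2))"
    and entropy: "\<And>e. \<epsilon> < e \<Longrightarrow> log_covering_number (\<xi> * e / 2) {f\<in>F. d f \<le> e} \<le> ereal (real n * \<epsilon>\<^sup>2)"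
    and B: "0 < measure Pr {f\<in>F. d f \<le> \<epsilon>}"
    and prior_ratio: "\<And>j. 1 \<le> j \<Longrightarrow> measure Pr {f\<in>F. d f \<le> real j * \<epsilon>} / measure Pr {f\<in>F. d f \<le> \<epsilon>}
       \<le> C * exp (K * real n * \<epsilon>\<^sup>2 * (real j)\<^sup>2 / 8)"
    and K: "0 < K" and C: "0 < C" and D: "0 < D" "\<beta> \<le> \<alpha> * D"
    and J: "3 \<le> J" "2 * exp (2 * \<Gamma>) \<le> real J" "C2 + D + 1 \<le> K * (real J)\<^sup>2 / 8" and m: "real J < m"
  shows "(\<integral>\<^sup>+x. posterior Pr p {f\<in>F. m * \<epsilon> \<le> d f} x \<partial>P f0)
    \<le> ennreal (2 * exp (\<beta> - \<alpha> * D) + (1 + 2 * C) * (exp (- K / 8) ^ J / (1 - exp (- K / 8))))"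
proof -
  interpret Pr: prob_space Pr by (rule prior(1))
  let ?N = "real n * \<epsilon>\<^sup>2"
  let ?B = "{f\<in>F. d f \<le> \<epsilon>}"
  let ?\<rho> = "exp (- K / 8)"
  have f0s: "f0 \<in> space Pr" using f0 prior(2) by simp
  note mf = model_facts[OF prior(1) model f0s]
  have sd: "{f\<in>F. d f \<le> t} \<in> sets Pr" "{f\<in>F. t \<le> d f} \<in> sets Pr" "{f\<in>F. t < d f} \<in> sets Pr" for t
    using dm unfolding prior(2)[symmetric] by measurable
  have P_dens: "P f = density \<mu> (p f)" and pm: "p f \<in> borel_measurable \<mu>" if "f \<in> F" for f
    using mf(3,4)[of f] that prior(2) by auto
  have sets_\<mu>: "sets \<mu> = sets (sample_space n)" using arg_cong[OF P_dens[OF f0], of sets] by (simp add: P_def)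
  have sp_\<mu>: "space \<mu> = space (sample_space n)" by (rule sets_eq_imp_space_eq[OF sets_\<mu>])
  \<comment> \<open>Strict below and closed above: the strict part keeps centres far from
    \<open>f0\<close>, and the closed part matches the balls of the entropy and prior
    conditions.\<close>
  define S where "S j = {f\<in>F. real (J + j) * \<epsilon> < d f} \<inter> {f\<in>F. d f \<le> real (Suc (J + j)) * \<epsilon>}" for j
  have "\<exists>\<phi>. is_test n \<phi> \<and> (\<integral>\<^sup>+x. ennreal (\<phi> x) \<partial>P f0) \<le> ennreal (exp (?N - K * real n * (real (J + j) * \<epsilon>)\<^sup>2)) \<and>
    (\<forall>f\<in>S j. (\<integral>\<^sup>+x. ennreal (1 - \<phi> x) \<partial>P f) \<le> ennreal (exp (C2 * ?N - K * real n * (real (J + j) * \<epsilon>)\<^sup>2 / 2)))" for j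
  proof -
    have jj: "2 * exp (2 * \<Gamma>) \<le> real (Suc (J + j))" using J(2) by simp
    have "\<epsilon> * 1 < \<epsilon> * real (Suc (J + j))" using \<epsilon>(1) J(1) by (intro mult_strict_left_mono) auto
    then have "\<epsilon> < real (Suc (J + j)) * \<epsilon>" by (simp only: mult.commute mult_1)
    note en = entropy[OF this, unfolded d_def]
    have le: "J \<le> J + j" by simp
    obtain \<phi> where \<phi>: "is_test n \<phi>"
      "(\<integral>\<^sup>+x. ennreal (\<phi> x) \<partial>sample_law (W f0) (X f0) n) \<le> ennreal (exp (?N - K * real n * (real (J + j) * \<epsilon>)\<^sup>2))"
      and t2: "\<And>f. f \<in> F \<Longrightarrow> real (J + j) * \<epsilon> < l2_norm (\<lambda>l. f l - f0 l) \<Longrightarrow> l2_norm (\<lambda>l. f l - f0 l) \<le> real (Suc (J + j)) * \<epsilon> \<Longrightarrow>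
      (\<integral>\<^sup>+x. ennreal (1 - \<phi> x) \<partial>sample_law (W f) (X f) n)
        \<le> ennreal (exp ((exp (2 * \<Gamma>) / 2 + 1) * exp (2 * \<Gamma>) / 2 * (real n * (\<xi> * \<epsilon>)\<^sup>2) - K * real n * (real (J + j) * \<epsilon>)\<^sup>2 / 2))"
      by (rule shell_test[OF series F f0 test[OF le, unfolded d_def P_def] jj en that])
    have "(exp (2 * \<Gamma>) / 2 + 1) * exp (2 * \<Gamma>) / 2 * (real n * (\<xi> * \<epsilon>)\<^sup>2) = C2 * ?N" by (simp add: C2_def power_mult_distrib)
    note t2' = t2[unfolded this]
    show ?thesis unfolding S_def d_def P_def
      by (intro exI[of _ \<phi>] conjI \<phi> ballI; elim IntE CollectE conjE) (rule t2')
  qed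
  then obtain \<phi> where \<phi>: "\<And>j. is_test n (\<phi> j)"
    and t1: "\<And>j. (\<integral>\<^sup>+x. ennreal (\<phi> j x) \<partial>P f0) \<le> ennreal (exp (?N - K * real n * (real (J + j) * \<epsilon>)\<^sup>2))"
    and t2: "\<And>j f. f \<in> S j \<Longrightarrow> (\<integral>\<^sup>+x. ennreal (1 - \<phi> j x) \<partial>P f) \<le> ennreal (exp (C2 * ?N - K * real n * (real (J + j) * \<epsilon>)\<^sup>2 / 2))"
    by metis
  have \<phi>m: "\<phi> j \<in> borel_measurable \<mu>" for j using \<phi>[of j] by (simp add: is_test_def measurable_cong_sets[OF sets_\<mu> refl])
  have \<phi>b: "0 \<le> \<phi> j x" "\<phi> j x \<le> 1" if "x \<in> space \<mu>" for j x using \<phi>[of j] that unfolding is_test_def sp_\<mu> by blast+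
  \<comment> \<open>Half of \<open>exp (- D * N)\<close>, because the evidence bound compares
    likelihood ratios with twice its threshold.\<close>
  define c' where "c' = exp (- D * ?N) / 2"
  have c': "0 < c'" by (simp add: c'_def)
  define b where "b = measure Pr ?B"
  have b: "0 < b" using B by (simp add: b_def)
  have eB: "emeasure Pr ?B = ennreal b" by (simp add: b_def Pr.emeasure_eq_measure)
  have ev: "emeasure (P f0) {x\<in>space \<mu>. (\<integral>\<^sup>+f\<in>?B. p f x \<partial>Pr) < ennreal c' * emeasure Pr ?B * p f0 x} \<le> 2 * ennreal (exp (\<beta> - \<alpha> * D))"
  proof (rule evidence_lower_bound[OF prior(1) model f0s sd(1) _ c'])
    show "0 < emeasure Pr ?B" using b by (simp add: eB)
    fix f assume f: "f \<in> ?B"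
    then have fF: "f \<in> F" by simp
    have "emeasure (P f0) {x\<in>space \<mu>. p f x < ennreal (exp (- D * ?N)) * p f0 x} \<le> ennreal (exp ((\<beta> - \<alpha> * D) * ?N))"
      unfolding P_def \<beta>_def \<alpha>_def
      by (rule regular_likelihood_lower_tail[OF series F[OF f0] F[OF fF] mf(1) pm[OF f0] pm[OF fF]])
        (use f P_dens[OF f0] P_dens[OF fF] in \<open>auto simp: P_def d_def\<close>)
    \<comment> \<open>As \<open>D\<close> makes the coefficient nonpositive,
      \<open>n * \<epsilon>^2 \<ge> 1\<close> is all that is needed of the rate.\<close>
    also have "(\<beta> - \<alpha> * D) * ?N \<le> (\<beta> - \<alpha> * D) * 1" using D(2) \<epsilon>(2) by (intro mult_left_mono_neg) auto
    finally show "emeasure (P f0) {x\<in>space \<mu>. p f x < ennreal (2 * c') * p f0 x} \<le> ennreal (exp (\<beta> - \<alpha> * D))"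
      by (simp add: c'_def)
  qed
  have cover: "{f\<in>F. m * \<epsilon> \<le> d f} \<subseteq> (\<Union>j. S j)"
  proof
    fix f assume f: "f \<in> {f\<in>F. m * \<epsilon> \<le> d f}"
    have "real J * \<epsilon> < m * \<epsilon>" using m \<epsilon>(1) by simp
    then have lt: "real J * \<epsilon> < d f" using f by auto
    \<comment> \<open>Rounding up gives
      \<open>(i - 1) * \<epsilon> < d f \<le> i * \<epsilon>\<close>, so the inner radius is
      \<open>i - 1 = J + j\<close>, that is, \<open>j = i - Suc J\<close>.\<close>
    define i where "i = nat \<lceil>d f / \<epsilon>\<rceil>"
    have dpos: "0 < d f" using lt \<epsilon>(1) le_less_trans[of 0 "real J * \<epsilon>" "d f"] by simp
    have i: "real i = of_int \<lceil>d f / \<epsilon>\<rceil>" using dpos \<epsilon>(1) by (simp add: i_def)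
    have i1: "d f \<le> real i * \<epsilon>" and i2: "(real i - 1) * \<epsilon> < d f"
    proof -
      have "d f / \<epsilon> \<le> real i" "real i < d f / \<epsilon> + 1" unfolding i by linarith+
      then show "d f \<le> real i * \<epsilon>" "(real i - 1) * \<epsilon> < d f" using \<epsilon>(1) by (auto simp: field_simps)
    qed
    have "real J < real i" using less_le_trans[OF lt i1] \<epsilon>(1) by simp
    then have "i = Suc (J + (i - Suc J))" by simp
    then have "f \<in> S (i - Suc J)" using f i1 i2 \<epsilon>(1) unfolding S_def by (auto simp: algebra_simps of_nat_diff)
    then show "f \<in> (\<Union>j. S j)" by blast
  qed
  have main: "(\<integral>\<^sup>+x. posterior Pr p {f\<in>F. m * \<epsilon> \<le> d f} x \<partial>P f0) \<le> 2 * ennreal (exp (\<beta> - \<alpha> * D)) +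
     (\<Sum>j. ennreal (exp (?N - K * real n * (real (J + j) * \<epsilon>)\<^sup>2)) +
       ennreal (exp (C2 * ?N - K * real n * (real (J + j) * \<epsilon>)\<^sup>2 / 2)) * emeasure Pr (S j) / (ennreal c' * emeasure Pr ?B))"
  proof (rule posterior_mass_bound[where \<phi>="\<lambda>j x. ennreal (\<phi> j x)" and S=S and B="?B", OF prior(1) model f0s])
    show "{f\<in>F. m * \<epsilon> \<le> d f} \<in> sets Pr" "?B \<in> sets Pr" by (rule sd)+
    show "{f\<in>F. m * \<epsilon> \<le> d f} \<subseteq> (\<Union>j. S j)" by (rule cover)
    show "emeasure (P f0) {x\<in>space \<mu>. (\<integral>\<^sup>+f\<in>?B. p f x \<partial>Pr) < ennreal c' * emeasure Pr ?B * p f0 x} \<le> 2 * ennreal (exp (\<beta> - \<alpha> * D))"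
      by (rule ev)
    show "(\<integral>\<^sup>+x. ennreal (\<phi> j x) \<partial>P f0) \<le> ennreal (exp (?N - K * real n * (real (J + j) * \<epsilon>)\<^sup>2))" for j by (rule t1)
    show "S j \<in> sets Pr" for j unfolding S_def by (intro sets.Int sd)
    show "0 < ennreal c' * emeasure Pr ?B" using c' b by (simp add: eB ennreal_zero_less_mult_iff)
    show "(\<lambda>x. ennreal (\<phi> j x)) \<in> borel_measurable \<mu>" for j using \<phi>m by measurable
    show "x \<in> space \<mu> \<Longrightarrow> ennreal (\<phi> j x) \<le> 1" for j x using \<phi>b by simp
    fix j f assume f: "f \<in> S j"
    then have fF: "f \<in> F" by (simp add: S_def)
    have "(\<integral>\<^sup>+x. 1 - ennreal (\<phi> j x) \<partial>P f) = (\<integral>\<^sup>+x. ennreal (1 - \<phi> j x) \<partial>P f)"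
      using \<phi>b by (intro nn_integral_cong) (simp add: P_dens[OF fF] ennreal_minus flip: ennreal_1)
    then show "(\<integral>\<^sup>+x. 1 - ennreal (\<phi> j x) \<partial>P f) \<le> ennreal (exp (C2 * ?N - K * real n * (real (J + j) * \<epsilon>)\<^sup>2 / 2))"
      using t2[OF f] by simp
  qed
  have shell_term: "ennreal (exp (?N - K * real n * (real (J + j) * \<epsilon>)\<^sup>2)) +
       ennreal (exp (C2 * ?N - K * real n * (real (J + j) * \<epsilon>)\<^sup>2 / 2)) * emeasure Pr (S j) / (ennreal c' * emeasure Pr ?B)
     \<le> ennreal ((1 + 2 * C) * ?\<rho> ^ J * ?\<rho> ^ j)" for j
  proof -
    let ?j = "J + j"
    have sq: "K * real n * (real ?j * \<epsilon>)\<^sup>2 = K * (?N * (real ?j)\<^sup>2)" by (simp add: power_mult_distrib)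
    have j3: "3 \<le> ?j" using J(1) by simp
    have "(real J)\<^sup>2 \<le> (real ?j)\<^sup>2" by (intro power_mono) auto
    then have "K * (real J)\<^sup>2 / 8 \<le> K * (real ?j)\<^sup>2 / 8" using K by simp
    then have big: "C2 + D + 1 \<le> K * (real ?j)\<^sup>2 / 8" using J(3) by linarith
    have "0 \<le> C2" unfolding C2_def by (intro mult_nonneg_nonneg divide_nonneg_pos add_nonneg_nonneg) auto
    then have pos: "0 \<le> C2 + D" using D(1) by simp
    note ex = contraction_exponents[OF K \<epsilon>(2) j3 big pos]
    have "exp (- (K / 8 * real ?j)) = exp (real ?j * (- K / 8))" by (rule arg_cong[where f=exp]) simp
    also have "\<dots> = ?\<rho> ^ ?j" by (rule exp_of_nat_mult)
    also have "\<dots> = ?\<rho> ^ J * ?\<rho> ^ j" by (rule power_add)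
    finally have \<rho>: "exp (- (K / 8 * real ?j)) = ?\<rho> ^ J * ?\<rho> ^ j" .
    have 1: "exp (?N - K * (?N * (real ?j)\<^sup>2)) \<le> ?\<rho> ^ J * ?\<rho> ^ j" unfolding \<rho>[symmetric] by (rule exp_mono[OF ex(1)])
    let ?s = "measure Pr (S j)"
    have "?s \<le> measure Pr {f\<in>F. d f \<le> real (Suc ?j) * \<epsilon>}"
      by (intro Pr.finite_measure_mono sd) (auto simp: S_def)
    then have "?s / b \<le> measure Pr {f\<in>F. d f \<le> real (Suc ?j) * \<epsilon>} / b" using b by (intro divide_right_mono) auto
    also have "\<dots> \<le> C * exp (K * real n * \<epsilon>\<^sup>2 * (real (Suc ?j))\<^sup>2 / 8)" unfolding b_def by (rule prior_ratio) simp
    finally have sb: "?s / b \<le> C * exp (K * (?N * (real (Suc ?j))\<^sup>2) / 8)" by (simp only: mult.assoc)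
    have "exp (C2 * ?N - K * (?N * (real ?j)\<^sup>2) / 2) * ?s / (c' * b) = exp (C2 * ?N - K * (?N * (real ?j)\<^sup>2) / 2) / c' * (?s / b)"
      by simp
    also have "\<dots> \<le> exp (C2 * ?N - K * (?N * (real ?j)\<^sup>2) / 2) / c' * (C * exp (K * (?N * (real (Suc ?j))\<^sup>2) / 8))"
      using c' by (intro mult_left_mono sb) auto
    also have "\<dots> = 2 * C * (exp (C2 * ?N - K * (?N * (real ?j)\<^sup>2) / 2) * exp (D * ?N) * exp (K * (?N * (real (Suc ?j))\<^sup>2) / 8))"
    proof -
      have "c' * (2 * exp (D * ?N)) = 1" by (simp add: c'_def mult_exp_exp)
      then have "inverse c' = 2 * exp (D * ?N)" by (rule inverse_unique)
      then have "x / c' = x * (2 * exp (D * ?N))" for x by (simp only: divide_inverse)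
      then show ?thesis by (simp only: mult_ac)
    qed
    also have "\<dots> = 2 * C * exp (C2 * ?N - K * (?N * (real ?j)\<^sup>2) / 2 + D * ?N + K * (?N * (real (Suc ?j))\<^sup>2) / 8)"
      by (simp only: mult_exp_exp)
    also have "\<dots> \<le> 2 * C * (?\<rho> ^ J * ?\<rho> ^ j)" unfolding \<rho>[symmetric] using C by (intro mult_left_mono exp_mono[OF ex(2)]) auto
    finally have 2: "exp (C2 * ?N - K * (?N * (real ?j)\<^sup>2) / 2) * ?s / (c' * b) \<le> 2 * C * (?\<rho> ^ J * ?\<rho> ^ j)" .
    have "ennreal (exp (?N - K * (?N * (real ?j)\<^sup>2))) + ennreal (exp (C2 * ?N - K * (?N * (real ?j)\<^sup>2) / 2)) * emeasure Pr (S j) / (ennreal c' * emeasure Pr ?B)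
      = ennreal (exp (?N - K * (?N * (real ?j)\<^sup>2)) + exp (C2 * ?N - K * (?N * (real ?j)\<^sup>2) / 2) * ?s / (c' * b))"
    proof -
      have "ennreal x + ennreal y * ennreal z / (ennreal c' * ennreal b) = ennreal (x + y * z / (c' * b))"
        if "0 \<le> x" "0 \<le> y" "0 \<le> z" for x y z
        using that c' b by (simp add: ennreal_mult[symmetric] divide_ennreal flip: ennreal_plus)
      then show ?thesis unfolding eB Pr.emeasure_eq_measure[of "S j"] by simp
    qed
    also have "\<dots> \<le> ennreal (?\<rho> ^ J * ?\<rho> ^ j + 2 * C * (?\<rho> ^ J * ?\<rho> ^ j))" by (intro ennreal_leI add_mono 1 2)
    also have "?\<rho> ^ J * ?\<rho> ^ j + 2 * C * (?\<rho> ^ J * ?\<rho> ^ j) = (1 + 2 * C) * ?\<rho> ^ J * ?\<rho> ^ j" by (simp add: algebra_simps)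
    finally show ?thesis unfolding sq .
  qed
  have \<rho>1: "?\<rho> < 1" using K by simp
  have "(\<lambda>j. (1 + 2 * C) * ?\<rho> ^ J * ?\<rho> ^ j) sums ((1 + 2 * C) * ?\<rho> ^ J * (1 / (1 - ?\<rho>)))"
    by (intro sums_mult geometric_sums) (use \<rho>1 in simp)
  then have "(\<Sum>j. ennreal ((1 + 2 * C) * ?\<rho> ^ J * ?\<rho> ^ j)) = ennreal ((1 + 2 * C) * ?\<rho> ^ J * (1 / (1 - ?\<rho>)))"
    using C by (intro suminf_ennreal_eq) auto
  moreover have "(\<Sum>j. ennreal (exp (?N - K * real n * (real (J + j) * \<epsilon>)\<^sup>2)) +
       ennreal (exp (C2 * ?N - K * real n * (real (J + j) * \<epsilon>)\<^sup>2 / 2)) * emeasure Pr (S j) / (ennreal c' * emeasure Pr ?B))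
     \<le> (\<Sum>j. ennreal ((1 + 2 * C) * ?\<rho> ^ J * ?\<rho> ^ j))"
    by (intro suminf_le shell_term) auto
  ultimately have "(\<integral>\<^sup>+x. posterior Pr p {f\<in>F. m * \<epsilon> \<le> d f} x \<partial>P f0) \<le> 2 * ennreal (exp (\<beta> - \<alpha> * D)) + ennreal ((1 + 2 * C) * ?\<rho> ^ J * (1 / (1 - ?\<rho>)))"
    by (intro order_trans[OF main] add_left_mono) simp
  also have "\<dots> = ennreal (2 * exp (\<beta> - \<alpha> * D) + (1 + 2 * C) * (?\<rho> ^ J / (1 - ?\<rho>)))"
    using C \<rho>1 by (subst ennreal_plus) (auto simp: ennreal_mult' mult.assoc)
  finally show ?thesis .
qed

theorem theorem7:
  fixes \<Gamma> M \<xi> K :: real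
    and W :: "(real \<Rightarrow> real) \<Rightarrow> 'w measure"
    and X :: "(real \<Rightarrow> real) \<Rightarrow> int \<Rightarrow> 'w \<Rightarrow> real"
    and P :: "nat \<Rightarrow> (real \<Rightarrow> real) \<Rightarrow> (nat \<Rightarrow> real) measure"
    and F :: "(real \<Rightarrow> real) set"
    and Pr :: "(real \<Rightarrow> real) measure"
    and \<mu> :: "nat \<Rightarrow> (nat \<Rightarrow> real) measure"
    and p :: "nat \<Rightarrow> (real \<Rightarrow> real) \<Rightarrow> (nat \<Rightarrow> real) \<Rightarrow> ennreal"
    and f0 :: "real \<Rightarrow> real"
    and \<epsilon> :: "nat \<Rightarrow> real"
    and Mn :: "nat \<Rightarrow> real"
  assumes series: "\<And>f. regular_density \<Gamma> M f \<Longrightarrow> stationary_gaussian_series (W f) (X f) f"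
    and P_eq: "\<And>n f. P n f = sample_law (W f) (X f) n"
    and constants: "testing_constants P \<Gamma> M \<xi> K"
    and F_bounds: "\<And>f. f \<in> F \<Longrightarrow> regular_density \<Gamma> M f"
    and f0: "f0 \<in> F"
    and prior: "prob_space Pr" "space Pr = F"
    and dist_measurable: "(\<lambda>f. l2_norm (\<lambda>l. f l - f0 l)) \<in> borel_measurable Pr"
    and dominated: "\<And>n. n \<ge> 1 \<Longrightarrow> dominated_model Pr (P n) (\<mu> n) (p n)"
    and rate: "\<And>n. n \<ge> 1 \<Longrightarrow> \<epsilon> n \<ge> 1 / sqrt (real n)"
    and entropy: "\<And>n. n \<ge> 1 \<Longrightarrow>
        (SUP e\<in>{\<epsilon> n<..}.
           log_covering_number (\<xi> * e / 2) {f\<in>F. l2_norm (\<lambda>l. f l - f0 l) \<le> e})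
        \<le> ereal (real n * (\<epsilon> n)\<^sup>2)"
    and prior_pos: "\<And>n. n \<ge> 1 \<Longrightarrow>
        measure Pr {f\<in>F. l2_norm (\<lambda>l. f l - f0 l) \<le> \<epsilon> n} > 0"
    and prior_ratio: "\<exists>C>0. \<forall>n\<ge>1. \<forall>j::nat. j \<ge> 1 \<longrightarrow>
        measure Pr {f\<in>F. l2_norm (\<lambda>l. f l - f0 l) \<le> real j * \<epsilon> n} /
        measure Pr {f\<in>F. l2_norm (\<lambda>l. f l - f0 l) \<le> \<epsilon> n}
        \<le> C * exp (K * real n * (\<epsilon> n)\<^sup>2 * (real j)\<^sup>2 / 8)"
    and Mn: "filterlim Mn at_top sequentially"
  shows "(\<lambda>n. \<integral>\<^sup>+x. posterior Pr (p n) {f\<in>F. l2_norm (\<lambda>l. f l - f0 l) \<ge> Mn n * \<epsilon> n} x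
              \<partial>(P n f0)) \<longlonglongrightarrow> 0"
proof -
  define \<alpha> where "\<alpha> = exp (- 2 * \<Gamma>) / 2"
  define \<beta> where "\<beta> = (\<alpha> * exp (2 * \<Gamma>) / 2 + \<alpha>\<^sup>2) * exp (2 * \<Gamma>) / (2 * pi)"
  define C2 where "C2 = (exp (2 * \<Gamma>) / 2 + 1) * exp (2 * \<Gamma>) / 2 * \<xi>\<^sup>2"
  define d where "d f = l2_norm (\<lambda>l. f l - f0 l)" for f
  have \<alpha>: "0 < \<alpha>" by (simp add: \<alpha>_def)
  obtain C where C: "0 < C" and ratio: "\<And>n j. 1 \<le> n \<Longrightarrow> 1 \<le> j \<Longrightarrow>
        measure Pr {f\<in>F. d f \<le> real j * \<epsilon> n} / measure Pr {f\<in>F. d f \<le> \<epsilon> n} \<le> C * exp (K * real n * (\<epsilon> n)\<^sup>2 * (real j)\<^sup>2 / 8)"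
    using prior_ratio unfolding d_def by blast
  obtain c0 where "0 < \<xi>" and K: "0 < K" and c0: "0 < c0"
    and test: "\<And>n e f0 f1. 1 \<le> n \<Longrightarrow> c0 / sqrt (real n) \<le> e \<Longrightarrow> regular_density \<Gamma> M f0 \<Longrightarrow> regular_density \<Gamma> M f1 \<Longrightarrow>
       e \<le> l2_norm (\<lambda>l. f1 l - f0 l) \<Longrightarrow>
       \<exists>\<phi>. is_test n \<phi> \<and> (LINT x|P n f0. \<phi> x) \<le> exp (- K * real n * e\<^sup>2) \<and>
         (\<forall>f. regular_density \<Gamma> M f \<longrightarrow> (\<forall>l\<in>{-pi<..pi}. \<bar>f l - f1 l\<bar> \<le> \<xi> * e) \<longrightarrow>
           (LINT x|P n f. 1 - \<phi> x) \<le> exp (- K * real n * e\<^sup>2))"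
    by (rule testing_constantsE[OF P_eq series constants that])
  let ?\<rho> = "exp (- K / 8)"
  let ?tail = "\<lambda>J. (1 + 2 * C) * (?\<rho> ^ J / (1 - ?\<rho>))"
  let ?I = "\<lambda>n. \<integral>\<^sup>+x. posterior Pr (p n) {f\<in>F. Mn n * \<epsilon> n \<le> d f} x \<partial>P n f0"
  have \<rho>: "0 < ?\<rho>" "?\<rho> < 1" using K by simp_all
  have bound: "?I n \<le> ennreal (2 * exp (\<beta> - \<alpha> * D) + ?tail J)"
    if n: "1 \<le> n" and D: "0 < D" "\<beta> \<le> \<alpha> * D" and J: "3 \<le> J" "2 * exp (2 * \<Gamma>) \<le> real J" "C2 + D + 1 \<le> K * (real J)\<^sup>2 / 8" "c0 \<le> real J"
      and m: "real J < Mn n" for n D J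
  proof -
    have sn: "0 < sqrt (real n)" using n by simp
    have \<epsilon>pos: "0 < \<epsilon> n" using rate[OF n] sn by (meson divide_pos_pos less_le_trans zero_less_one)
    have "1 \<le> \<epsilon> n * sqrt (real n)" using rate[OF n] sn by (simp add: field_simps)
    then have "1\<^sup>2 \<le> (\<epsilon> n * sqrt (real n))\<^sup>2" by (intro power_mono) auto
    then have N1: "1 \<le> real n * (\<epsilon> n)\<^sup>2" by (simp add: power_mult_distrib mult.commute)
    have Pn: "P n = (\<lambda>f. sample_law (W f) (X f) n)" using P_eq by auto
    show ?thesis unfolding Pn \<alpha>_def \<beta>_def d_def
    proof (rule posterior_contraction_bound[OF series F_bounds f0 prior dist_measurable dominated[OF n, unfolded Pn] \<epsilon>pos N1 _ _
          prior_pos[OF n] ratio[OF n, unfolded d_def] K C D(1) D(2)[unfolded \<alpha>_def \<beta>_def] J(1,2) J(3)[unfolded C2_def] m])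
      fix j f1 assume j: "J \<le> j" and f1: "regular_density \<Gamma> M f1" and far: "real j * \<epsilon> n \<le> l2_norm (\<lambda>l. f1 l - f0 l)"
      have "c0 / sqrt (real n) = c0 * (1 / sqrt (real n))" by simp
      \<comment> \<open>The requirement \<open>c0 \<le> J\<close> together with the minimal rate
        puts every shell radius in the range where tests exist.\<close>
      also have "\<dots> \<le> real j * \<epsilon> n" using J(4) j c0 rate[OF n] by (intro mult_mono) auto
      finally show "\<exists>\<phi>. is_test n \<phi> \<and> (LINT x|sample_law (W f0) (X f0) n. \<phi> x) \<le> exp (- K * real n * (real j * \<epsilon> n)\<^sup>2) \<and>
         (\<forall>f. regular_density \<Gamma> M f \<longrightarrow> (\<forall>l\<in>{-pi<..pi}. \<bar>f l - f1 l\<bar> \<le> \<xi> * (real j * \<epsilon> n)) \<longrightarrow>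
           (LINT x|sample_law (W f) (X f) n. 1 - \<phi> x) \<le> exp (- K * real n * (real j * \<epsilon> n)\<^sup>2))"
        using test[OF n _ F_bounds[OF f0] f1 far] unfolding P_eq by blast
    next
      fix e assume "\<epsilon> n < e"
      then show "log_covering_number (\<xi> * e / 2) {f\<in>F. l2_norm (\<lambda>l. f l - f0 l) \<le> e} \<le> ereal (real n * (\<epsilon> n)\<^sup>2)"
        using entropy[OF n] by (simp add: SUP_le_iff)
    qed
  qed
  \<comment> \<open>\<open>D\<close> is fixed before \<open>J\<close>, since the condition on
    \<open>K * J^2\<close> involves \<open>D\<close>; each choice accounts for half of the error.
    Neither depends on \<open>n\<close>, so divergence of \<open>Mn\<close> finishes the
    argument.\<close>
  have "\<forall>\<^sub>F n in sequentially. ?I n < \<eta>" if \<eta>: "0 < \<eta>" for \<eta>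
  proof -
    \<comment> \<open>A real level strictly below \<eta>, which may be \<open>top\<close>.\<close>
    obtain h where h: "0 < h" "ennreal h < \<eta>"
      using dense[OF \<eta>] by (metis ennreal_cases ennreal_less_zero_iff less_trans not_less_iff_gr_or_eq order_less_le top_greatest ennreal_zero_less_top)
    have "((\<lambda>D. 2 * exp (\<beta> - \<alpha> * D)) \<longlongrightarrow> 0) at_top" using \<alpha> by real_asymp
    then have "\<forall>\<^sub>F D in at_top. 2 * exp (\<beta> - \<alpha> * D) < h / 2" using h(1) by (intro order_tendstoD(2)) auto
    moreover have "\<forall>\<^sub>F D in at_top. \<beta> \<le> \<alpha> * D" using \<alpha> by real_asymp
    moreover have "\<forall>\<^sub>F D in at_top. 0 < (D::real)" by (rule eventually_gt_at_top)
    ultimately have "\<forall>\<^sub>F D in at_top. 2 * exp (\<beta> - \<alpha> * D) < h / 2 \<and> \<beta> \<le> \<alpha> * D \<and> 0 < D" by eventually_elim auto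
    then obtain D where D: "2 * exp (\<beta> - \<alpha> * D) < h / 2" "\<beta> \<le> \<alpha> * D" "0 < D"
      using eventually_happens'[OF trivial_limit_at_top_linorder] by blast
    have "?tail \<longlonglongrightarrow> (1 + 2 * C) * (0 / (1 - ?\<rho>))"
      using \<rho> by (intro tendsto_intros LIMSEQ_power_zero) auto
    then have "\<forall>\<^sub>F J in sequentially. ?tail J < h / 2" using h(1) by (intro order_tendstoD(2)[where y="(1 + 2 * C) * (0 / (1 - ?\<rho>))"]) auto
    moreover have "\<forall>\<^sub>F J in sequentially. C2 + D + 1 \<le> K * (real J)\<^sup>2 / 8" using K by real_asymp
    moreover have "\<forall>\<^sub>F J in sequentially. 2 * exp (2 * \<Gamma>) \<le> real J" by real_asymp
    moreover have "\<forall>\<^sub>F J in sequentially. c0 \<le> real J" by real_asymp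
    moreover have "\<forall>\<^sub>F J in sequentially. 3 \<le> J" by (rule eventually_ge_at_top)
    ultimately have "\<forall>\<^sub>F J in sequentially. ?tail J < h / 2 \<and> C2 + D + 1 \<le> K * (real J)\<^sup>2 / 8 \<and> 2 * exp (2 * \<Gamma>) \<le> real J \<and> c0 \<le> real J \<and> 3 \<le> J"
      by eventually_elim auto
    then obtain J where J: "?tail J < h / 2" "C2 + D + 1 \<le> K * (real J)\<^sup>2 / 8" "2 * exp (2 * \<Gamma>) \<le> real J" "c0 \<le> real J" "3 \<le> J"
      using eventually_happens'[OF sequentially_bot] by blast
    have "\<forall>\<^sub>F n in sequentially. real J < Mn n" using Mn by (simp add: filterlim_at_top_dense)
    moreover have "\<forall>\<^sub>F n in sequentially. 1 \<le> n" by (rule eventually_ge_at_top)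
    ultimately show ?thesis
    proof eventually_elim
      case (elim n)
      have "?I n \<le> ennreal (2 * exp (\<beta> - \<alpha> * D) + ?tail J)"
        by (rule bound[OF elim(2) D(3,2) J(5,3,2,4) elim(1)])
      also have "\<dots> \<le> ennreal h" using D(1) J(1) by (intro ennreal_leI) linarith
      also have "\<dots> < \<eta>" by (rule h(2))
      finally show ?case .
    qed
  qed
  then have "?I \<longlonglongrightarrow> 0" by (intro order_tendstoI) auto
  then show ?thesis by (simp add: d_def)
qed

end
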